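(* Let $p\ge 1$ and let $\Sigma^n$ be a complete noncompact properly immersed self-shrinker in Euclidean space $\mathbb{R}^{n+p}$, with mean curvature vector $\mathbf{H}$, and let $\beta$ be a nonnegative constant with $\beta\le\inf_\Sigma|\mathbf{H}|^2$. Then there is a positive constant $C$ such that for all $r\ge 1$ $$\operatorname{Vol}(B_r(0)\cap\Sigma)\le C r^{n-2\beta}.$$
   Context: Let $\Sigma$ be an $n$-dimensional submanifold isometrically immersed in $\mathbb{R}^{n+p}$, with second fundamental form $A(V,W)=\overline\nabla_V W-\nabla_V W$ for $V,W\in T\Sigma$ ($\overline\nabla$ the flat connection of $\mathbb{R}^{n+p}$, $\nabla$ the Levi-Civita connection of $\Sigma$). The mean curvature vector is $\mathbf{H}=\sum_{i=1}^n A(e_i,e_i)$, where $\{e_i\}$ is a local orthonormal frame of $\Sigma$. $\Sigma$ is a self-shrinker if $\mathbf{H}=-\frac{x^N}{2}$, where $x$ is the position vector and $(\cdot)^N$ denotes orthogonal projection to the normal bundle of $\Sigma$. Complete means that the induced Riemannian metric on $\Sigma$ is complete; properly immersed means that the immersion $\Sigma\to\mathbb{R}^{n+p}$ is a proper map. $B_r(0)=\{x\in\mathbb{R}^{n+p}:|x|<r\}$, and $\operatorname{Vol}(B_r(0)\cap\Sigma)$ is the $n$-dimensional volume, in the induced metric, of the set of points of $\Sigma$ whose position vector $x$ satisfies $|x|<r$. *)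

theory Defs
  imports "HOL-Analysis.Analysis"
begin

section \<open>Smooth manifolds\<close>

text \<open>\<open>Ck_on k S f\<close> and \<open>smooth_on S f\<close> are only used for open \<open>S\<close> and finite-dimensional domains,
  where continuity of all iterated directional derivatives is the usual notion.\<close>

primrec Ck_on :: "nat \<Rightarrow> 'a::real_normed_vector set \<Rightarrow> ('a \<Rightarrow> 'b::real_normed_vector) \<Rightarrow> bool" where
  "Ck_on 0 S f \<longleftrightarrow> continuous_on S f"
| "Ck_on (Suc k) S f \<longleftrightarrow>
     f differentiable_on S \<and> (\<forall>v. Ck_on k S (\<lambda>u. frechet_derivative f (at u) v))"

definition smooth_on :: "'a::real_normed_vector set \<Rightarrow> ('a \<Rightarrow> 'b::real_normed_vector) \<Rightarrow> bool" where
  "smooth_on S f \<longleftrightarrow> (\<forall>k. Ck_on k S f)"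

text \<open>The manifold is a whole type \<open>'m\<close> (a Hausdorff, second countable space). A chart is a pair
  of an open domain and a coordinate map, which is only meaningful on that domain.\<close>

type_synonym ('m, 'n) chart = "'m set \<times> ('m \<Rightarrow> real^'n)"

definition is_chart :: "('m::topological_space, 'n::finite) chart \<Rightarrow> bool" where
  "is_chart c \<longleftrightarrow> open (fst c) \<and> open (snd c ` fst c) \<and>
     (\<exists>\<psi>. homeomorphism (fst c) (snd c ` fst c) (snd c) \<psi>)"

definition chart_inv :: "('m, 'n::finite) chart \<Rightarrow> real^'n \<Rightarrow> 'm" where
  "chart_inv c = inv_into (fst c) (snd c)"

text \<open>The atlas is not required to be maximal: everything below depends only on the smooth
  structure it generates.\<close>

definition smooth_atlas :: "('m::topological_space, 'n::finite) chart set \<Rightarrow> bool" where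
  "smooth_atlas \<A> \<longleftrightarrow>
     (\<forall>c\<in>\<A>. is_chart c) \<and> (\<Union>c\<in>\<A>. fst c) = UNIV \<and>
     (\<forall>c\<in>\<A>. \<forall>d\<in>\<A>. smooth_on (snd c ` (fst c \<inter> fst d)) (snd d \<circ> chart_inv c))"

definition chart_at :: "('m, 'n::finite) chart set \<Rightarrow> 'm \<Rightarrow> ('m, 'n) chart" where
  "chart_at \<A> q = (SOME c. c \<in> \<A> \<and> q \<in> fst c)"

section \<open>Immersions and the induced metric\<close>

definition smooth_immersion ::
    "('m::topological_space, 'n::finite) chart set \<Rightarrow> ('m \<Rightarrow> 'a::euclidean_space) \<Rightarrow> bool" where
  "smooth_immersion \<A> x \<longleftrightarrow>
     (\<forall>c\<in>\<A>. smooth_on (snd c ` fst c) (x \<circ> chart_inv c) \<and>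
        (\<forall>u\<in>snd c ` fst c. inj (frechet_derivative (x \<circ> chart_inv c) (at u))))"

text \<open>In the following definitions \<open>f\<close> is the coordinate expression \<open>x \<circ> chart_inv c\<close> of the
  immersion, and tangent vectors and vector fields are given by their coordinates.\<close>

definition induced_metric ::
    "('e::real_normed_vector \<Rightarrow> 'a::euclidean_space) \<Rightarrow> 'e \<Rightarrow> 'e \<Rightarrow> 'e \<Rightarrow> real" where
  "induced_metric f u v w = frechet_derivative f (at u) v \<bullet> frechet_derivative f (at u) w"

text \<open>The Levi-Civita connection has the form \<open>\<nabla>\<^sub>V W = DW(V) + \<Gamma>(V, W)\<close> in coordinates, where the
  bilinear map \<open>\<Gamma>\<close> is determined by vanishing torsion (symmetry) and compatibility with the
  metric.\<close>

definition christoffel ::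
    "('e::real_normed_vector \<Rightarrow> 'e \<Rightarrow> 'e \<Rightarrow> real) \<Rightarrow> 'e \<Rightarrow> 'e \<Rightarrow> 'e \<Rightarrow> 'e" where
  "christoffel g u = (THE \<Gamma>. bilinear \<Gamma> \<and> (\<forall>v w. \<Gamma> v w = \<Gamma> w v) \<and>
     (\<forall>v w z. frechet_derivative (\<lambda>y. g y w z) (at u) v = g u (\<Gamma> v w) z + g u w (\<Gamma> v z)))"

definition levi_civita ::
    "('e::real_normed_vector \<Rightarrow> 'e \<Rightarrow> 'e \<Rightarrow> real) \<Rightarrow> ('e \<Rightarrow> 'e) \<Rightarrow> ('e \<Rightarrow> 'e) \<Rightarrow> 'e \<Rightarrow> 'e" where
  "levi_civita g V W u = frechet_derivative W (at u) (V u) + christoffel g u (V u) (W u)"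

text \<open>\<open>A(V, W)\<close>: the field \<open>W\<close> is, in the ambient space, \<open>y \<mapsto> Df\<^sub>y (W y)\<close>, and its flat derivative
  along \<open>V\<close> is the first term.\<close>

definition second_fundamental_form ::
    "('e::real_normed_vector \<Rightarrow> 'a::euclidean_space) \<Rightarrow> ('e \<Rightarrow> 'e) \<Rightarrow> ('e \<Rightarrow> 'e) \<Rightarrow> 'e \<Rightarrow> 'a" where
  "second_fundamental_form f V W u =
     frechet_derivative (\<lambda>y. frechet_derivative f (at y) (W y)) (at u) (V u)
     - frechet_derivative f (at u) (levi_civita (induced_metric f) V W u)"

definition tangent_onb :: "(real^'n \<Rightarrow> 'a::euclidean_space) \<Rightarrow> real^'n \<Rightarrow> (real^'n) set \<Rightarrow> bool" where
  "tangent_onb f u B \<longleftrightarrow> card B = CARD('n) \<and>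
     (\<forall>v\<in>B. \<forall>w\<in>B. induced_metric f u v w = (if v = w then 1 else 0))"

text \<open>Since \<open>A\<close> is tensorial, \<open>A(e\<^sub>i, e\<^sub>i)\<close> at a point depends only on the values of the frame at
  that point; these are extended by constant coordinates. The sum depends neither on the chosen
  basis nor on the chosen chart.\<close>

definition mean_curvature ::
    "('m, 'n::finite) chart set \<Rightarrow> ('m \<Rightarrow> 'a::euclidean_space) \<Rightarrow> 'm \<Rightarrow> 'a" where
  "mean_curvature \<A> x q =
     (let c = chart_at \<A> q; f = x \<circ> chart_inv c; u = snd c q
      in \<Sum>e\<in>(SOME B. tangent_onb f u B). second_fundamental_form f (\<lambda>_. e) (\<lambda>_. e) u)"

definition tangent_space ::
    "('m, 'n::finite) chart set \<Rightarrow> ('m \<Rightarrow> 'a::euclidean_space) \<Rightarrow> 'm \<Rightarrow> 'a set" where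
  "tangent_space \<A> x q =
     (let c = chart_at \<A> q in range (frechet_derivative (x \<circ> chart_inv c) (at (snd c q))))"

definition normal_part ::
    "('m, 'n::finite) chart set \<Rightarrow> ('m \<Rightarrow> 'a::euclidean_space) \<Rightarrow> 'm \<Rightarrow> 'a \<Rightarrow> 'a" where
  "normal_part \<A> x q v = closest_point (orthogonal_comp (tangent_space \<A> x q)) v"

definition self_shrinker ::
    "('m::topological_space, 'n::finite) chart set \<Rightarrow> ('m \<Rightarrow> 'a::euclidean_space) \<Rightarrow> bool" where
  "self_shrinker \<A> x \<longleftrightarrow> smooth_atlas \<A> \<and> smooth_immersion \<A> x \<and>
     (\<forall>q. mean_curvature \<A> x q = - (1/2) *\<^sub>R normal_part \<A> x q (x q))"

section \<open>Completeness\<close>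

definition piecewise_C1_curve ::
    "('m::topological_space, 'n::finite) chart set \<Rightarrow> (real \<Rightarrow> 'm) \<Rightarrow> bool" where
  "piecewise_C1_curve \<A> \<gamma> \<longleftrightarrow> continuous_on {0..1} \<gamma> \<and>
     (\<forall>c\<in>\<A>. \<forall>a b. {a..b} \<subseteq> {0..1} \<and> \<gamma> ` {a..b} \<subseteq> fst c \<longrightarrow>
        (snd c \<circ> \<gamma>) piecewise_C1_differentiable_on {a..b})"

text \<open>The length of \<open>\<gamma>'\<close> in the induced metric is the Euclidean length of \<open>(x \<circ> \<gamma>)'\<close>. The value is
  an extended real because \<^const>\<open>piecewise_C1_differentiable_on\<close> allows unbounded derivatives.\<close>

definition curve_length :: "('m \<Rightarrow> 'a::euclidean_space) \<Rightarrow> (real \<Rightarrow> 'm) \<Rightarrow> ennreal" where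
  "curve_length x \<gamma> =
     (\<integral>\<^sup>+t\<in>{0..1}. ennreal (norm (vector_derivative (x \<circ> \<gamma>) (at t))) \<partial>lborel)"

text \<open>The distance between different connected components is \<open>\<infinity>\<close>.\<close>

definition riemannian_dist ::
    "('m::topological_space, 'n::finite) chart set \<Rightarrow> ('m \<Rightarrow> 'a::euclidean_space) \<Rightarrow>
     'm \<Rightarrow> 'm \<Rightarrow> ennreal" where
  "riemannian_dist \<A> x q q' =
     Inf {curve_length x \<gamma> |\<gamma>. piecewise_C1_curve \<A> \<gamma> \<and> \<gamma> 0 = q \<and> \<gamma> 1 = q'}"

definition complete_immersed ::
    "('m::topological_space, 'n::finite) chart set \<Rightarrow> ('m \<Rightarrow> 'a::euclidean_space) \<Rightarrow> bool" where
  "complete_immersed \<A> x \<longleftrightarrow>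
     (\<forall>s. (\<forall>\<epsilon>>0. \<exists>N. \<forall>i\<ge>N. \<forall>j\<ge>N. riemannian_dist \<A> x (s i) (s j) < \<epsilon>) \<longrightarrow>
        (\<exists>q. (\<lambda>i. riemannian_dist \<A> x (s i) q) \<longlonglongrightarrow> 0))"

section \<open>Volume\<close>

definition volume_density :: "(real^'n \<Rightarrow> 'a::euclidean_space) \<Rightarrow> real^'n \<Rightarrow> real" where
  "volume_density f u =
     sqrt (det (\<chi> i j. induced_metric f u (axis i 1) (axis j 1) :: real^'n^'n))"

definition riemannian_volume ::
    "('m::topological_space, 'n::finite) chart set \<Rightarrow> ('m \<Rightarrow> 'a::euclidean_space) \<Rightarrow> 'm measure" where
  "riemannian_volume \<A> x = (THE \<mu>. sets \<mu> = sets borel \<and>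
     (\<forall>c\<in>\<A>. \<forall>S\<in>sets borel. S \<subseteq> fst c \<longrightarrow>
        emeasure \<mu> S =
          (\<integral>\<^sup>+u\<in>snd c ` S. ennreal (volume_density (x \<circ> chart_inv c) u) \<partial>lborel)))"

end

theory Submission
  imports Defs
begin

text \<open>Put \<open>s = |x|\<^sup>2\<close> and \<open>w = |H|\<^sup>2 = |x\<^sup>N|\<^sup>2 / 4\<close>, so that \<open>|x\<^sup>T|\<^sup>2 = s - 4 w\<close> and, by the
  self-shrinker equation, \<open>div x\<^sup>T = n - 2 w\<close>. The divergence theorem for \<open>\<phi>(s) x\<^sup>T\<close>, where \<open>\<phi>(s)\<close>
  has compact support because \<open>x\<close> is proper, gives
  \<open>\<integral> 2 \<phi>'(s) (s - 4 w) + \<phi>(s) (n - 2 w) = 0\<close>. With \<open>\<phi>(s) = \<psi>(s) exp(-s / 4t)\<close> for a nonincreasing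
  cutoff \<open>\<psi>\<close> and \<open>w \<ge> \<beta>\<close> this becomes, for \<open>t \<ge> 1\<close>, the differential inequality
  \<open>J' \<le> ((n / 2 - \<beta>) / t + \<beta> / t\<^sup>2) J\<close> for \<open>J(t) = \<integral> \<psi>(s) exp(-s / 4t)\<close>; hence
  \<open>J(t) \<le> exp(\<beta>) t\<^bsup>n/2 - \<beta>\<^esup> J(1)\<close>. The case \<open>t = 2\<close> bounds \<open>J(1)\<close> independently of \<open>\<psi>\<close>, since
  \<open>exp(-s/4)\<close> is much smaller than \<open>exp(-s/8)\<close> for large \<open>s\<close>. Taking \<open>t = r\<^sup>2\<close> and \<open>\<psi> = 1\<close> on
  \<open>[0, r\<^sup>2]\<close> gives the volume bound.\<close>

subsection \<open>Functions of class \<open>C\<^sup>1\<close>\<close>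

text \<open>In div x^T the derivative of the position contributes n, and the removed normal part
  contributes the pairing of x^N with H, which is -|x^N|^2 / 2 = -2 w. In the differential
  inequality the \<open>\<psi>'\<close> term has a favourable sign because 4 w <= s, and the terms
  in w combine to -2 w (1 - 1/t); this is why t >= 1 is needed before w can be replaced by \<beta>.
  The final constant must not depend on the cutoff, yet without the cutoff no integral is known to
  be finite. Comparing t = 1 with t = 2 gives J(1) <= m + J(1) / 2, where m is the volume of a fixed
  sublevel set of s, and the last term is absorbed. The divergence theorem is brought down to one
  fact about compactly supported C1 functions on Euclidean space: bump functions localise to single
  charts, where x^T has coordinates given by Cramer's rule. The volume measure is given by a
  definite description, so its existence and uniqueness have to be proved; both rest on gluing over
  countably many charts, and existence also on the change of variables between charts.\<close>

abbreviation fd :: "('a::real_normed_vector \<Rightarrow> 'b::real_normed_vector) \<Rightarrow> 'a \<Rightarrow> 'a \<Rightarrow> 'b" where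
  "fd f u \<equiv> frechet_derivative f (at u)"

abbreviation C1 :: "'a::real_normed_vector set \<Rightarrow> ('a \<Rightarrow> 'b::real_normed_vector) \<Rightarrow> bool" where
  "C1 \<equiv> Ck_on (Suc 0)"

declare Ck_on.simps [simp del]

lemma C1_iff: "C1 S f \<longleftrightarrow> f differentiable_on S \<and> (\<forall>v. continuous_on S (\<lambda>u. fd f u v))"
  by (simp add: Ck_on.simps)

lemma C1I:
  assumes "open S" "\<And>u. u \<in> S \<Longrightarrow> (f has_derivative f' u) (at u)"
    "\<And>v. continuous_on S (\<lambda>u. f' u v)"
  shows "C1 S f"
proof -
  have "fd f u = f' u" if "u \<in> S" for u
    using frechet_derivative_at[OF assms(2)[OF that]] by simp
  then have "continuous_on S (\<lambda>u. fd f u v)" for v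
    using assms(3)[of v] by (simp cong: continuous_on_cong)
  then show ?thesis
    using assms by (auto simp: C1_iff differentiable_on_def at_within_open[OF _ assms(1)] differentiable_def)
qed

lemma Ck_Suc_has_derivative:
  assumes "Ck_on (Suc k) S f" "open S" "u \<in> S"
  shows "(f has_derivative fd f u) (at u)"
  using assms
  by (auto simp: Ck_on.simps differentiable_on_def at_within_open[OF _ assms(2)] frechet_derivative_works[symmetric])

lemma fd_linear: "Ck_on (Suc k) S f \<Longrightarrow> open S \<Longrightarrow> u \<in> S \<Longrightarrow> linear (fd f u)"
  using Ck_Suc_has_derivative has_derivative_linear by blast

lemma C1_fd_continuous: "C1 S f \<Longrightarrow> continuous_on S (\<lambda>u. fd f u v)"
  by (simp add: C1_iff)

lemma C1_continuous: "C1 S f \<Longrightarrow> continuous_on S f"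
  by (simp add: C1_iff differentiable_imp_continuous_on)

lemma smooth_C1: "smooth_on S f \<Longrightarrow> C1 S f"
  unfolding smooth_on_def by blast

lemma smooth_fd: "smooth_on S f \<Longrightarrow> smooth_on S (\<lambda>u. fd f u v)"
  unfolding smooth_on_def by (metis Ck_on.simps(2))

lemma C1_cong:
  assumes "open S" "\<And>u. u \<in> S \<Longrightarrow> f u = g u" "C1 S f"
  shows "C1 S g"
proof (rule C1I[OF assms(1)])
  fix u assume "u \<in> S"
  then show "(g has_derivative fd f u) (at u)"
    using Ck_Suc_has_derivative[OF assms(3,1)] has_derivative_transform_within_open[OF _ assms(1)] assms(2)
    by blast
qed (use C1_fd_continuous[OF assms(3)] in auto)

text \<open>Used to glue a function that is C1 near its support to the zero function off the
  support.\<close>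

lemma C1_Un:
  assumes "open S" "open T" "C1 S f" "C1 T f"
  shows "C1 (S \<union> T) f"
proof (rule C1I)
  show "(f has_derivative fd f u) (at u)" if "u \<in> S \<union> T" for u
    using that assms Ck_Suc_has_derivative by blast
  show "continuous_on (S \<union> T) (\<lambda>u. fd f u v)" for v
    using assms C1_fd_continuous by (intro continuous_on_open_Un) auto
qed (use assms in auto)

lemma C1_const: "open S \<Longrightarrow> C1 S (\<lambda>_. c)"
  by (rule C1I[where f' = "\<lambda>_ _. 0"]) auto

lemma C1_add:
  assumes "open S" "C1 S f" "C1 S g"
  shows "C1 S (\<lambda>u. f u + g u)"
  by (rule C1I[where f' = "\<lambda>u v. fd f u v + fd g u v"])
     (auto intro!: derivative_intros continuous_intros Ck_Suc_has_derivative[OF _ assms(1)] C1_fd_continuous assms)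

lemma C1_bilinear:
  assumes "bounded_bilinear p" "open S" "C1 S f" "C1 S g"
  shows "C1 S (\<lambda>u. p (f u) (g u))"
proof -
  interpret bounded_bilinear p by fact
  show ?thesis
    by (rule C1I[where f' = "\<lambda>u v. p (f u) (fd g u v) + p (fd f u v) (g u)"])
     (auto intro!: FDERIV Ck_Suc_has_derivative[OF _ assms(2)] assms continuous_on_add
         continuous_on[OF C1_continuous[OF assms(3)] C1_fd_continuous[OF assms(4)]]
         continuous_on[OF C1_fd_continuous[OF assms(3)] C1_continuous[OF assms(4)]])
qed

lemmas C1_mult = C1_bilinear[OF bounded_bilinear_mult]
lemmas C1_inner = C1_bilinear[OF bounded_bilinear_inner]
lemmas C1_scaleR = C1_bilinear[OF bounded_bilinear_scaleR]

lemma C1_sum: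
  assumes "open S" "\<And>i. i \<in> I \<Longrightarrow> C1 S (f i)"
  shows "C1 S (\<lambda>u. \<Sum>i\<in>I. f i u)"
  using assms(2) by (induction I rule: infinite_finite_induct) (auto intro!: C1_const C1_add assms(1))

lemma C1_prod:
  fixes f :: "'i \<Rightarrow> 'a::real_normed_vector \<Rightarrow> real"
  assumes "open S" "\<And>i. i \<in> I \<Longrightarrow> C1 S (f i)"
  shows "C1 S (\<lambda>u. \<Prod>i\<in>I. f i u)"
  using assms(2) by (induction I rule: infinite_finite_induct) (auto intro!: C1_const C1_mult assms(1))

lemma C1_compose:
  fixes g :: "'b::euclidean_space \<Rightarrow> 'c::real_normed_vector"
  assumes S: "open S" and T: "open T" and f: "C1 S f" and g: "C1 T g" and sub: "f ` S \<subseteq> T"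
  shows "C1 S (\<lambda>u. g (f u))"
proof (rule C1I[OF S])
  show "((\<lambda>u. g (f u)) has_derivative (\<lambda>v. fd g (f u) (fd f u v))) (at u)" if "u \<in> S" for u
    using has_derivative_compose[OF Ck_Suc_has_derivative[OF f S that] Ck_Suc_has_derivative[OF g T]] that sub
    by blast
  \<comment> \<open>\<open>C1\<close> gives continuity of \<open>fd g\<close> only in each fixed
    direction, while here the direction moves with \<open>u\<close>. The expansion in a basis
    reduces to fixed directions.\<close>
  have "fd g (f u) (fd f u v) = (\<Sum>b\<in>Basis. (fd f u v \<bullet> b) *\<^sub>R fd g (f u) b)" if "u \<in> S" for u v
  proof -
    have "linear (fd g (f u))" using fd_linear[OF g T] that sub by blast
    then show ?thesis
      by (subst euclidean_representation[of "fd f u v", symmetric]) (simp add: linear_sum linear_scale)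
  qed
  moreover have "continuous_on S (\<lambda>u. \<Sum>b\<in>Basis. (fd f u v \<bullet> b) *\<^sub>R fd g (f u) b)" for v
    by (intro continuous_intros C1_fd_continuous f
        continuous_on_compose2[OF C1_fd_continuous[OF g] C1_continuous[OF f] sub])
  ultimately show "continuous_on S (\<lambda>u. fd g (f u) (fd f u v))" for v
    by (simp cong: continuous_on_cong)
qed

lemma C1_real:
  assumes "open S" "\<And>t. t \<in> S \<Longrightarrow> (f has_real_derivative f' t) (at t)" "continuous_on S f'"
  shows "C1 S f"
  by (rule C1I[where f' = "\<lambda>t v. f' t * v"])
     (use assms in \<open>auto simp: has_field_derivative_def intro!: continuous_intros\<close>)

lemma C1_divide:
  fixes f g :: "'a::real_normed_vector \<Rightarrow> real"
  assumes "open S" "C1 S f" "C1 S g" "\<And>u. u \<in> S \<Longrightarrow> g u \<noteq> 0"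
  shows "C1 S (\<lambda>u. f u / g u)"
proof -
  have "C1 (-{0}) (inverse :: real \<Rightarrow> real)"
    by (rule C1_real[where f' = "\<lambda>t. - (inverse t ^ 2)"])
       (auto intro!: derivative_eq_intros continuous_intros simp: power2_eq_square)
  then have "C1 S (\<lambda>u. inverse (g u))"
    by (rule C1_compose[OF assms(1) open_Compl[OF closed_singleton[of 0]] assms(3)]) (use assms(4) in auto)
  then show ?thesis
    unfolding divide_inverse by (rule C1_mult[OF assms(1,2)])
qed

lemma fd_compose:
  assumes "(f has_derivative f') (at u)" "(g has_derivative g') (at (f u))"
  shows "fd (\<lambda>u. g (f u)) u v = g' (f' v)"
  using frechet_derivative_at[OF has_derivative_compose[OF assms]] by metis

text \<open>\<open>frechet_derivative\<close> chooses among all derivatives at the point. Functions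
  that agree nearby have the same ones, so the choices agree even where there is none.\<close>

lemma fd_cong:
  assumes "open S" "u \<in> S" "\<And>u. u \<in> S \<Longrightarrow> f u = g u"
  shows "fd f u = fd g u"
proof -
  have "(f has_derivative f') (at u) \<longleftrightarrow> (g has_derivative f') (at u)" for f'
    using has_derivative_transform_within_open[OF _ assms(1,2)] assms(3) by metis
  then show ?thesis unfolding frechet_derivative_def by simp
qed

section \<open>A cutoff function of class C1 on the line\<close>

lemma has_real_derivative_pos_part_square:
  "((\<lambda>t::real. (max 0 t)\<^sup>2) has_real_derivative 2 * max 0 t) (at t)"
proof -
  consider "t < 0" | "t = 0" | "t > 0" by linarith
  then show ?thesis
  proof cases
    case 1
    have "((\<lambda>t::real. 0) has_real_derivative 0) (at t)" by simp
    then have "((\<lambda>t::real. (max 0 t)\<^sup>2) has_real_derivative 0) (at t)"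
      by (rule has_field_derivative_transform_within_open[where S="{..<0}"]) (use 1 in auto)
    then show ?thesis using 1 by simp
  next
    case 3
    have "((\<lambda>t::real. t\<^sup>2) has_real_derivative 2 * t) (at t)" by (auto intro!: derivative_eq_intros)
    then have "((\<lambda>t::real. (max 0 t)\<^sup>2) has_real_derivative 2 * t) (at t)"
      by (rule has_field_derivative_transform_within_open[where S="{0<..}"]) (use 3 in auto)
    then show ?thesis using 3 by simp
  next
    case 2
    have "((\<lambda>y. (max 0 y)\<^sup>2 / y) \<longlongrightarrow> 0) (at (0::real))"
    proof (rule Lim_null_comparison)
      show "\<forall>\<^sub>F y in at (0::real). norm ((max 0 y)\<^sup>2 / y) \<le> \<bar>y\<bar>"
        by (intro always_eventually) (auto simp: max_def power2_eq_square)
      show "((\<lambda>y::real. \<bar>y\<bar>) \<longlongrightarrow> 0) (at 0)"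
        using tendsto_rabs[OF tendsto_ident_at, of "0::real" UNIV] by simp
    qed
    then show ?thesis by (simp add: 2 has_field_derivative_iff)
  qed
qed

text \<open>With \<open>h t\<close> the square of the positive part of \<open>t\<close>, take h(b -
  t) / (h(b - t) + h(t - a)). The summands of the denominator vanish for t >= b and for t <= a
  respectively, hence never together.\<close>

lemma cutoff_exists:
  assumes "a < (b::real)"
  obtains \<psi> \<psi>' where "\<And>t. (\<psi> has_real_derivative \<psi>' t) (at t)" "continuous_on UNIV \<psi>'"
    "\<And>t. \<psi>' t \<le> 0" "\<And>t. 0 \<le> \<psi> t" "\<And>t. \<psi> t \<le> 1"
    "\<And>t. t \<le> a \<Longrightarrow> \<psi> t = 1" "\<And>t. b \<le> t \<Longrightarrow> \<psi> t = 0"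
proof -
  define h where "h t = (max 0 t)\<^sup>2" for t :: real
  define N where "N t = h (b - t) + h (t - a)" for t
  define \<psi> where "\<psi> t = h (b - t) / N t" for t
  define \<psi>' where "\<psi>' t = (- (2 * max 0 (b - t)) * N t
     - h (b - t) * (- (2 * max 0 (b - t)) + 2 * max 0 (t - a))) / (N t * N t)" for t
  have N: "N t > 0" for t
  proof -
    have "max 0 (b - t) > 0 \<or> max 0 (t - a) > 0" using assms by (auto simp: max_def)
    then show ?thesis by (auto simp: N_def h_def intro: add_pos_nonneg add_nonneg_pos)
  qed
  have h: "(h has_real_derivative 2 * max 0 t) (at t)" for t
    using has_real_derivative_pos_part_square by (simp add: h_def[abs_def])
  have h1: "((\<lambda>t. h (b - t)) has_real_derivative - (2 * max 0 (b - t))) (at t)" for t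
  proof -
    have "((\<lambda>t. b - t) has_real_derivative -1) (at t)" by (auto intro!: derivative_eq_intros)
    from DERIV_chain'[OF this h] show ?thesis by simp
  qed
  have h2: "((\<lambda>t. h (t - a)) has_real_derivative 2 * max 0 (t - a)) (at t)" for t
  proof -
    have "((\<lambda>t. t - a) has_real_derivative 1) (at t)" by (auto intro!: derivative_eq_intros)
    from DERIV_chain'[OF this h] show ?thesis by simp
  qed
  have "(N has_real_derivative - (2 * max 0 (b - t)) + 2 * max 0 (t - a)) (at t)" for t
    unfolding N_def[abs_def] by (intro DERIV_add h1 h2)
  from DERIV_divide[OF h1 this] N have "(\<psi> has_real_derivative \<psi>' t) (at t)" for t
    unfolding \<psi>_def[abs_def] \<psi>'_def by (simp add: less_imp_neq[symmetric])
  moreover have "continuous_on UNIV \<psi>'"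
  proof -
    have c: "continuous_on UNIV h" "continuous_on UNIV N"
      unfolding h_def[abs_def] N_def[abs_def] by (intro continuous_intros)+
    have "continuous_on UNIV (\<lambda>t. h (b - t))"
      by (rule continuous_on_compose2[OF c(1)]) (auto intro!: continuous_intros)
    moreover have "\<forall>t\<in>UNIV. N t * N t \<noteq> 0" using N by (metis less_irrefl mult_eq_0_iff)
    ultimately show ?thesis
      unfolding \<psi>'_def by (intro continuous_intros c)
  qed
  moreover have "\<psi>' t \<le> 0" for t
  proof -
    \<comment> \<open>In the numerator of the quotient rule the products of \<open>h (b - t)\<close>
      with its own derivative cancel; what remains is a sum of two nonpositive terms.\<close>
    have "- (2 * max 0 (b - t)) * N t - h (b - t) * (- (2 * max 0 (b - t)) + 2 * max 0 (t - a))
      = - (2 * max 0 (b - t)) * h (t - a) - h (b - t) * (2 * max 0 (t - a))"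
      by (simp add: N_def algebra_simps)
    also have "\<dots> \<le> 0"
    proof -
      have "0 \<le> max 0 (b - t) * h (t - a)" "0 \<le> h (b - t) * max 0 (t - a)" by (auto simp: h_def)
      then show ?thesis by (simp add: algebra_simps)
    qed
    finally show ?thesis using N[of t] unfolding \<psi>'_def by (intro divide_nonpos_pos) auto
  qed
  moreover have "0 \<le> \<psi> t" "\<psi> t \<le> 1" for t
    using N[of t] by (auto simp: \<psi>_def h_def N_def divide_simps)
  moreover have "\<psi> t = 1" if "t \<le> a" for t
  proof -
    have "h (t - a) = 0" using that by (simp add: h_def)
    then show ?thesis using N[of t] by (simp add: \<psi>_def N_def)
  qed
  moreover have "\<psi> t = 0" if "b \<le> t" for t
    using that by (simp add: \<psi>_def h_def)
  ultimately show ?thesis using that by blast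
qed

section \<open>Differentiation under the integral sign\<close>

text \<open>Dominated convergence for the difference quotients: by the mean value inequality they
  obey the same bound \<open>g\<close> as the derivative. Applied to translates of a compactly
  supported function and later to the weighted integral J(t).\<close>

lemma integral_has_real_derivative:
  fixes F :: "real \<Rightarrow> 'a \<Rightarrow> real"
  assumes \<epsilon>: "0 < \<epsilon>"
    and F: "\<And>t x. \<bar>t - t0\<bar> < \<epsilon> \<Longrightarrow> x \<in> space M \<Longrightarrow> ((\<lambda>s. F s x) has_real_derivative F' t x) (at t)"
    and int: "\<And>t. \<bar>t - t0\<bar> < \<epsilon> \<Longrightarrow> integrable M (F t)"
    and bound: "\<And>t x. \<bar>t - t0\<bar> < \<epsilon> \<Longrightarrow> x \<in> space M \<Longrightarrow> \<bar>F' t x\<bar> \<le> g x"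
    and g: "integrable M g"
  shows "((\<lambda>t. \<integral>x. F t x \<partial>M) has_real_derivative (\<integral>x. F' t0 x \<partial>M)) (at t0)"
proof -
  have lip: "\<bar>F (t0 + h) x - F t0 x\<bar> \<le> \<bar>h\<bar> * g x" if h: "\<bar>h\<bar> < \<epsilon>" and x: "x \<in> space M" for h x
  proof -
    have "norm (F (t0 + h) x - F t0 x) \<le> g x * norm (t0 + h - t0)"
    proof (rule field_differentiable_bound[where f="\<lambda>s. F s x" and S="{t0 - \<bar>h\<bar>..t0 + \<bar>h\<bar>}" and f'="\<lambda>t. F' t x"])
      fix z assume "z \<in> {t0 - \<bar>h\<bar>..t0 + \<bar>h\<bar>}"
      then have z: "\<bar>z - t0\<bar> < \<epsilon>" using h by auto
      show "((\<lambda>s. F s x) has_real_derivative F' z x) (at z within {t0 - \<bar>h\<bar>..t0 + \<bar>h\<bar>})"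
        using F[OF z x] by (rule has_field_derivative_at_within)
      show "norm (F' z x) \<le> g x" using bound[OF z x] by simp
    qed auto
    then show ?thesis by (simp add: mult.commute)
  qed
  have "((\<lambda>h. ((\<integral>x. F (t0 + h) x \<partial>M) - (\<integral>x. F t0 x \<partial>M)) / h) \<longlongrightarrow> (\<integral>x. F' t0 x \<partial>M)) (at 0)"
    unfolding tendsto_at_iff_sequentially comp_def
  proof (intro allI impI)
    fix X :: "nat \<Rightarrow> real" assume X: "\<forall>i. X i \<in> UNIV - {0}" and X0: "X \<longlonglongrightarrow> 0"
    obtain N where N: "\<And>n. n \<ge> N \<Longrightarrow> \<bar>X n\<bar> < \<epsilon>"
      using LIMSEQ_D[OF X0 \<epsilon>] by auto
    \<comment> \<open>The index shift discards the finitely many increments that may leave the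
      interval of radius \<open>\<epsilon>\<close>.\<close>
    let ?Y = "\<lambda>n. X (n + N)"
    have Y0: "?Y \<longlonglongrightarrow> 0" using X0 by (rule LIMSEQ_ignore_initial_segment)
    have Yn: "?Y n \<noteq> 0" "\<bar>?Y n\<bar> < \<epsilon>" for n using X N by auto
    have conv: "(\<lambda>n. (F (t0 + ?Y n) x - F t0 x) / ?Y n) \<longlonglongrightarrow> F' t0 x" if "x \<in> space M" for x
    proof -
      have "((\<lambda>h. (F (t0 + h) x - F t0 x) / h) \<longlongrightarrow> F' t0 x) (at 0)"
        using F[of t0 x] that \<epsilon> by (simp add: DERIV_def)
      then show ?thesis
        using Yn Y0 by (auto simp: tendsto_at_iff_sequentially comp_def)
    qed
    have m: "(\<lambda>x. (F (t0 + ?Y n) x - F t0 x) / ?Y n) \<in> borel_measurable M" for n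
      using int[of "t0 + ?Y n"] int[of t0] \<epsilon> Yn by (auto intro!: borel_measurable_divide borel_measurable_diff)
    have m': "F' t0 \<in> borel_measurable M"
      by (rule borel_measurable_LIMSEQ_real[OF conv m])
    have "(\<lambda>n. \<integral>x. (F (t0 + ?Y n) x - F t0 x) / ?Y n \<partial>M) \<longlonglongrightarrow> (\<integral>x. F' t0 x \<partial>M)"
    proof (rule integral_dominated_convergence[OF m' m g])
      show "AE x in M. norm ((F (t0 + ?Y n) x - F t0 x) / ?Y n) \<le> g x" for n
        using lip[of "?Y n"] Yn[of n] by (auto simp: divide_simps mult.commute)
    qed (use conv in auto)
    moreover have "(\<integral>x. (F (t0 + ?Y n) x - F t0 x) / ?Y n \<partial>M)
        = ((\<integral>x. F (t0 + ?Y n) x \<partial>M) - (\<integral>x. F t0 x \<partial>M)) / ?Y n" for n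
      using int[of "t0 + ?Y n"] int[of t0] \<epsilon> Yn[of n] by simp
    ultimately have "(\<lambda>n. ((\<integral>x. F (t0 + ?Y n) x \<partial>M) - (\<integral>x. F t0 x \<partial>M)) / ?Y n) \<longlonglongrightarrow> (\<integral>x. F' t0 x \<partial>M)"
      by (simp only:)
    then show "(\<lambda>n. ((\<integral>x. F (t0 + X n) x \<partial>M) - (\<integral>x. F t0 x \<partial>M)) / X n) \<longlonglongrightarrow> (\<integral>x. F' t0 x \<partial>M)"
      by (rule LIMSEQ_offset)
  qed
  then show ?thesis by (simp add: DERIV_def)
qed

text \<open>By translation invariance of Lebesgue measure the integral of
  \<open>F (u + t *\<^sub>R v)\<close> does not depend on t; its derivative at t = 0 is the integral
  in question.\<close>

lemma integral_fd_compact_support: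
  fixes F :: "'a::euclidean_space \<Rightarrow> real"
  assumes F: "C1 UNIV F" and K: "compact K" and supp: "\<And>u. u \<notin> K \<Longrightarrow> F u = 0"
  shows "(\<integral>u. fd F u v \<partial>lborel) = 0"
proof -
  have der: "(F has_derivative fd F u) (at u)" for u
    using Ck_Suc_has_derivative[OF F] by auto
  have supp': "fd F u v = 0" if "u \<notin> K" for u
  proof -
    have "fd F u = fd (\<lambda>_. 0) u"
      by (rule fd_cong[of "-K"]) (use that supp K in \<open>auto intro: compact_imp_closed\<close>)
    then show ?thesis by simp
  qed
  \<comment> \<open>\<open>K'\<close> contains every point whose translate by some t v with |t| <= 1
    meets \<open>K\<close>. A constant on this compact set therefore dominates the derivatives for
    all |t| < 1 at once.\<close>
  define K' where "K' = (\<lambda>(u, t). u - t *\<^sub>R v) ` (K \<times> {-1..1})"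
  have K': "compact K'" unfolding K'_def
    by (intro compact_continuous_image compact_Times K) (auto intro!: continuous_intros simp: case_prod_unfold)
  have in': "u + t *\<^sub>R v \<notin> K" if "u \<notin> K'" "\<bar>t\<bar> < 1" for u t
  proof
    assume "u + t *\<^sub>R v \<in> K"
    then have "(u + t *\<^sub>R v) - t *\<^sub>R v \<in> K'" unfolding K'_def using that(2)
      by (intro image_eqI[where x="(u + t *\<^sub>R v, t)"]) auto
    then show False using that by simp
  qed
  have cont: "continuous_on UNIV F" "continuous_on UNIV (\<lambda>u. fd F u v)"
    using C1_continuous[OF F] C1_fd_continuous[OF F] by auto
  obtain B where B: "\<And>u. u \<in> K \<Longrightarrow> \<bar>fd F u v\<bar> \<le> B"
    using compact_imp_bounded[OF compact_continuous_image[OF continuous_on_subset[OF cont(2)] K]]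
    by (auto simp: bounded_iff)
  have int0: "integrable lborel F"
  proof -
    have "integrable lborel (\<lambda>u. indicator K u *\<^sub>R F u)"
      by (rule borel_integrable_compact[OF K continuous_on_subset[OF cont(1)]]) auto
    moreover have "(\<lambda>u. indicator K u *\<^sub>R F u) = F" using supp by (auto simp: indicator_def fun_eq_iff)
    ultimately show ?thesis by simp
  qed
  have shift: "distr lborel borel (\<lambda>u. u + c) = lborel" for c :: 'a
    using lborel_distr_plus[of c] by (simp add: add.commute[of _ c] cong: distr_cong)
  have int: "integrable lborel (\<lambda>u. F (u + c))" "(\<integral>u. F (u + c) \<partial>lborel) = (\<integral>u. F u \<partial>lborel)" for c
  proof -
    have m: "F \<in> borel_measurable borel" using cont(1) by (rule borel_measurable_continuous_onI)
    have "integrable (distr lborel borel (\<lambda>u. u + c)) F" unfolding shift by (rule int0)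
    then show "integrable lborel (\<lambda>u. F (u + c))" by (subst (asm) integrable_distr_eq) (use m in auto)
    show "(\<integral>u. F (u + c) \<partial>lborel) = (\<integral>u. F u \<partial>lborel)"
      using integral_distr[of "\<lambda>u. u + c" lborel borel F] m unfolding shift by auto
  qed
  have "((\<lambda>t. \<integral>u. F (u + t *\<^sub>R v) \<partial>lborel) has_real_derivative (\<integral>u. fd F (u + 0 *\<^sub>R v) v \<partial>lborel)) (at 0)"
  proof (rule integral_has_real_derivative[where \<epsilon>=1 and g="\<lambda>u. indicator K' u *\<^sub>R \<bar>B\<bar>" and F'="\<lambda>t u. fd F (u + t *\<^sub>R v) v"])
    fix t :: real and u
    assume t: "\<bar>t - 0\<bar> < 1"
    have "((\<lambda>s. u + s *\<^sub>R v) has_derivative (\<lambda>s. s *\<^sub>R v)) (at t)"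
      by (auto intro!: derivative_eq_intros)
    from has_derivative_compose[OF this der]
    have "((\<lambda>s. F (u + s *\<^sub>R v)) has_derivative (\<lambda>s. fd F (u + t *\<^sub>R v) (s *\<^sub>R v))) (at t)" .
    then show "((\<lambda>s. F (u + s *\<^sub>R v)) has_real_derivative fd F (u + t *\<^sub>R v) v) (at t)"
      unfolding has_field_derivative_def
      by (simp add: linear_scale[OF fd_linear[OF F]] mult.commute[of _ "fd F _ _"])
    show "\<bar>fd F (u + t *\<^sub>R v) v\<bar> \<le> indicator K' u *\<^sub>R \<bar>B\<bar>"
    proof (cases "u + t *\<^sub>R v \<in> K")
      case True
      then have "u \<in> K'" using in' t by force
      then show ?thesis using B[OF True] by auto
    qed (auto simp: supp' indicator_def)
    show "integrable lborel (\<lambda>u. F (u + t *\<^sub>R v))" by (rule int)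
  next
    show "integrable lborel (\<lambda>u. indicator K' u *\<^sub>R \<bar>B\<bar>)"
      by (rule borel_integrable_compact[OF K']) auto
  qed auto
  moreover have "((\<lambda>t. \<integral>u. F (u + t *\<^sub>R v) \<partial>lborel) has_real_derivative 0) (at 0)"
    by (simp add: int)
  ultimately show ?thesis using DERIV_unique by fastforce
qed

section \<open>Symmetry of second derivatives\<close>

text \<open>The mean value theorem is applied twice: along \<open>v\<close> to the increment of
  \<open>f\<close> in direction \<open>w\<close>, and along \<open>w\<close> to the resulting
  derivative. The second difference on the left is symmetric in \<open>v\<close> and
  \<open>w\<close>, while the right-hand side is not.\<close>

lemma mixed_derivative_mean_value:
  fixes f :: "'a::real_normed_vector \<Rightarrow> real"
  assumes S: "open S" and f: "Ck_on (Suc (Suc 0)) S f" and h: "h > 0"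
    and sub: "\<And>s t. 0 \<le> s \<Longrightarrow> s \<le> h \<Longrightarrow> 0 \<le> t \<Longrightarrow> t \<le> h \<Longrightarrow> u + s *\<^sub>R v + t *\<^sub>R w \<in> S"
  shows "\<exists>s t. 0 < s \<and> s < h \<and> 0 < t \<and> t < h \<and>
    f (u + h *\<^sub>R v + h *\<^sub>R w) - f (u + h *\<^sub>R v) - f (u + h *\<^sub>R w) + f u
    = h * h * fd (\<lambda>y. fd f y v) (u + s *\<^sub>R v + t *\<^sub>R w) w"
proof -
  have fv: "C1 S (\<lambda>y. fd f y v)" using f by (subst (asm) Ck_on.simps) blast
  have line: "((\<lambda>s. g (p + s *\<^sub>R z)) has_real_derivative fd g (p + s *\<^sub>R z) z) (at s)"
    if g: "Ck_on (Suc k) S g" and p: "p + s *\<^sub>R z \<in> S" for g :: "'a \<Rightarrow> real" and p z s k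
  proof -
    have "((\<lambda>s. p + s *\<^sub>R z) has_derivative (\<lambda>s. s *\<^sub>R z)) (at s)"
      by (auto intro!: derivative_eq_intros)
    from has_derivative_compose[OF this Ck_Suc_has_derivative[OF g S p]]
    show ?thesis
      unfolding has_field_derivative_def
      by (simp add: linear_scale[OF fd_linear[OF g S p]] mult.commute[of _ "fd g _ _"])
  qed
  define F where "F s = f (u + h *\<^sub>R w + s *\<^sub>R v) - f (u + s *\<^sub>R v)" for s
  have "\<exists>s. 0 < s \<and> s < h \<and> F h - F 0 = (h - 0) * (fd f (u + h *\<^sub>R w + s *\<^sub>R v) v - fd f (u + s *\<^sub>R v) v)"
  proof (rule MVT2[OF h])
    fix s assume s: "0 \<le> s" "s \<le> h"
    show "(F has_real_derivative fd f (u + h *\<^sub>R w + s *\<^sub>R v) v - fd f (u + s *\<^sub>R v) v) (at s)"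
      unfolding F_def[abs_def]
      using sub[OF s, of h] sub[OF s, of 0] h by (intro DERIV_diff line[OF f]) (auto simp: algebra_simps)
  qed
  then obtain s where s: "0 < s" "s < h" "F h - F 0 = h * (fd f (u + h *\<^sub>R w + s *\<^sub>R v) v - fd f (u + s *\<^sub>R v) v)"
    by auto
  define G where "G t = fd f (u + s *\<^sub>R v + t *\<^sub>R w) v" for t
  have "\<exists>t. 0 < t \<and> t < h \<and> G h - G 0 = (h - 0) * fd (\<lambda>y. fd f y v) (u + s *\<^sub>R v + t *\<^sub>R w) w"
  proof (rule MVT2[OF h])
    fix t assume t: "0 \<le> t" "t \<le> h"
    show "(G has_real_derivative fd (\<lambda>y. fd f y v) (u + s *\<^sub>R v + t *\<^sub>R w) w) (at t)"
      unfolding G_def[abs_def]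
      using sub[OF _ _ t, of s] s by (intro line[OF fv]) auto
  qed
  then obtain t where t: "0 < t" "t < h" "G h - G 0 = h * fd (\<lambda>y. fd f y v) (u + s *\<^sub>R v + t *\<^sub>R w) w"
    by auto
  have "F h - F 0 = h * (G h - G 0)" using s(3) by (simp add: G_def algebra_simps)
  then have "F h - F 0 = h * h * fd (\<lambda>y. fd f y v) (u + s *\<^sub>R v + t *\<^sub>R w) w" using t(3) by simp
  moreover have "F h - F 0 = f (u + h *\<^sub>R v + h *\<^sub>R w) - f (u + h *\<^sub>R v) - f (u + h *\<^sub>R w) + f u"
    by (simp add: F_def algebra_simps)
  ultimately show ?thesis using s t by metis
qed

text \<open>One and the same second difference equals h^2 times either mixed derivative, each taken
  at some point near \<open>u\<close>. Continuity of both at \<open>u\<close> excludes different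
  values.\<close>

lemma second_derivative_symmetric_real:
  fixes f :: "'a::real_normed_vector \<Rightarrow> real"
  assumes S: "open S" and f: "Ck_on (Suc (Suc 0)) S f" and u: "u \<in> S"
  shows "fd (\<lambda>y. fd f y v) u w = fd (\<lambda>y. fd f y w) u v"
proof (rule ccontr)
  let ?A = "\<lambda>y. fd (\<lambda>y. fd f y v) y w" and ?B = "\<lambda>y. fd (\<lambda>y. fd f y w) y v"
  assume ne: "?A u \<noteq> ?B u"
  \<comment> \<open>Half the gap: the two mixed derivatives move by less than \<open>e\<close> each,
    hence cannot meet.\<close>
  define e where "e = \<bar>?A u - ?B u\<bar> / 2"
  have e: "e > 0" using ne by (simp add: e_def)
  have "continuous_on S ?A" "continuous_on S ?B" using f by (auto simp: Ck_on.simps)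
  then have "(?A \<longlongrightarrow> ?A u) (at u)" "(?B \<longlongrightarrow> ?B u) (at u)"
    using u by (simp_all only: continuous_on_eq_continuous_at[OF S] isCont_def)
  then have "\<forall>\<^sub>F y in at u. dist (?A y) (?A u) < e \<and> dist (?B y) (?B u) < e"
    using e by (intro eventually_conj tendstoD)
  then obtain d1 where d1: "d1 > 0" "\<And>y. dist y u < d1 \<Longrightarrow> dist (?A y) (?A u) < e \<and> dist (?B y) (?B u) < e"
    using e unfolding eventually_at by (metis UNIV_I dist_self)
  obtain d2 where d2: "d2 > 0" "\<And>y. dist y u < d2 \<Longrightarrow> y \<in> S"
    using S u unfolding open_dist by blast
  \<comment> \<open>All points of the parallelogram lie within \<open>h * M\<close> of
    \<open>u\<close>. The summand 1 keeps \<open>M\<close> positive when \<open>v\<close> and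
    \<open>w\<close> vanish, and the factor 2 in \<open>h\<close> makes \<open>h * M\<close>
    strictly smaller than both radii.\<close>
  define M where "M = norm v + norm w + 1"
  have M: "M > 0" by (simp add: M_def add_nonneg_pos)
  define h where "h = min d1 d2 / (2 * M)"
  have h: "h > 0" using d1 d2 M by (simp add: h_def)
  have hM: "h * M < d1" "h * M < d2"
    using d1(1) d2(1) M by (auto simp: h_def)
  have near: "dist (u + s *\<^sub>R v + t *\<^sub>R w) u < min d1 d2" if "0 \<le> s" "s \<le> h" "0 \<le> t" "t \<le> h" for s t
  proof -
    have "dist (u + s *\<^sub>R v + t *\<^sub>R w) u \<le> s * norm v + t * norm w"
      using norm_triangle_ineq[of "s *\<^sub>R v" "t *\<^sub>R w"] that by (simp add: dist_norm algebra_simps)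
    also have "\<dots> \<le> h * norm v + h * norm w" using that by (intro add_mono mult_right_mono) auto
    also have "\<dots> \<le> h * M" using h by (simp add: M_def algebra_simps)
    finally show ?thesis using hM by simp
  qed
  obtain s t where st: "0 < s" "s < h" "0 < t" "t < h"
    "f (u + h *\<^sub>R v + h *\<^sub>R w) - f (u + h *\<^sub>R v) - f (u + h *\<^sub>R w) + f u = h * h * ?A (u + s *\<^sub>R v + t *\<^sub>R w)"
    using mixed_derivative_mean_value[OF S f h, of u v w] d2(2) near by (metis min_less_iff_conj)
  have near': "dist (u + s *\<^sub>R w + t *\<^sub>R v) u < min d1 d2" if "0 \<le> s" "s \<le> h" "0 \<le> t" "t \<le> h" for s t
    using near[OF that(3,4,1,2)] by (simp only: add.assoc add.commute[of "s *\<^sub>R w"])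
  obtain s' t' where st': "0 < s'" "s' < h" "0 < t'" "t' < h"
    "f (u + h *\<^sub>R w + h *\<^sub>R v) - f (u + h *\<^sub>R w) - f (u + h *\<^sub>R v) + f u = h * h * ?B (u + s' *\<^sub>R w + t' *\<^sub>R v)"
    using mixed_derivative_mean_value[OF S f h, of u w v] d2(2) near' by (metis min_less_iff_conj)
  have "h * h * ?A (u + s *\<^sub>R v + t *\<^sub>R w) = h * h * ?B (u + s' *\<^sub>R w + t' *\<^sub>R v)"
    using st(5) st'(5) by (simp add: algebra_simps)
  then have "?A (u + s *\<^sub>R v + t *\<^sub>R w) = ?B (u + s' *\<^sub>R w + t' *\<^sub>R v)" using h by simp
  moreover have "dist (?A (u + s *\<^sub>R v + t *\<^sub>R w)) (?A u) < e"
    using d1(2) near[of s t] st by auto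
  moreover have "dist (?B (u + s' *\<^sub>R w + t' *\<^sub>R v)) (?B u) < e"
    using d1(2)[of "u + s' *\<^sub>R w + t' *\<^sub>R v"] near'[of s' t'] st' by auto
  ultimately have "\<bar>?A u - ?B u\<bar> < 2 * e" unfolding dist_real_def by linarith
  then show False by (simp add: e_def)
qed

lemma second_derivative_symmetric:
  fixes f :: "'a::real_normed_vector \<Rightarrow> 'b::euclidean_space"
  assumes S: "open S" and f: "smooth_on S f" and u: "u \<in> S"
  shows "fd (\<lambda>y. fd f y v) u w = fd (\<lambda>y. fd f y w) u v"
proof (rule euclidean_eqI)
  fix b :: 'b
  have 1: "fd (\<lambda>y. f y \<bullet> b) y = (\<lambda>z. fd f y z \<bullet> b)" if "y \<in> S" for y
    using frechet_derivative_at[OF has_derivative_inner_left[OF Ck_Suc_has_derivative[OF smooth_C1[OF f] S that]]]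
    by metis
  have fv: "C1 S (\<lambda>y. fd f y z)" for z using smooth_C1[OF smooth_fd[OF f]] .
  have 2: "fd (\<lambda>y. fd f y z \<bullet> b) y = (\<lambda>x. fd (\<lambda>y. fd f y z) y x \<bullet> b)" if "y \<in> S" for y z
    using frechet_derivative_at[OF has_derivative_inner_left[OF Ck_Suc_has_derivative[OF fv S that]]]
    by metis
  have 3: "fd (\<lambda>y. fd (\<lambda>y. f y \<bullet> b) y z) y = (\<lambda>x. fd (\<lambda>y. fd f y z) y x \<bullet> b)" if "y \<in> S" for y z
    using fd_cong[OF S that, of "\<lambda>y. fd (\<lambda>y. f y \<bullet> b) y z" "\<lambda>y. fd f y z \<bullet> b"] 1 2[OF that] by simp
  have "C1 S (\<lambda>y. f y \<bullet> b)" by (intro C1_inner C1_const S smooth_C1 f)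
  moreover have "C1 S (\<lambda>y. fd (\<lambda>y. f y \<bullet> b) y z)" for z
  proof (rule C1_cong[OF S])
    show "C1 S (\<lambda>y. fd f y z \<bullet> b)" by (intro C1_inner C1_const S fv)
  qed (simp add: 1)
  ultimately have "Ck_on (Suc (Suc 0)) S (\<lambda>y. f y \<bullet> b)"
    by (subst Ck_on.simps) (auto simp: C1_iff)
  from second_derivative_symmetric_real[OF S this u, of v w] 3[OF u]
  show "fd (\<lambda>y. fd f y v) u w \<bullet> b = fd (\<lambda>y. fd f y w) u v \<bullet> b" by simp
qed

subsection \<open>Change of variables\<close>

text \<open>The change of variables theorem of the library needs a well-ordered index type.\<close>

typedef 'n wo = "UNIV :: 'n set" morphisms of_wo to_wo by simp

lemma to_wo_inverse' [simp]: "of_wo (to_wo i) = i"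
  by (simp add: to_wo_inverse)

lemma bij_to_wo: "bij to_wo"
  by (metis bijI' of_wo_inverse to_wo_inverse')

lemma bij_of_wo: "bij of_wo"
  by (metis bijI' of_wo_inverse to_wo_inverse')

instance wo :: (finite) finite
proof
  have "(UNIV :: 'a wo set) = range to_wo" by (rule bij_is_surj[OF bij_to_wo, symmetric])
  then show "finite (UNIV :: 'a wo set)" by (metis finite finite_imageI)
qed

instantiation wo :: (finite) wellorder
begin

definition less_eq_wo :: "'a wo \<Rightarrow> 'a wo \<Rightarrow> bool" where
  "less_eq_wo a b \<longleftrightarrow> to_nat_on UNIV (of_wo a) \<le> to_nat_on UNIV (of_wo b)"

definition less_wo :: "'a wo \<Rightarrow> 'a wo \<Rightarrow> bool" where
  "less_wo a b \<longleftrightarrow> to_nat_on UNIV (of_wo a) < to_nat_on UNIV (of_wo b)"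

instance
proof
  fix P :: "'a wo \<Rightarrow> bool" and a
  assume step: "\<And>x. (\<And>y. y < x \<Longrightarrow> P y) \<Longrightarrow> P x"
  show "P a"
  proof (induction a rule: measure_induct_rule[where f="\<lambda>a. to_nat_on UNIV (of_wo a)"])
    case (less x)
    show ?case by (rule step, rule less) (simp add: less_wo_def)
  qed
next
  fix a b :: "'a wo"
  assume "a \<le> b" "b \<le> a"
  then have "to_nat_on UNIV (of_wo a) = to_nat_on UNIV (of_wo b)" by (simp add: less_eq_wo_def)
  then have "of_wo a = of_wo b" by simp
  then show "a = b" by (simp add: of_wo_inject)
qed (auto simp: less_eq_wo_def less_wo_def)

end

section \<open>Lebesgue measure and determinants under relabelling of coordinates\<close>

definition wo_vec :: "real^'n \<Rightarrow> real^('n::finite) wo" where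
  "wo_vec v = (\<chi> i. v $ of_wo i)"

definition vec_wo :: "real^('n::finite) wo \<Rightarrow> real^'n" where
  "vec_wo v = (\<chi> i. v $ to_wo i)"

lemma vec_wo_inverse [simp]: "wo_vec (vec_wo v) = v" "vec_wo (wo_vec w) = w"
  by (simp_all add: wo_vec_def vec_wo_def vec_eq_iff of_wo_inverse)

lemma bounded_linear_wo_vec: "bounded_linear wo_vec"
  by (intro linear_conv_bounded_linear[THEN iffD1] linearI) (auto simp: wo_vec_def vec_eq_iff)

lemma bounded_linear_vec_wo: "bounded_linear vec_wo"
  by (intro linear_conv_bounded_linear[THEN iffD1] linearI) (auto simp: vec_wo_def vec_eq_iff)

lemma continuous_on_wo_vec: "continuous_on S wo_vec" and continuous_on_vec_wo: "continuous_on S' vec_wo"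
  by (rule linear_continuous_on, rule bounded_linear_wo_vec, rule linear_continuous_on, rule bounded_linear_vec_wo)

lemma measurable_wo_vec [measurable]: "wo_vec \<in> borel_measurable borel"
  and measurable_vec_wo [measurable]: "vec_wo \<in> borel_measurable borel"
  by (intro borel_measurable_continuous_onI continuous_on_wo_vec continuous_on_vec_wo)+

lemma prod_Basis_cart: "(\<Prod>b\<in>Basis. (x::real^'n::finite) \<bullet> b) = (\<Prod>i\<in>UNIV. x $ i)"
proof -
  have Basis: "(Basis :: (real^'n) set) = (\<lambda>i. axis i 1) ` UNIV" by (auto simp: Basis_vec_def)
  show ?thesis
    unfolding Basis by (subst prod.reindex) (auto simp: inj_on_def axis_eq_axis inner_axis)
qed

text \<open>Relabelling maps boxes to boxes with the same side lengths, and Lebesgue measure is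
  determined by its values on boxes.\<close>

lemma distr_wo_vec: "distr lborel borel wo_vec = (lborel :: (real^('n::finite) wo) measure)"
proof (rule lborel_eqI[symmetric])
  fix l u :: "real^'n wo" assume le: "\<And>b. b \<in> Basis \<Longrightarrow> l \<bullet> b \<le> u \<bullet> b"
  have le': "l $ i \<le> u $ i" for i using le[of "axis i 1"] by (simp add: inner_axis)
  have "wo_vec -` box l u = box (vec_wo l) (vec_wo u)"
    unfolding set_eq_iff vimage_eq mem_box_cart
    by (auto simp: wo_vec_def vec_wo_def) (metis of_wo_inverse to_wo_inverse')+
  then have "emeasure (distr lborel borel wo_vec) (box l u) = emeasure lborel (box (vec_wo l) (vec_wo u))"
    by (subst emeasure_distr) auto
  also have "\<dots> = (\<Prod>b\<in>Basis. (vec_wo u - vec_wo l) \<bullet> b)"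
    using le' by (intro emeasure_lborel_box) (auto simp: Basis_vec_def inner_axis vec_wo_def)
  also have "\<dots> = (\<Prod>i\<in>UNIV. (u - l) $ to_wo i)"
    by (subst prod_Basis_cart) (simp add: vec_wo_def)
  also have "\<dots> = (\<Prod>i\<in>UNIV. (u - l) $ i)"
    using prod.reindex_bij_betw[OF bij_to_wo, of "\<lambda>i. (u - l) $ i"] by simp
  finally show "emeasure (distr lborel borel wo_vec) (box l u) = (\<Prod>b\<in>Basis. (u - l) \<bullet> b)"
    by (simp add: prod_Basis_cart)
qed simp

text \<open>Conjugation by the bijection takes transpositions to transpositions, so induction over
  products of transpositions applies. The second conjunct is carried along because multiplicativity
  of \<open>sign\<close> asks for it.\<close>

lemma sign_conjugate_wo:
  fixes p :: "'n::finite \<Rightarrow> 'n"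
  assumes "p permutes UNIV"
  shows "sign (to_wo \<circ> p \<circ> of_wo) = sign p \<and> permutation (to_wo \<circ> p \<circ> of_wo)"
  using assms finite
proof (induction p rule: permutes_induct)
  case id
  have "to_wo \<circ> id \<circ> of_wo = (id :: 'n wo \<Rightarrow> _)" by (auto simp: of_wo_inverse)
  then show ?case by simp
next
  case (swap a b p)
  have *: "to_wo \<circ> (Transposition.transpose a b \<circ> p) \<circ> of_wo =
    Transposition.transpose (to_wo a) (to_wo b) \<circ> (to_wo \<circ> p \<circ> of_wo)"
    by (auto simp: fun_eq_iff Transposition.transpose_def) (metis to_wo_inverse')+
  have "permutation p" using swap.hyps permutation_permutes finite by blast
  moreover have "to_wo a \<noteq> to_wo b" using swap.hyps by (metis to_wo_inverse')
  ultimately show ?case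
    using swap.IH swap.hyps(3) unfolding *
    by (simp only: sign_compose permutation_swap_id permutation_compose sign_swap_id if_False simp_thms)
qed

lemma det_wo: "det (\<chi> i j. A $ of_wo i $ of_wo j) = det (A :: real^'n::finite^'n)"
proof -
  have permutes_iff: "q permutes UNIV \<longleftrightarrow> bij q" for q :: "'k \<Rightarrow> 'k"
    by (simp add: permutes_univ bij_iff)
  let ?c = "\<lambda>p :: 'n \<Rightarrow> 'n. to_wo \<circ> p \<circ> of_wo"
  have bij: "bij_betw ?c {p. p permutes UNIV} {p. p permutes UNIV}"
  proof (rule bij_betw_byWitness[where f'="\<lambda>p. of_wo \<circ> p \<circ> to_wo"])
    show "?c ` {p. p permutes UNIV} \<subseteq> {p. p permutes UNIV}"
      unfolding image_subset_iff mem_Collect_eq permutes_iff by (intro allI ballI bij_comp bij_to_wo bij_of_wo) auto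
    show "(\<lambda>p. of_wo \<circ> p \<circ> to_wo) ` {p. p permutes UNIV} \<subseteq> {p. p permutes UNIV}"
      unfolding image_subset_iff mem_Collect_eq permutes_iff by (intro allI ballI bij_comp bij_to_wo bij_of_wo) auto
  qed (auto simp: fun_eq_iff of_wo_inverse)
  have "det (\<chi> i j. A $ of_wo i $ of_wo j)
    = (\<Sum>p | p permutes UNIV. of_int (sign p) * (\<Prod>i\<in>UNIV. A $ of_wo i $ of_wo (p i)))"
    by (simp add: det_def)
  also have "\<dots> = (\<Sum>p | p permutes (UNIV::'n set). of_int (sign (?c p)) * (\<Prod>i\<in>UNIV. A $ of_wo i $ of_wo (?c p i)))"
    using sum.reindex_bij_betw[OF bij, of "\<lambda>p. of_int (sign p) * (\<Prod>i\<in>UNIV. A $ of_wo i $ of_wo (p i))"] by simp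
  also have "\<dots> = (\<Sum>p | p permutes (UNIV::'n set). of_int (sign p) * (\<Prod>i\<in>UNIV. A $ i $ p i))"
  proof (rule sum.cong)
    fix p :: "'n \<Rightarrow> 'n" assume p: "p \<in> {p. p permutes UNIV}"
    have "(\<Prod>i\<in>UNIV. A $ of_wo i $ p (of_wo i)) = (\<Prod>i\<in>UNIV. A $ i $ p i)"
      using prod.reindex_bij_betw[OF bij_of_wo, of "\<lambda>i. A $ i $ p i"] by simp
    then show "of_int (sign (?c p)) * (\<Prod>i\<in>UNIV. A $ of_wo i $ of_wo (?c p i)) = of_int (sign p) * (\<Prod>i\<in>UNIV. A $ i $ p i)"
      using sign_conjugate_wo[of p] p by simp
  qed simp
  finally show ?thesis by (simp add: det_def)
qed

text \<open>\<open>has_measure_differentiable_image\<close> relates finite real values. It is lifted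
  to extended values by showing that finiteness of either side forces finiteness of the other with
  the same value; in the remaining case both sides are infinite.\<close>

lemma emeasure_differentiable_image_wo:
  fixes \<tau> :: "real^'n::{finite,wellorder} \<Rightarrow> real^'n::_"
  assumes S: "S \<in> sets borel" and \<tau>S: "\<tau> ` S \<in> sets borel"
    and der: "\<And>u. u \<in> S \<Longrightarrow> (\<tau> has_derivative \<tau>' u) (at u within S)" and inj: "inj_on \<tau> S"
    and m: "(\<lambda>u. \<bar>det (matrix (\<tau>' u))\<bar> * indicator S u) \<in> borel_measurable borel"
  shows "emeasure lborel (\<tau> ` S) = (\<integral>\<^sup>+u. ennreal (\<bar>det (matrix (\<tau>' u))\<bar> * indicator S u) \<partial>lborel)"
proof -
  let ?J = "\<lambda>u. \<bar>det (matrix (\<tau>' u))\<bar>"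
  have iff: "\<tau> ` S \<in> lmeasurable \<and> measure lebesgue (\<tau> ` S) = r \<longleftrightarrow> (?J has_integral r) S" for r
    using has_measure_differentiable_image[OF _ der inj] S by auto
  have ind: "(?J has_integral r) S \<longleftrightarrow> ((\<lambda>u. ?J u * indicator S u) has_integral r) UNIV" for r
    by (subst has_integral_restrict_UNIV[symmetric]) (rule has_integral_cong, simp add: indicator_def)
  have 1: "emeasure lborel (\<tau> ` S) = r" if "0 \<le> r" "(\<integral>\<^sup>+u. ennreal (?J u * indicator S u) \<partial>lborel) = ennreal r" for r
  proof -
    have "((\<lambda>u. ?J u * indicator S u) has_integral r) UNIV"
      using m that by (intro nn_integral_has_integral) auto
    then have "\<tau> ` S \<in> lmeasurable" "measure lebesgue (\<tau> ` S) = r" using iff ind by blast+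
    then show ?thesis using \<tau>S emeasure_eq_measure2[of "\<tau> ` S" lebesgue] by simp
  qed
  have 2: "(\<integral>\<^sup>+u. ennreal (?J u * indicator S u) \<partial>lborel) = ennreal r" if r: "0 \<le> r" "emeasure lborel (\<tau> ` S) = ennreal r" for r
  proof -
    have "\<tau> ` S \<in> lmeasurable" using r \<tau>S by (intro fmeasurableI) auto
    moreover from this have "measure lebesgue (\<tau> ` S) = r"
      using r \<tau>S emeasure_eq_measure2[of "\<tau> ` S" lebesgue] by simp
    ultimately have "((\<lambda>u. ?J u * indicator S u) has_integral r) UNIV" using iff ind by blast
    then show ?thesis using m by (intro nn_integral_has_integral_lborel) auto
  qed
  show ?thesis
  proof (cases "emeasure lborel (\<tau> ` S)")
    case (real r)
    then show ?thesis using 2[of r] by simp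
  next
    case top
    show ?thesis
    proof (cases "\<integral>\<^sup>+u. ennreal (?J u * indicator S u) \<partial>lborel")
      case (real r)
      then show ?thesis using 1[of r] by simp
    qed (simp add: top)
  qed
qed

lemma continuous_on_det_matrix:
  fixes \<tau>' :: "'a::topological_space \<Rightarrow> real^'n::finite \<Rightarrow> real^'n"
  assumes "\<And>v. continuous_on S (\<lambda>u. \<tau>' u v)"
  shows "continuous_on S (\<lambda>u. det (matrix (\<tau>' u)))"
  unfolding det_def matrix_def vec_lambda_beta
  by (intro continuous_intros assms)

text \<open>The formula for well-ordered indices is applied to \<open>\<tau>\<close> conjugated by
  the relabelling; neither the measure of sets nor the Jacobian determinant changes.\<close>

lemma emeasure_C1_image:
  fixes \<tau> :: "real^'n::finite \<Rightarrow> real^'n"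
  assumes V: "open V" and C: "C1 V \<tau>" and S: "S \<in> sets borel" "S \<subseteq> V" and \<tau>S: "\<tau> ` S \<in> sets borel"
    and inj: "inj_on \<tau> S"
  shows "emeasure lborel (\<tau> ` S) = (\<integral>\<^sup>+u\<in>S. ennreal \<bar>det (matrix (fd \<tau> u))\<bar> \<partial>lborel)"
proof -
  define \<tau>1 where "\<tau>1 = wo_vec \<circ> \<tau> \<circ> vec_wo"
  define \<tau>1' where "\<tau>1' u = wo_vec \<circ> fd \<tau> (vec_wo u) \<circ> vec_wo" for u
  \<comment> \<open>Images under \<open>wo_vec\<close> are preimages under its inverse, hence
    Borel.\<close>
  have vimage: "wo_vec ` A = vec_wo -` A" for A :: "(real^'n) set"
    by (auto simp: image_iff) (metis vec_wo_inverse)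
  have emeasure_wo: "emeasure lborel (wo_vec ` A) = emeasure lborel A" if "A \<in> sets borel" for A :: "(real^'n) set"
  proof -
    have "wo_vec ` A \<in> sets borel" unfolding vimage by (rule measurable_sets_borel[OF measurable_vec_wo that])
    moreover have "wo_vec -` wo_vec ` A = A" by (auto, metis vec_wo_inverse(2))
    ultimately show ?thesis using emeasure_distr[of wo_vec lborel borel "wo_vec ` A"] by (simp add: distr_wo_vec)
  qed
  have det: "det (matrix (\<tau>1' u)) = det (matrix (fd \<tau> (vec_wo u)))" for u
  proof -
    have "vec_wo (axis j 1) = axis (of_wo j) 1" for j :: "'n wo"
      by (auto simp: vec_wo_def axis_def vec_eq_iff of_wo_inverse)
    then have "matrix (\<tau>1' u) = (\<chi> i j. matrix (fd \<tau> (vec_wo u)) $ of_wo i $ of_wo j)"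
      by (simp add: matrix_def \<tau>1'_def wo_vec_def)
    then show ?thesis by (simp add: det_wo)
  qed
  have S1: "wo_vec ` S \<in> sets borel" unfolding vimage by (rule measurable_sets_borel[OF measurable_vec_wo S(1)])
  have im: "\<tau>1 ` wo_vec ` S = wo_vec ` \<tau> ` S" by (simp add: \<tau>1_def image_image)
  have meas: "(\<lambda>u. \<bar>det (matrix (\<tau>1' u))\<bar> * indicator (wo_vec ` S) u) \<in> borel_measurable borel"
  proof -
    have "(\<lambda>u. indicator S u *\<^sub>R \<bar>det (matrix (fd \<tau> u))\<bar>) \<in> borel_measurable borel"
      by (intro borel_measurable_continuous_on_indicator S continuous_intros continuous_on_det_matrix
          continuous_on_subset[OF C1_fd_continuous[OF C] S(2)])
    then have "(\<lambda>u. indicator S (vec_wo u) *\<^sub>R \<bar>det (matrix (fd \<tau> (vec_wo u)))\<bar>) \<in> borel_measurable borel"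
      by measurable
    moreover have "indicator (wo_vec ` S) u = (indicator S (vec_wo u) :: real)" for u
      by (simp add: vimage indicator_def)
    ultimately show ?thesis by (simp add: det mult.commute)
  qed
  have "emeasure lborel (\<tau> ` S) = emeasure lborel (\<tau>1 ` wo_vec ` S)"
    unfolding im using emeasure_wo[OF \<tau>S] by simp
  also have "\<dots> = (\<integral>\<^sup>+u. ennreal (\<bar>det (matrix (\<tau>1' u))\<bar> * indicator (wo_vec ` S) u) \<partial>lborel)"
  proof (rule emeasure_differentiable_image_wo[OF S1 _ _ _ meas])
    show "\<tau>1 ` wo_vec ` S \<in> sets borel" unfolding im unfolding vimage by (rule measurable_sets_borel[OF measurable_vec_wo \<tau>S])
    show "inj_on \<tau>1 (wo_vec ` S)"
      using inj by (auto simp: inj_on_def \<tau>1_def) (metis vec_wo_inverse(2))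
    fix u assume "u \<in> wo_vec ` S"
    then have u: "vec_wo u \<in> V" using S by (auto simp: vimage)
    have "(wo_vec \<circ> (\<tau> \<circ> vec_wo) has_derivative wo_vec \<circ> (fd \<tau> (vec_wo u) \<circ> vec_wo)) (at u)"
      by (intro diff_chain_at bounded_linear_imp_has_derivative bounded_linear_wo_vec bounded_linear_vec_wo
          Ck_Suc_has_derivative[OF C V u])
    then show "(\<tau>1 has_derivative \<tau>1' u) (at u within wo_vec ` S)"
      unfolding \<tau>1_def \<tau>1'_def comp_assoc by (rule has_derivative_at_withinI)
  qed
  also have "\<dots> = (\<integral>\<^sup>+u. ennreal (\<bar>det (matrix (\<tau>1' u))\<bar> * indicator (wo_vec ` S) u) \<partial>distr lborel borel wo_vec)"
    by (simp add: distr_wo_vec)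
  also have "\<dots> = (\<integral>\<^sup>+u. ennreal (\<bar>det (matrix (\<tau>1' (wo_vec u)))\<bar> * indicator (wo_vec ` S) (wo_vec u)) \<partial>lborel)"
    by (rule nn_integral_distr) (use meas in auto)
  also have "\<dots> = (\<integral>\<^sup>+u\<in>S. ennreal \<bar>det (matrix (fd \<tau> u))\<bar> \<partial>lborel)"
    by (intro nn_integral_cong) (auto simp: det vimage indicator_def)
  finally show ?thesis .
qed

text \<open>The formula for sets says that \<open>\<tau>\<close> pushes the measure with density
  |det D\<tau>| on \<open>V\<close> forward to Lebesgue measure on \<open>W\<close>. Equality of the
  two measures gives equality of integrals.\<close>

lemma nn_integral_C1_image:
  fixes \<tau> :: "real^'n::finite \<Rightarrow> real^'n"
  assumes V: "open V" and C: "C1 V \<tau>" and hom: "homeomorphism V W \<tau> \<sigma>" and W: "open W"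
    and h: "h \<in> borel_measurable borel" and S: "S \<in> sets borel" "S \<subseteq> V"
  shows "(\<integral>\<^sup>+w\<in>\<tau> ` S. h w \<partial>lborel) = (\<integral>\<^sup>+u\<in>S. ennreal \<bar>det (matrix (fd \<tau> u))\<bar> * h (\<tau> u) \<partial>lborel)"
proof -
  \<comment> \<open>The Jacobian, the map and its inverse are continuous only on \<open>V\<close> or
    \<open>W\<close>; extension by zero makes them Borel on the whole space.\<close>
  define J where "J u = ennreal (indicator V u *\<^sub>R \<bar>det (matrix (fd \<tau> u))\<bar>)" for u
  define t where "t u = indicator V u *\<^sub>R \<tau> u" for u
  define s where "s w = indicator W w *\<^sub>R \<sigma> w" for w
  have [measurable]: "V \<in> sets borel" "W \<in> sets borel" using V W by auto
  have [measurable]: "J \<in> borel_measurable borel"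
    unfolding J_def
    by (intro measurable_compose[OF _ measurable_ennreal] borel_measurable_continuous_on_indicator
        continuous_intros continuous_on_det_matrix C1_fd_continuous[OF C]) simp
  have t [measurable]: "t \<in> borel_measurable borel" and s: "s \<in> borel_measurable borel"
    unfolding t_def s_def
    by (auto intro!: borel_measurable_continuous_on_indicator homeomorphism_cont1[OF hom] homeomorphism_cont2[OF hom])
  have image: "\<tau> ` B = W \<inter> s -` B" if "B \<subseteq> V" for B
  proof -
    have "\<sigma> (\<tau> v) = v" "\<tau> v \<in> W" if "v \<in> V" for v
      using that hom homeomorphism_apply1 homeomorphism_image1 by blast+
    moreover have "\<tau> (\<sigma> w) = w" if "w \<in> W" for w
      using that hom homeomorphism_apply2 by blast
    ultimately show ?thesis using that unfolding s_def by (auto simp: image_iff) (metis subsetD)+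
  qed
  have image_sets: "\<tau> ` B \<in> sets borel" if "B \<subseteq> V" "B \<in> sets borel" for B
    unfolding image[OF that(1)] using measurable_sets_borel[OF s that(2)] W by simp
  have inj: "inj_on \<tau> V" using hom by (metis homeomorphism_apply1 inj_on_inverseI)
  have "distr (density lborel J) borel t = density lborel (indicator W)"
  proof (rule measure_eqI)
    fix A :: "(real^'n) set" assume "A \<in> sets (distr (density lborel J) borel t)"
    then have A [measurable]: "A \<in> sets borel" by simp
    let ?B = "V \<inter> t -` A"
    have B: "?B \<in> sets borel" using measurable_sets_borel[OF t A] V by simp
    have "emeasure (distr (density lborel J) borel t) A = (\<integral>\<^sup>+u. J u * indicator (t -` A) u \<partial>lborel)"
      using measurable_sets_borel[OF t A] by (simp add: emeasure_distr emeasure_density)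
    also have "\<dots> = (\<integral>\<^sup>+u\<in>?B. ennreal \<bar>det (matrix (fd \<tau> u))\<bar> \<partial>lborel)"
      by (intro nn_integral_cong) (auto simp: J_def indicator_def)
    also have "\<dots> = emeasure lborel (\<tau> ` ?B)"
      using inj by (intro emeasure_C1_image[OF V C B _ image_sets[OF _ B], symmetric]) (auto intro: inj_on_subset)
    also have "\<tau> ` ?B = W \<inter> A"
      using homeomorphism_image1[OF hom] by (auto simp: t_def)
    also have "emeasure lborel (W \<inter> A) = emeasure (density lborel (indicator W)) A"
      by (subst emeasure_density) (auto simp: indicator_inter_arith[symmetric])
    finally show "emeasure (distr (density lborel J) borel t) A = emeasure (density lborel (indicator W)) A" .
  qed simp
  then have eq: "(\<integral>\<^sup>+w. k w \<partial>distr (density lborel J) borel t) = (\<integral>\<^sup>+w. k w \<partial>density lborel (indicator W))" for k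
    by simp
  note [measurable] = h image_sets[OF S(2,1)] S(1)
  have m [measurable]: "(\<lambda>w. h w * indicator (\<tau> ` S) w) \<in> borel_measurable borel" by measurable
  have "(\<integral>\<^sup>+w\<in>\<tau> ` S. h w \<partial>lborel) = (\<integral>\<^sup>+w. indicator W w * (h w * indicator (\<tau> ` S) w) \<partial>lborel)"
    using image[OF S(2)] by (intro nn_integral_cong) (auto simp: indicator_def)
  also have "\<dots> = (\<integral>\<^sup>+w. h w * indicator (\<tau> ` S) w \<partial>density lborel (indicator W))"
    by (subst nn_integral_density) auto
  also have "\<dots> = (\<integral>\<^sup>+u. J u * (h (t u) * indicator (\<tau> ` S) (t u)) \<partial>lborel)"
    by (simp add: eq[symmetric] nn_integral_distr nn_integral_density)
  also have "\<dots> = (\<integral>\<^sup>+u\<in>S. ennreal \<bar>det (matrix (fd \<tau> u))\<bar> * h (\<tau> u) \<partial>lborel)"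
    using S inj by (intro nn_integral_cong) (auto simp: J_def t_def indicator_def inj_on_def)
  finally show ?thesis .
qed

subsection \<open>Gram matrices\<close>

definition gram :: "(real^'n \<Rightarrow> 'a::euclidean_space) \<Rightarrow> real^'n^'n" where
  "gram L = (\<chi> i j. L (axis i 1) \<bullet> L (axis j 1))"

lemma volume_density_gram: "volume_density f u = sqrt (det (gram (fd f u)))"
  by (simp add: volume_density_def gram_def induced_metric_def)

lemma linear_axis_expansion:
  fixes L :: "real^'n::finite \<Rightarrow> 'a::real_vector"
  assumes "linear L"
  shows "L v = (\<Sum>i\<in>UNIV. v $ i *\<^sub>R L (axis i 1))"
proof -
  have "v = (\<Sum>i\<in>UNIV. v $ i *\<^sub>R axis i 1)"
    using basis_expansion[of v] by (simp add: scalar_mult_eq_scaleR)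
  then have "L v = L (\<Sum>i\<in>UNIV. v $ i *\<^sub>R axis i 1)" by simp
  then show ?thesis by (simp only: linear_sum[OF assms] linear_scale[OF assms])
qed

lemma gram_compose:
  fixes L :: "real^'n::finite \<Rightarrow> 'a::euclidean_space" and T :: "real^'n \<Rightarrow> real^'n"
  assumes L: "linear L"
  shows "gram (\<lambda>v. L (T v)) = transpose (matrix T) ** gram L ** matrix T"
proof -
  have "L (T (axis i 1)) \<bullet> L (T (axis j 1)) =
    (\<Sum>k\<in>UNIV. (\<Sum>l\<in>UNIV. T (axis i 1) $ l * (L (axis l 1) \<bullet> L (axis k 1))) * T (axis j 1) $ k)" for i j
  proof -
    have "L (T (axis i 1)) \<bullet> L (T (axis j 1))
      = (\<Sum>l\<in>UNIV. T (axis i 1) $ l *\<^sub>R L (axis l 1)) \<bullet> (\<Sum>k\<in>UNIV. T (axis j 1) $ k *\<^sub>R L (axis k 1))"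
      using linear_axis_expansion[OF L] by metis
    also have "\<dots> = (\<Sum>k\<in>UNIV. (\<Sum>l\<in>UNIV. T (axis i 1) $ l * (L (axis l 1) \<bullet> L (axis k 1))) * T (axis j 1) $ k)"
      unfolding inner_sum_right
      by (intro sum.cong refl)
         (simp only: inner_scaleR_right inner_sum_left inner_scaleR_left mult.commute)
    finally show ?thesis .
  qed
  then show ?thesis
    by (simp add: vec_eq_iff gram_def matrix_matrix_mult_def transpose_def matrix_def)
qed

lemma sqrt_det_gram_compose:
  fixes L :: "real^'n::finite \<Rightarrow> 'a::euclidean_space" and T :: "real^'n \<Rightarrow> real^'n"
  assumes "linear L"
  shows "sqrt (det (gram (\<lambda>v. L (T v)))) = \<bar>det (matrix T)\<bar> * sqrt (det (gram L))"
proof -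
  have "det (gram (\<lambda>v. L (T v))) = (det (matrix T))\<^sup>2 * det (gram L)"
    by (subst gram_compose[OF assms]) (simp add: det_mul det_transpose power2_eq_square)
  then show ?thesis by (simp add: real_sqrt_mult)
qed

text \<open>Frames are indexed by the coordinate type instead of being sets, so that they form the
  columns of a square matrix and sums over them can be compared with sums over coordinates.\<close>

definition orthonormal_frame :: "(real^'n::finite \<Rightarrow> 'a::euclidean_space) \<Rightarrow> ('n \<Rightarrow> real^'n) \<Rightarrow> bool" where
  "orthonormal_frame L E \<longleftrightarrow> (\<forall>i j. L (E i) \<bullet> L (E j) = (if i = j then 1 else 0))"

lemma orthonormal_frame_exists:
  fixes L :: "real^'n::finite \<Rightarrow> 'a::euclidean_space"
  assumes L: "linear L" "inj L"
  obtains E where "orthonormal_frame L E"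
proof -
  have "subspace (range L)" using L(1) by (simp add: linear_subspace_image)
  then obtain B where B: "B \<subseteq> range L" "pairwise orthogonal B" "\<And>b. b \<in> B \<Longrightarrow> norm b = 1"
    "independent B" "card B = dim (range L)"
    using orthonormal_basis_subspace by metis
  have "dim (range L) = CARD('n)"
    using dim_image_eq[OF L(1), of UNIV] L(2) by (simp add: dim_UNIV)
  then obtain g :: "'n \<Rightarrow> 'a" where g: "bij_betw g UNIV B"
    using B(4,5) finite_same_card_bij[of "UNIV :: 'n set" B] independent_bound by auto
  have "\<forall>i. \<exists>e. L e = g i" using g B(1) unfolding bij_betw_def by (metis UNIV_I image_iff subset_iff)
  then obtain E where E: "\<And>i. L (E i) = g i" by metis
  have "g i \<bullet> g j = (if i = j then 1 else 0)" for i j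
  proof (cases "i = j")
    case True
    then show ?thesis using B(3)[of "g i"] g by (auto simp: bij_betw_def norm_eq_1)
  next
    case False
    then have "g i \<noteq> g j" "g i \<in> B" "g j \<in> B" using g by (auto simp: bij_betw_def inj_on_def)
    then have "orthogonal (g i) (g j)" using B(2) by (auto simp: pairwise_def)
    then show ?thesis using False by (simp add: orthogonal_def)
  qed
  then show ?thesis using that[of E] by (simp add: orthonormal_frame_def E)
qed

definition frame_map :: "('n \<Rightarrow> real^'n) \<Rightarrow> real^'n \<Rightarrow> real^('n::finite)" where
  "frame_map E v = (\<Sum>i\<in>UNIV. v $ i *\<^sub>R E i)"

lemma linear_frame_map: "linear (frame_map E)"
  by (rule linearI) (simp_all add: frame_map_def scaleR_left_distrib sum.distrib scaleR_sum_right)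

lemma frame_map_axis [simp]: "frame_map E (axis i 1) = E i"
proof -
  have "axis i 1 $ j *\<^sub>R E j = (if j = i then E j else 0)" for j by (simp add: axis_def)
  then show ?thesis by (simp add: frame_map_def)
qed

lemma gram_frame:
  assumes "orthonormal_frame L E"
  shows "gram (\<lambda>v. L (frame_map E v)) = mat 1"
  using assms by (simp add: gram_def orthonormal_frame_def mat_def vec_eq_iff)

text \<open>In the frame the Gram matrix is the identity, so the change of basis has determinant
  reciprocal to the volume density up to sign. This yields both the positivity of Gram determinants
  and the fact that a frame is a basis.\<close>

lemma det_gram_frame:
  fixes L :: "real^'n::finite \<Rightarrow> 'a::euclidean_space"
  assumes "linear L" "orthonormal_frame L E"
  shows "\<bar>det (matrix (frame_map E))\<bar> * sqrt (det (gram L)) = 1"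
  using sqrt_det_gram_compose[OF assms(1), of "frame_map E"] gram_frame[OF assms(2)] by simp

lemma det_gram_pos:
  fixes L :: "real^'n::finite \<Rightarrow> 'a::euclidean_space"
  assumes "linear L" "inj L"
  shows "0 < det (gram L)"
proof -
  obtain E where "orthonormal_frame L E" using orthonormal_frame_exists[OF assms] .
  from det_gram_frame[OF assms(1) this] have "0 < \<bar>det (matrix (frame_map E))\<bar> * sqrt (det (gram L))" by simp
  then have "0 < sqrt (det (gram L))" by (simp add: zero_less_mult_iff)
  then show ?thesis by simp
qed

text \<open>The nonzero determinant makes the frame span; pairing with \<open>L (E i)\<close> then
  reads off the coefficients.\<close>

lemma frame_expansion:
  fixes L :: "real^'n::finite \<Rightarrow> 'a::euclidean_space"
  assumes L: "linear L" and E: "orthonormal_frame L E"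
  shows "v = (\<Sum>i\<in>UNIV. (L v \<bullet> L (E i)) *\<^sub>R E i)"
proof -
  have "det (matrix (frame_map E)) \<noteq> 0" using det_gram_frame[OF assms] by auto
  then have "invertible (matrix (frame_map E))" by (simp add: invertible_det_nz)
  then have "surj (frame_map E)"
    using linear_frame_map by (metis bij_is_surj invertible_eq_bij matrix_of_matrix_vector_mul matrix_vector_mul(2) matrix_works)
  then obtain c where c: "v = frame_map E c" by blast
  have "L v \<bullet> L (E i) = c $ i" for i
  proof -
    have "L v \<bullet> L (E i) = (\<Sum>j\<in>UNIV. c $ j * (L (E j) \<bullet> L (E i)))"
      by (simp add: c frame_map_def linear_sum[OF L] linear_scale[OF L] inner_sum_left)
    also have "\<dots> = (\<Sum>j\<in>UNIV. if j = i then c $ j else 0)"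
      using E by (intro sum.cong) (auto simp: orthonormal_frame_def)
    also have "\<dots> = c $ i" by simp
    finally show ?thesis .
  qed
  then show ?thesis using c by (simp add: frame_map_def)
qed

lemma continuous_on_sqrt_det_gram:
  assumes "\<And>v. continuous_on S (\<lambda>u. L u v)"
  shows "continuous_on S (\<lambda>u. sqrt (det (gram (L u))))"
  unfolding det_def gram_def vec_lambda_beta
  by (intro continuous_intros assms)

subsection \<open>The Riemannian volume\<close>

locale immersed =
  fixes \<A> :: "('m::{t2_space, second_countable_topology}, 'n::finite) chart set"
    and x :: "'m \<Rightarrow> 'a::euclidean_space"
  assumes atlas: "smooth_atlas \<A>" and imm: "smooth_immersion \<A> x"
begin

abbreviation "cdom c \<equiv> fst (c :: ('m, 'n) chart)"
abbreviation "img c \<equiv> snd (c :: ('m, 'n) chart) ` fst c"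
abbreviation "X c \<equiv> x \<circ> chart_inv c"
abbreviation "transit c d \<equiv> snd (d :: ('m, 'n) chart) \<circ> chart_inv c"
abbreviation "overlap c d \<equiv> snd (c :: ('m, 'n) chart) ` (fst c \<inter> fst d)"
abbreviation "dens c \<equiv> volume_density (X c)"

lemma open_dom: "c \<in> \<A> \<Longrightarrow> open (cdom c)"
  and open_img: "c \<in> \<A> \<Longrightarrow> open (img c)"
  using atlas by (auto simp: smooth_atlas_def is_chart_def)

lemma chart_homeomorphism: 
  assumes "c \<in> \<A>"
  shows "homeomorphism (cdom c) (img c) (snd c) (chart_inv c)"
proof -
  obtain \<psi> where \<psi>: "homeomorphism (cdom c) (img c) (snd c) \<psi>"
    using atlas assms by (auto simp: smooth_atlas_def is_chart_def)
  then have "inj_on (snd c) (cdom c)" by (metis homeomorphism_apply1 inj_on_inverseI)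
  then have "chart_inv c u = \<psi> u" if "u \<in> img c" for u
    using that \<psi> by (auto simp: chart_inv_def homeomorphism_def)
  then show ?thesis by (rule homeomorphism_cong[OF \<psi> refl refl refl])
qed

lemma chart_inv_chart: "c \<in> \<A> \<Longrightarrow> q \<in> cdom c \<Longrightarrow> chart_inv c (snd c q) = q"
  using chart_homeomorphism homeomorphism_apply1 by blast

lemma chart_inv_in: "c \<in> \<A> \<Longrightarrow> u \<in> img c \<Longrightarrow> chart_inv c u \<in> cdom c"
  by (metis chart_inv_chart imageE)

lemma chart_chart_inv: "c \<in> \<A> \<Longrightarrow> u \<in> img c \<Longrightarrow> snd c (chart_inv c u) = u"
  by (metis chart_inv_chart imageE)

lemma chart_inv_image: "c \<in> \<A> \<Longrightarrow> S \<subseteq> cdom c \<Longrightarrow> chart_inv c ` snd c ` S = S"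
  unfolding image_image using chart_inv_chart by (metis (no_types, lifting) image_cong image_ident subsetD)

lemma chart_continuous: "c \<in> \<A> \<Longrightarrow> continuous_on (cdom c) (snd c)"
  and chart_inv_continuous: "c \<in> \<A> \<Longrightarrow> continuous_on (img c) (chart_inv c)"
  using chart_homeomorphism homeomorphism_cont1 homeomorphism_cont2 by blast+

lemma chart_cover: obtains c where "c \<in> \<A>" "q \<in> cdom c"
  using atlas unfolding smooth_atlas_def by (metis UNIV_I UN_iff)

lemma smooth_X: "c \<in> \<A> \<Longrightarrow> smooth_on (img c) (X c)"
  and inj_fd_X: "c \<in> \<A> \<Longrightarrow> u \<in> img c \<Longrightarrow> inj (fd (X c) u)"
  using imm by (auto simp: smooth_immersion_def)

lemma linear_fd_X: "c \<in> \<A> \<Longrightarrow> u \<in> img c \<Longrightarrow> linear (fd (X c) u)"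
  using fd_linear smooth_C1[OF smooth_X] open_img by blast

lemma smooth_trans: "c \<in> \<A> \<Longrightarrow> d \<in> \<A> \<Longrightarrow> smooth_on (overlap c d) (transit c d)"
  using atlas by (auto simp: smooth_atlas_def)

lemma open_chart_image:
  assumes "c \<in> \<A>" "open W" "W \<subseteq> cdom c"
  shows "open (snd c ` W)"
  using homeomorphism_imp_open_map[OF chart_homeomorphism[OF assms(1)], of W] assms open_img
  by (metis inf.absorb_iff2 openin_open openin_open_trans)

lemma open_overlap: "c \<in> \<A> \<Longrightarrow> d \<in> \<A> \<Longrightarrow> open (overlap c d)"
  by (intro open_chart_image) (auto simp: open_dom)

lemma trans_image: "c \<in> \<A> \<Longrightarrow> S \<subseteq> cdom c \<Longrightarrow> transit c d ` snd c ` S = snd d ` S"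
  using chart_inv_image by (metis image_comp)

lemma homeomorphism_trans:
  assumes c: "c \<in> \<A>" and d: "d \<in> \<A>"
  shows "homeomorphism (overlap c d) (overlap d c) (transit c d) (transit d c)"
proof (rule homeomorphismI)
  show "continuous_on (overlap c d) (transit c d)" "continuous_on (overlap d c) (transit d c)"
    using smooth_trans c d smooth_C1 C1_continuous by blast+
qed (auto simp: chart_inv_chart c d)

lemma X_trans: "c \<in> \<A> \<Longrightarrow> d \<in> \<A> \<Longrightarrow> u \<in> overlap c d \<Longrightarrow> X c u = X d (transit c d u)"
  by (auto simp: chart_inv_chart)

lemma fd_X_trans:
  assumes c: "c \<in> \<A>" and d: "d \<in> \<A>" and u: "u \<in> overlap c d"
  shows "fd (X c) u = (\<lambda>v. fd (X d) (transit c d u) (fd (transit c d) u v))"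
proof -
  have u': "transit c d u \<in> img d" using u by (auto simp: chart_inv_chart c d)
  have "fd (X c) u = fd (\<lambda>u. X d (transit c d u)) u"
    by (rule fd_cong[OF open_overlap[OF c d] u]) (rule X_trans[OF c d])
  also have "\<dots> = (\<lambda>v. fd (X d) (transit c d u) (fd (transit c d) u v))"
    by (rule ext, rule fd_compose)
       (intro Ck_Suc_has_derivative[OF smooth_C1[OF smooth_trans[OF c d]] open_overlap[OF c d] u]
          Ck_Suc_has_derivative[OF smooth_C1[OF smooth_X[OF d]] open_img[OF d] u'])+
  finally show ?thesis .
qed

lemma dens_trans:
  assumes c: "c \<in> \<A>" and d: "d \<in> \<A>" and u: "u \<in> overlap c d"
  shows "dens c u = \<bar>det (matrix (fd (transit c d) u))\<bar> * dens d (transit c d u)"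
proof -
  have "transit c d u \<in> img d" using u by (auto simp: chart_inv_chart c d)
  then show ?thesis
    unfolding volume_density_gram fd_X_trans[OF assms]
    by (intro sqrt_det_gram_compose linear_fd_X d)
qed

lemma dens_pos: "c \<in> \<A> \<Longrightarrow> u \<in> img c \<Longrightarrow> 0 < dens c u"
  unfolding volume_density_gram using det_gram_pos[OF linear_fd_X inj_fd_X] by simp

lemma continuous_on_dens: "c \<in> \<A> \<Longrightarrow> continuous_on (img c) (dens c)"
  unfolding volume_density_gram[abs_def]
  by (intro continuous_on_sqrt_det_gram C1_fd_continuous smooth_C1 smooth_X)

lemma chart_image_borel:
  assumes c: "c \<in> \<A>" and S: "S \<in> sets borel" "S \<subseteq> cdom c"
  shows "snd c ` S \<in> sets borel"
proof -
  have "chart_inv c -` S \<inter> space (restrict_space borel (img c)) \<in> sets (restrict_space borel (img c))"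
    by (intro measurable_sets[OF borel_measurable_continuous_on_restrict] chart_inv_continuous c S)
  then have "chart_inv c -` S \<inter> img c \<in> sets borel"
    using open_img[OF c] by (simp add: space_restrict_space sets_restrict_space_iff)
  moreover have "chart_inv c -` S \<inter> img c = snd c ` S"
    using S c by (auto simp: chart_inv_chart image_iff)
  ultimately show ?thesis by simp
qed

section \<open>Existence and uniqueness of the volume measure\<close>

definition vol_in :: "('m, 'n) chart \<Rightarrow> 'm set \<Rightarrow> ennreal" where
  "vol_in c S = (\<integral>\<^sup>+u\<in>snd c ` S. ennreal (dens c u) \<partial>lborel)"

lemma dens_ind_measurable: "c \<in> \<A> \<Longrightarrow> (\<lambda>u. indicator (img c) u *\<^sub>R dens c u) \<in> borel_measurable borel"
  by (intro borel_measurable_continuous_on_indicator continuous_on_dens) (auto simp: open_img)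

text \<open>Change of variables along the transition map, whose Jacobian is by
  \<open>dens_trans\<close> the quotient of the two densities.\<close>

lemma vol_in_unique:
  assumes c: "c \<in> \<A>" and d: "d \<in> \<A>" and S: "S \<in> sets borel" "S \<subseteq> cdom c" "S \<subseteq> cdom d"
  shows "vol_in c S = vol_in d S"
proof -
  let ?h = "\<lambda>w. ennreal (indicator (img d) w *\<^sub>R dens d w)"
  have "vol_in d S = (\<integral>\<^sup>+w\<in>transit c d ` snd c ` S. ?h w \<partial>lborel)"
    unfolding trans_image[OF c S(2)] vol_in_def using S
    by (intro nn_integral_cong) (auto simp: indicator_def)
  also have "\<dots> = (\<integral>\<^sup>+u\<in>snd c ` S. ennreal \<bar>det (matrix (fd (transit c d) u))\<bar> * ?h (transit c d u) \<partial>lborel)"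
    using S by (intro nn_integral_C1_image[OF open_overlap[OF c d] smooth_C1[OF smooth_trans[OF c d]]
          homeomorphism_trans[OF c d] open_overlap[OF d c]] measurable_compose[OF dens_ind_measurable[OF d]]
          chart_image_borel c) auto
  also have "\<dots> = vol_in c S"
    unfolding vol_in_def
  proof (intro nn_integral_cong)
    fix u
    show "ennreal \<bar>det (matrix (fd (transit c d) u))\<bar> * ?h (transit c d u) * indicator (snd c ` S) u
      = ennreal (dens c u) * indicator (snd c ` S) u"
    proof (cases "u \<in> snd c ` S")
      case True
      then have u: "u \<in> overlap c d" using S by auto
      then have "transit c d u \<in> img d" by (auto simp: chart_inv_chart c d)
      then show ?thesis using True dens_trans[OF c d u] dens_pos[OF d] by (simp add: ennreal_mult' less_imp_le)
    qed simp
  qed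
  finally show ?thesis by simp
qed

text \<open>Turns \<open>vol_in c\<close> into a measure on the whole manifold, concentrated on the
  chart domain, so that countable additivity and integration rules are available.\<close>

definition chart_vol :: "('m, 'n) chart \<Rightarrow> 'm measure" where
  "chart_vol c = distr (density (restrict_space lborel (img c)) (\<lambda>u. ennreal (dens c u))) borel (chart_inv c)"

lemma sets_chart_vol [simp]: "sets (chart_vol c) = sets borel"
  by (simp add: chart_vol_def)

lemma chart_inv_measurable:
  assumes "c \<in> \<A>"
  shows "chart_inv c \<in> measurable (restrict_space lborel (img c)) borel"
proof -
  have "measurable (restrict_space lborel (img c)) borel = measurable (restrict_space borel (img c)) (borel :: 'm measure)"
    by (rule measurable_cong_sets) (simp_all add: sets_restrict_space)
  then show ?thesis
    using borel_measurable_continuous_on_restrict[OF chart_inv_continuous[OF assms]] by simp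
qed

lemma dens_measurable:
  assumes "c \<in> \<A>"
  shows "dens c \<in> borel_measurable (restrict_space lborel (img c))"
proof -
  have "borel_measurable (restrict_space lborel (img c)) = borel_measurable (restrict_space borel (img c))"
    by (rule measurable_cong_sets) (simp_all add: sets_restrict_space)
  then show ?thesis
    using borel_measurable_continuous_on_restrict[OF continuous_on_dens[OF assms]] by simp
qed

lemma emeasure_chart_vol:
  assumes c: "c \<in> \<A>" and S: "S \<in> sets borel"
  shows "emeasure (chart_vol c) S = vol_in c (S \<inter> cdom c)"
proof -
  have [measurable]: "chart_inv c \<in> measurable (restrict_space lborel (img c)) borel"
    "dens c \<in> borel_measurable (restrict_space lborel (img c))"
    using chart_inv_measurable dens_measurable c by auto
  let ?P = "chart_inv c -` S \<inter> img c"
  have P: "?P \<in> sets (restrict_space lborel (img c))"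
    using measurable_sets[OF chart_inv_measurable[OF c] S] by (simp add: space_restrict_space)
  have "emeasure (chart_vol c) S = (\<integral>\<^sup>+u. ennreal (dens c u) * indicator ?P u \<partial>restrict_space lborel (img c))"
    unfolding chart_vol_def using S P
    by (subst emeasure_distr) (auto simp: emeasure_density space_restrict_space)
  also have "\<dots> = (\<integral>\<^sup>+u. ennreal (dens c u) * indicator ?P u * indicator (img c) u \<partial>lborel)"
    using open_img[OF c] by (subst nn_integral_restrict_space) auto
  also have "?P = snd c ` (S \<inter> cdom c)"
    using c by (auto simp: chart_inv_chart image_iff)
  also have "(\<integral>\<^sup>+u. ennreal (dens c u) * indicator (snd c ` (S \<inter> cdom c)) u * indicator (img c) u \<partial>lborel)
    = vol_in c (S \<inter> cdom c)"
    unfolding vol_in_def by (intro nn_integral_cong) (auto simp: indicator_def)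
  finally show ?thesis .
qed

definition is_volume :: "'m measure \<Rightarrow> bool" where
  "is_volume \<mu> \<longleftrightarrow> sets \<mu> = sets borel \<and>
     (\<forall>c\<in>\<A>. \<forall>S\<in>sets borel. S \<subseteq> cdom c \<longrightarrow> emeasure \<mu> S = vol_in c S)"

text \<open>Second countability gives a countable subcover; removing earlier domains makes it
  disjoint. The pieces are Borel but in general not open.\<close>

lemma countable_partition:
  obtains C :: "nat \<Rightarrow> ('m, 'n) chart" and D where "range C \<subseteq> \<A>" "\<And>i. D i \<subseteq> cdom (C i)"
    "\<And>i. D i \<in> sets borel" "disjoint_family D" "(\<Union>i. D i) = UNIV"
proof -
  have U: "\<Union>(fst ` \<A>) = (UNIV :: 'm set)" using atlas by (simp add: smooth_atlas_def)
  obtain F where F: "F \<subseteq> fst ` \<A>" "countable F" "\<Union>F = (UNIV :: 'm set)"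
    using Lindelof[of "fst ` \<A>"] open_dom U by (metis imageE)
  then have ne: "F \<noteq> {}" by auto
  define C where "C i = (SOME c. c \<in> \<A> \<and> cdom c = from_nat_into F i)" for i
  have C: "C i \<in> \<A>" "cdom (C i) = from_nat_into F i" for i
  proof -
    have "from_nat_into F i \<in> fst ` \<A>" using from_nat_into[OF ne] F(1) by blast
    then have "\<exists>c. c \<in> \<A> \<and> cdom c = from_nat_into F i" by auto
    from someI_ex[OF this] show "C i \<in> \<A>" "cdom (C i) = from_nat_into F i" by (simp_all add: C_def)
  qed
  have "(\<Union>i. cdom (C i)) = UNIV"
    using F(3) range_from_nat_into[OF ne F(2)] by (simp add: C(2))
  then have "(\<Union>i. disjointed (\<lambda>i. cdom (C i)) i) = UNIV" by (simp add: UN_disjointed_eq)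
  moreover have "range (disjointed (\<lambda>i. cdom (C i))) \<subseteq> sets borel"
    by (intro sets.range_disjointed_sets) (auto simp: open_dom C(1))
  ultimately show ?thesis
    using that[of C "disjointed (\<lambda>i. cdom (C i))"] C(1) disjointed_subset[of "\<lambda>i. cdom (C i)"]
      disjoint_family_disjointed[of "\<lambda>i. cdom (C i)"] by blast
qed

lemma is_volume_unique:
  assumes \<mu>: "is_volume \<mu>" and \<nu>: "is_volume \<nu>"
  shows "\<mu> = \<nu>"
proof (rule measure_eqI)
  show "sets \<mu> = sets \<nu>" using assms by (simp add: is_volume_def)
  fix S assume "S \<in> sets \<mu>"
  then have S: "S \<in> sets borel" using \<mu> by (simp add: is_volume_def)
  obtain C :: "nat \<Rightarrow> ('m, 'n) chart" and D where CD: "range C \<subseteq> \<A>" "\<And>i. D i \<subseteq> cdom (C i)"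
    "\<And>i. D i \<in> sets borel" "disjoint_family D" "(\<Union>i. D i) = UNIV"
    using countable_partition by blast
  have eq: "emeasure \<kappa> S = (\<Sum>i. vol_in (C i) (S \<inter> D i))" if "is_volume \<kappa>" for \<kappa>
  proof -
    have v: "emeasure \<kappa> (S \<inter> D i) = vol_in (C i) (S \<inter> D i)" for i
    proof -
      have "C i \<in> \<A>" "S \<inter> D i \<in> sets borel" "S \<inter> D i \<subseteq> cdom (C i)" using CD S by blast+
      then show ?thesis using that by (simp add: is_volume_def)
    qed
    have "(\<Sum>i. emeasure \<kappa> (S \<inter> D i)) = emeasure \<kappa> (\<Union>i. S \<inter> D i)"
      using that S CD(3,4) by (intro suminf_emeasure) (auto simp: is_volume_def disjoint_family_on_def)
    also have "(\<Union>i. S \<inter> D i) = S" using CD(5) by blast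
    finally show ?thesis by (simp add: v)
  qed
  show "emeasure \<mu> S = emeasure \<nu> S" using eq[OF \<mu>] eq[OF \<nu>] by simp
qed

text \<open>Each piece of a countable partition is measured in its own chart and the results are
  added. For a set inside some other chart the value is the prescribed one because
  \<open>vol_in\<close> does not depend on the chart.\<close>

lemma is_volume_exists: "\<exists>\<mu>. is_volume \<mu>"
proof -
  obtain C :: "nat \<Rightarrow> ('m, 'n) chart" and D where CD: "range C \<subseteq> \<A>" "\<And>i. D i \<subseteq> cdom (C i)"
    "\<And>i. D i \<in> sets borel" "disjoint_family D" "(\<Union>i. D i) = UNIV"
    using countable_partition by blast
  have C: "C i \<in> \<A>" for i using CD(1) by blast
  \<comment> \<open>The sum over pieces is an integral against counting measure, so countable
    additivity follows from exchanging integral and series.\<close>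
  define f where "f S = (\<integral>\<^sup>+i. emeasure (chart_vol (C i)) (S \<inter> D i) \<partial>count_space UNIV)" for S
  define \<mu> where "\<mu> = measure_of UNIV (sets borel) f"
  have sets\<mu>: "sets \<mu> = sets borel" unfolding \<mu>_def using sets.sigma_sets_eq[of borel] by simp
  have em: "emeasure \<mu> S = f S" if S: "S \<in> sets borel" for S
  proof (rule emeasure_measure_of[OF \<mu>_def])
    show "positive (sets \<mu>) f" by (simp add: positive_def f_def)
    show "countably_additive (sets \<mu>) f"
    proof (rule countably_additiveI)
      fix T :: "nat \<Rightarrow> 'm set" assume T: "range T \<subseteq> sets \<mu>" "disjoint_family T"
      have T': "T k \<in> sets borel" for k using T(1) by (auto simp: sets\<mu>)
      have "(\<Sum>k. f (T k)) = (\<integral>\<^sup>+i. (\<Sum>k. emeasure (chart_vol (C i)) (T k \<inter> D i)) \<partial>count_space UNIV)"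
        unfolding f_def by (rule nn_integral_suminf[symmetric]) simp
      also have "\<dots> = (\<integral>\<^sup>+i. emeasure (chart_vol (C i)) (\<Union>k. T k \<inter> D i) \<partial>count_space UNIV)"
      proof (intro nn_integral_cong suminf_emeasure)
        show "disjoint_family (\<lambda>k. T k \<inter> D i)" for i
          using T(2) unfolding disjoint_family_on_def by blast
      qed (use T' CD(3) in auto)
      also have "\<dots> = f (\<Union>k. T k)" by (simp add: f_def)
      finally show "(\<Sum>k. f (T k)) = f (\<Union>k. T k)" .
    qed
  qed (use S sets\<mu> in auto)
  have "is_volume \<mu>"
    unfolding is_volume_def
  proof (intro conjI ballI impI)
    show "sets \<mu> = sets borel" by (rule sets\<mu>)
    fix c S assume c: "c \<in> \<A>" and S: "S \<in> sets borel" "S \<subseteq> cdom c"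
    have *: "emeasure (chart_vol (C i)) (S \<inter> D i) = emeasure (chart_vol c) (S \<inter> D i)" for i
    proof -
      have "S \<inter> D i \<inter> cdom (C i) = S \<inter> D i" "S \<inter> D i \<inter> cdom c = S \<inter> D i" using CD(2) S by auto
      moreover have "vol_in (C i) (S \<inter> D i) = vol_in c (S \<inter> D i)"
        using S CD(2)[of i] CD(3)[of i] by (intro vol_in_unique C c) auto
      ultimately show ?thesis using S CD(3) by (simp add: emeasure_chart_vol C c)
    qed
    have "emeasure \<mu> S = (\<Sum>i. emeasure (chart_vol c) (S \<inter> D i))"
      by (simp add: em[OF S(1)] f_def * nn_integral_count_space_nat)
    also have "\<dots> = emeasure (chart_vol c) (\<Union>i. S \<inter> D i)"
    proof (intro suminf_emeasure)
      show "disjoint_family (\<lambda>i. S \<inter> D i)"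
        using CD(4) unfolding disjoint_family_on_def by blast
    qed (use S CD(3) in auto)
    also have "(\<Union>i. S \<inter> D i) = S" using CD(5) by blast
    also have "emeasure (chart_vol c) S = vol_in c S"
      using S by (simp add: emeasure_chart_vol c inf.absorb1)
    finally show "emeasure \<mu> S = vol_in c S" .
  qed
  then show ?thesis by blast
qed

abbreviation "vol \<equiv> riemannian_volume \<A> x"

text \<open>Justifies the definite description in \<open>riemannian_volume\<close>; from here on the
  volume is accessed through \<open>is_volume\<close>.\<close>

lemma is_volume_vol: "is_volume vol"
proof -
  have "\<exists>!\<mu>. is_volume \<mu>" using is_volume_exists is_volume_unique by blast
  from theI'[OF this] show ?thesis
    unfolding riemannian_volume_def is_volume_def vol_in_def by simp
qed

lemma sets_vol [simp, measurable_cong]: "sets vol = sets borel"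
  using is_volume_vol by (simp add: is_volume_def)

lemma space_vol [simp]: "space vol = UNIV"
  using sets_eq_imp_space_eq[OF sets_vol] by simp

lemma emeasure_vol: "c \<in> \<A> \<Longrightarrow> S \<in> sets borel \<Longrightarrow> S \<subseteq> cdom c \<Longrightarrow> emeasure vol S = vol_in c S"
  using is_volume_vol by (simp add: is_volume_def)

lemma density_vol_dom:
  assumes c: "c \<in> \<A>"
  shows "density vol (indicator (cdom c)) = chart_vol c"
proof (rule measure_eqI)
  fix S assume "S \<in> sets (density vol (indicator (cdom c)))"
  then have S: "S \<in> sets borel" by simp
  have "emeasure (density vol (indicator (cdom c))) S = emeasure vol (S \<inter> cdom c)"
    using S open_dom[OF c] emeasure_density[of "indicator (cdom c)" vol S]
    by (simp add: borel_measurable_indicator indicator_inter_arith[symmetric] Int_commute)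
  then show "emeasure (density vol (indicator (cdom c))) S = emeasure (chart_vol c) S"
    using emeasure_vol[OF c, of "S \<inter> cdom c"] emeasure_chart_vol[OF c S] S open_dom[OF c] by auto
qed simp

lemma integral_vol_chart:
  fixes h :: "'m \<Rightarrow> real"
  assumes c: "c \<in> \<A>" and h: "h \<in> borel_measurable borel" and supp: "\<And>q. q \<notin> cdom c \<Longrightarrow> h q = 0"
  shows "(\<integral>q. h q \<partial>vol) = (\<integral>u. indicator (img c) u *\<^sub>R (dens c u * h (chart_inv c u)) \<partial>lborel)"
proof -
  have "(\<integral>q. h q \<partial>vol) = (\<integral>q. indicator (cdom c) q *\<^sub>R h q \<partial>vol)"
    using supp by (intro Bochner_Integration.integral_cong) (auto simp: indicator_def)
  also have "\<dots> = (\<integral>q. h q \<partial>density vol (\<lambda>q. ennreal (indicator (cdom c) q)))"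
    using h open_dom[OF c]
    by (intro integral_density[symmetric] borel_measurable_indicator) (auto cong: measurable_cong_sets)
  also have "density vol (\<lambda>q. ennreal (indicator (cdom c) q)) = chart_vol c"
    using density_vol_dom[OF c] by (simp add: ennreal_indicator)
  also have "(\<integral>q. h q \<partial>chart_vol c) =
     (\<integral>u. h (chart_inv c u) \<partial>density (restrict_space lborel (img c)) (\<lambda>u. ennreal (dens c u)))"
    unfolding chart_vol_def using chart_inv_measurable[OF c] h by (intro integral_distr) auto
  also have "\<dots> = (\<integral>u. dens c u *\<^sub>R h (chart_inv c u) \<partial>restrict_space lborel (img c))"
  proof (rule integral_density)
    show "AE u in restrict_space lborel (img c). 0 \<le> dens c u"
      using dens_pos[OF c] by (intro AE_I2) (auto simp: space_restrict_space less_imp_le)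
  qed (use dens_measurable[OF c] measurable_compose[OF chart_inv_measurable[OF c] h] in auto)
  also have "\<dots> = (\<integral>u. indicator (img c) u *\<^sub>R (dens c u * h (chart_inv c u)) \<partial>lborel)"
    using open_img[OF c] by (subst integral_restrict_space) auto
  finally show ?thesis .
qed

text \<open>The density is bounded on closed coordinate balls, so every point has an open
  neighbourhood of finite volume, and finitely many of these cover the compact set.\<close>

lemma emeasure_vol_compact:
  assumes K: "compact K"
  shows "emeasure vol K < \<infinity>"
proof -
  have "\<exists>W. open W \<and> q \<in> W \<and> emeasure vol W < \<infinity>" for q
  proof -
    obtain c where c: "c \<in> \<A>" "q \<in> cdom c" using chart_cover .
    then obtain e where e: "e > 0" "cball (snd c q) e \<subseteq> img c"
      using open_img[OF c(1)] open_contains_cball by blast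
    let ?B = "ball (snd c q) e" and ?W = "chart_inv c ` ball (snd c q) e"
    have B: "?B \<subseteq> img c" using e ball_subset_cball by blast
    have sub: "?W \<subseteq> cdom c" using B chart_inv_in c by blast
    have W: "open ?W"
    proof -
      have "openin (top_of_set (cdom c)) ?W"
        by (rule homeomorphism_imp_open_map[OF homeomorphism_symD[OF chart_homeomorphism[OF c(1)]]])
           (use B in \<open>auto simp: openin_open\<close>)
      then show ?thesis using open_dom[OF c(1)] openin_open_trans by blast
    qed
    have im: "snd c ` ?W = ?B"
      using B chart_chart_inv[OF c(1)] by (force simp: image_iff)
    have "compact (dens c ` cball (snd c q) e)"
      by (rule compact_continuous_image[OF continuous_on_subset[OF continuous_on_dens[OF c(1)] e(2)]]) simp
    then have "bounded (dens c ` cball (snd c q) e)" by (rule compact_imp_bounded)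
    then obtain b where "\<forall>y\<in>dens c ` cball (snd c q) e. norm y \<le> b" unfolding bounded_iff ..
    then have b: "\<bar>dens c u\<bar> \<le> b" if "u \<in> cball (snd c q) e" for u
      using that by (metis imageI real_norm_def)
    have "emeasure vol ?W = vol_in c ?W" using W sub by (intro emeasure_vol c) auto
    also have "\<dots> \<le> (\<integral>\<^sup>+u. ennreal b * indicator ?B u \<partial>lborel)"
      unfolding vol_in_def im
    proof (intro nn_integral_mono)
      fix u
      show "ennreal (dens c u) * indicator ?B u \<le> ennreal b * indicator ?B u"
        using b[of u] by (auto simp: indicator_def intro!: ennreal_leI)
    qed
    also have "\<dots> = ennreal b * emeasure lborel ?B" by (rule nn_integral_cmult_indicator) simp
    also have "\<dots> < \<infinity>"
      using emeasure_lborel_ball_finite[of "snd c q" e] by (simp add: ennreal_mult_less_top)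
    finally have "emeasure vol ?W < \<infinity>" .
    moreover have "q \<in> ?W" using c e by (auto simp: image_iff chart_inv_chart intro!: bexI[of _ "snd c q"])
    ultimately show ?thesis using W by blast
  qed
  then obtain W where W: "\<And>q. open (W q)" "\<And>q. q \<in> W q" "\<And>q. emeasure vol (W q) < \<infinity>" by metis
  obtain T where T: "T \<subseteq> K" "finite T" "K \<subseteq> (\<Union>q\<in>T. W q)"
    using compactE_image[OF K, of K W] W by blast
  have "emeasure vol K \<le> emeasure vol (\<Union>q\<in>T. W q)" using T W by (intro emeasure_mono) auto
  also have "\<dots> \<le> (\<Sum>q\<in>T. emeasure vol (W q))"
    using T W by (intro emeasure_subadditive_finite) auto
  also have "\<dots> < \<infinity>" using W(3) T(2) by simp
  finally show ?thesis .
qed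

end

subsection \<open>The divergence of the tangential position field\<close>

text \<open>An injective map cannot move exactly one point.\<close>

lemma permutes_almost_id:
  assumes p: "p permutes UNIV" and fix_other: "\<And>j. j \<noteq> i \<Longrightarrow> p j = j"
  shows "p = id"
proof
  fix j
  have "inj p" using p by (simp add: permutes_inj)
  show "p j = id j"
  proof (cases "j = i")
    case True
    show ?thesis
    proof (rule ccontr)
      assume "p j \<noteq> id j"
      then have "p (p j) = p j" using True fix_other by simp
      then show False using \<open>inj p\<close> \<open>p j \<noteq> id j\<close> by (simp add: inj_eq)
    qed
  qed (simp add: fix_other)
qed

text \<open>In the Leibniz formula, a product for p different from \<open>id\<close> still contains
  an off-diagonal entry of the identity matrix after one factor is differentiated. Only p =
  \<open>id\<close> survives and gives the trace.\<close>

lemma has_derivative_det_at_identity: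
  fixes H :: "'a::real_normed_vector \<Rightarrow> real^'n::finite^'n"
  assumes der: "\<And>i j. ((\<lambda>y. H y $ i $ j) has_derivative H' i j) (at u)" and one: "H u = mat 1"
  shows "((\<lambda>y. det (H y)) has_derivative (\<lambda>v. \<Sum>i\<in>UNIV. H' i i v)) (at u)"
proof -
  let ?P = "{p. p permutes (UNIV :: 'n set)}"
  have fin: "finite ?P" by (simp add: finite_permutations)
  have summand: "of_int (sign p) * (\<Sum>i\<in>UNIV. H' i (p i) v * (\<Prod>j\<in>UNIV - {i}. H u $ j $ p j))
     = (if p = id then \<Sum>i\<in>UNIV. H' i i v else 0)" if p: "p \<in> ?P" for p v
  proof (cases "p = id")
    case True
    then show ?thesis by (simp add: one mat_def)
  next
    case False
    have z: "(\<Prod>j\<in>UNIV - {i}. H u $ j $ p j) = 0" for i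
    proof -
      obtain j where "j \<noteq> i" "p j \<noteq> j" using permutes_almost_id[of p i] p False by auto
      then show ?thesis by (intro prod_zero bexI[of _ j]) (auto simp: one mat_def)
    qed
    show ?thesis unfolding z using False by simp
  qed
  have "((\<lambda>y. det (H y)) has_derivative
    (\<lambda>v. \<Sum>p\<in>?P. of_int (sign p) * (\<Sum>i\<in>UNIV. H' i (p i) v * (\<Prod>j\<in>UNIV - {i}. H u $ j $ p j)))) (at u)"
    unfolding det_def by (intro has_derivative_sum has_derivative_mult_right has_derivative_prod der)
  moreover have "(\<Sum>p\<in>?P. of_int (sign p) * (\<Sum>i\<in>UNIV. H' i (p i) v * (\<Prod>j\<in>UNIV - {i}. H u $ j $ p j)))
    = (\<Sum>i\<in>UNIV. H' i i v)" for v
  proof -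
    have "(\<Sum>p\<in>?P. of_int (sign p) * (\<Sum>i\<in>UNIV. H' i (p i) v * (\<Prod>j\<in>UNIV - {i}. H u $ j $ p j)))
      = (\<Sum>p\<in>?P. if p = id then \<Sum>i\<in>UNIV. H' i i v else 0)"
      by (rule sum.cong[OF refl summand])
    also have "\<dots> = (\<Sum>i\<in>UNIV. H' i i v)"
      using fin by (simp add: permutes_id)
    finally show ?thesis .
  qed
  ultimately show ?thesis by simp
qed

text \<open>The trace does not depend on the basis: the frame vectors are expanded in coordinates,
  the sums exchanged, and \<open>frame_expansion\<close> reassembles the image of each axis
  vector.\<close>

lemma trace_frame:
  fixes L :: "real^'n::finite \<Rightarrow> 'a::euclidean_space" and M :: "real^'n \<Rightarrow> real^'n"
  assumes L: "linear L" and E: "orthonormal_frame L E" and M: "linear M"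
  shows "(\<Sum>j\<in>UNIV. M (axis j 1) $ j) = (\<Sum>i\<in>UNIV. L (M (E i)) \<bullet> L (E i))"
proof -
  have "(\<Sum>i\<in>UNIV. L (M (E i)) \<bullet> L (E i)) = (\<Sum>i\<in>UNIV. \<Sum>j\<in>UNIV. E i $ j * (L (M (axis j 1)) \<bullet> L (E i)))"
  proof (rule sum.cong[OF refl])
    fix i
    have "linear (\<lambda>v. L (M v))" using linear_compose[OF M L] by (simp add: o_def)
    from linear_axis_expansion[OF this, of "E i"]
    show "L (M (E i)) \<bullet> L (E i) = (\<Sum>j\<in>UNIV. E i $ j * (L (M (axis j 1)) \<bullet> L (E i)))"
      by (simp add: inner_sum_left)
  qed
  also have "\<dots> = (\<Sum>j\<in>UNIV. (\<Sum>i\<in>UNIV. (L (M (axis j 1)) \<bullet> L (E i)) *\<^sub>R E i) $ j)"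
    by (subst sum.swap) (simp add: sum_component mult.commute)
  also have "\<dots> = (\<Sum>j\<in>UNIV. M (axis j 1) $ j)"
    using frame_expansion[OF L E] by simp
  finally show ?thesis by simp
qed

locale immersion_patch =
  fixes f :: "real^'n::finite \<Rightarrow> 'a::euclidean_space" and U :: "(real^'n) set"
  assumes open_U: "open U" and smooth: "smooth_on U f" and inj: "u \<in> U \<Longrightarrow> inj (fd f u)"
begin

abbreviation "D2 u v w \<equiv> fd (\<lambda>y. fd f y w) u v"

lemma deriv: "u \<in> U \<Longrightarrow> (f has_derivative fd f u) (at u)"
  using Ck_Suc_has_derivative[OF smooth_C1[OF smooth] open_U] .

lemma deriv2: "u \<in> U \<Longrightarrow> ((\<lambda>y. fd f y w) has_derivative (\<lambda>v. D2 u v w)) (at u)"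
  using Ck_Suc_has_derivative[OF smooth_C1[OF smooth_fd[OF smooth]] open_U] .

lemma lin: "u \<in> U \<Longrightarrow> linear (fd f u)"
  using deriv has_derivative_linear by blast

lemma D2_sym: "u \<in> U \<Longrightarrow> D2 u v w = D2 u w v"
  using second_derivative_symmetric[OF open_U smooth] .

lemma D2_linear:
  assumes u: "u \<in> U"
  shows "linear (\<lambda>w. D2 u v w)"
proof -
  have "(\<lambda>w. D2 u v w) = (\<lambda>w. D2 u w v)" using D2_sym[OF u] by blast
  then show ?thesis using has_derivative_linear[OF deriv2[OF u, of v]] by simp
qed

text \<open>Chain and product rule for the differential taken at a moving point and applied to a
  moving vector. \<open>deriv2\<close> treats fixed vectors, hence the expansion along the
  axes.\<close>

lemma has_derivative_fd_apply:
  fixes g h :: "'b::real_normed_vector \<Rightarrow> real^'n"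
  assumes W: "open W" "u \<in> W" "g ` W \<subseteq> U"
    and g: "(g has_derivative g') (at u)" and h: "(h has_derivative h') (at u)"
  shows "((\<lambda>y. fd f (g y) (h y)) has_derivative (\<lambda>v. D2 (g u) (g' v) (h u) + fd f (g u) (h' v))) (at u)"
proof -
  have gu: "g u \<in> U" using W by blast
  have hk: "((\<lambda>y. h y $ k) has_derivative (\<lambda>v. h' v $ k)) (at u)" for k
    by (rule bounded_linear.has_derivative[OF bounded_linear_vec_nth h])
  have "((\<lambda>y. \<Sum>k\<in>UNIV. h y $ k *\<^sub>R fd f (g y) (axis k 1)) has_derivative
     (\<lambda>v. \<Sum>k\<in>UNIV. h u $ k *\<^sub>R D2 (g u) (g' v) (axis k 1) + h' v $ k *\<^sub>R fd f (g u) (axis k 1))) (at u)"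
    by (intro has_derivative_sum has_derivative_scaleR hk has_derivative_compose[OF g deriv2[OF gu]])
  moreover have "(\<Sum>k\<in>UNIV. h u $ k *\<^sub>R D2 (g u) (g' v) (axis k 1) + h' v $ k *\<^sub>R fd f (g u) (axis k 1))
     = D2 (g u) (g' v) (h u) + fd f (g u) (h' v)" for v
    using linear_axis_expansion[OF D2_linear[OF gu, of "g' v"], of "h u"] linear_axis_expansion[OF lin[OF gu], of "h' v"]
    by (simp add: sum.distrib)
  ultimately have "((\<lambda>y. \<Sum>k\<in>UNIV. h y $ k *\<^sub>R fd f (g y) (axis k 1)) has_derivative
      (\<lambda>v. D2 (g u) (g' v) (h u) + fd f (g u) (h' v))) (at u)" by simp
  then show ?thesis
  proof (rule has_derivative_transform_within_open[OF _ W(1,2)])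
    fix y assume "y \<in> W"
    then have "g y \<in> U" using W(3) by blast
    show "(\<Sum>k\<in>UNIV. h y $ k *\<^sub>R fd f (g y) (axis k 1)) = fd f (g y) (h y)"
      by (rule linear_axis_expansion[symmetric, OF lin]) fact
  qed
qed

text \<open>Coordinates of x^T. The inner products with the coordinate vectors give a linear system
  with the Gram matrix, and this is its solution by Cramer's rule; the explicit quotient shows that
  the field is C1.\<close>

definition T :: "real^'n \<Rightarrow> real^'n" where
  "T u = (\<chi> k. det (\<chi> i j. if j = k then fd f u (axis i 1) \<bullet> f u else gram (fd f u) $ i $ j) / det (gram (fd f u)))"

definition tang :: "real^'n \<Rightarrow> 'a" where
  "tang u = fd f u (T u)"

lemma det_gram: "u \<in> U \<Longrightarrow> 0 < det (gram (fd f u))"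
  by (rule det_gram_pos[OF lin inj])

lemma tang_inner:
  assumes u: "u \<in> U"
  shows "tang u \<bullet> fd f u z = f u \<bullet> fd f u z"
proof -
  have "gram (fd f u) *v T u = (\<chi> i. fd f u (axis i 1) \<bullet> f u)"
    using det_gram[OF u] by (subst cramer) (auto simp: T_def cong: if_cong)
  then have 1: "(\<Sum>j\<in>UNIV. (fd f u (axis i 1) \<bullet> fd f u (axis j 1)) * T u $ j) = fd f u (axis i 1) \<bullet> f u" for i
    by (simp add: vec_eq_iff matrix_vector_mult_def gram_def)
  have 2: "tang u \<bullet> fd f u (axis i 1) = f u \<bullet> fd f u (axis i 1)" for i
    unfolding tang_def linear_axis_expansion[OF lin[OF u], of "T u"] inner_sum_left
    using 1[of i] by (simp add: inner_commute mult.commute)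
  show ?thesis
    unfolding linear_axis_expansion[OF lin[OF u], of z] by (simp add: inner_sum_right 2)
qed

text \<open>This characterisation makes no reference to a coordinate basis, which is what yields the
  transformation law of \<open>T\<close> between charts.\<close>

lemma tang_unique:
  assumes u: "u \<in> U" and t: "\<And>z. fd f u t \<bullet> fd f u z = f u \<bullet> fd f u z"
  shows "t = T u"
proof -
  have "fd f u (t - T u) \<bullet> fd f u (t - T u) = 0"
    unfolding linear_diff[OF lin[OF u], of t "T u"] inner_diff_left
    using t tang_inner[OF u] by (simp add: tang_def inner_diff_right)
  then have "fd f u t = fd f u (T u)" by (simp add: linear_diff[OF lin[OF u]])
  then show ?thesis using inj[OF u] by (simp add: inj_eq)
qed

lemma C1_fd: "C1 U (\<lambda>u. fd f u w)"
  by (rule smooth_C1[OF smooth_fd[OF smooth]])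

lemma C1_f: "C1 U f"
  by (rule smooth_C1[OF smooth])

lemma C1_det:
  assumes "\<And>i j. C1 U (\<lambda>u. A u i j)"
  shows "C1 U (\<lambda>u. det (\<chi> i j. A u i j :: real^'n^'n))"
  unfolding det_def vec_lambda_beta by (intro C1_sum C1_mult C1_prod C1_const open_U assms)

lemma C1_gram: "C1 U (\<lambda>u. det (gram (fd f u)))"
  unfolding gram_def by (intro C1_det C1_inner C1_fd open_U)

lemma C1_T_component: "C1 U (\<lambda>u. T u $ k)"
  unfolding T_def vec_lambda_beta
proof (rule C1_divide[OF open_U C1_det C1_gram])
  fix i j
  show "C1 U (\<lambda>u. if j = k then fd f u (axis i 1) \<bullet> f u else gram (fd f u) $ i $ j)"
    by (cases "j = k") (simp_all add: gram_def C1_inner[OF open_U] C1_fd C1_f)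
qed (use det_gram in force)

lemma C1_T: "C1 U T"
proof -
  have "T = (\<lambda>u. \<Sum>k\<in>UNIV. T u $ k *\<^sub>R axis k 1)"
    using basis_expansion by (metis (no_types, lifting) scalar_mult_eq_scaleR sum.cong)
  moreover have "C1 U (\<lambda>u. \<Sum>k\<in>UNIV. T u $ k *\<^sub>R (axis k 1 :: real^'n))"
    by (intro C1_sum C1_scaleR C1_T_component C1_const open_U)
  ultimately show ?thesis by metis
qed

abbreviation "dens \<equiv> volume_density f"

lemma C1_dens: "C1 U dens"
  unfolding volume_density_gram
proof (rule C1_compose[OF open_U _ C1_gram])
  show "C1 {0<..} sqrt"
    by (rule C1_real[where f'="\<lambda>t. inverse (sqrt t) / 2"])
       (auto intro!: DERIV_real_sqrt continuous_intros)
qed (use det_gram in auto)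

text \<open>The frame at \<open>u\<close> is extended with constant coordinates. Its Gram matrix is
  the identity at \<open>u\<close>, so the derivative of the determinant there is a trace; by the
  constant factor \<open>?e\<close>, with \<open>?e * dens u = 1\<close>, the result passes back to
  the density.\<close>

lemma fd_dens:
  assumes u: "u \<in> U" and E: "orthonormal_frame (fd f u) E"
  shows "fd dens u v = dens u * (\<Sum>i\<in>UNIV. D2 u v (E i) \<bullet> fd f u (E i))"
proof -
  let ?H = "\<lambda>y. gram (\<lambda>v. fd f y (frame_map E v))" and ?e = "\<bar>det (matrix (frame_map E))\<bar>"
  have e: "?e * dens u = 1"
    using det_gram_frame[OF lin[OF u] E] by (simp add: volume_density_gram)
  have "((\<lambda>y. det (?H y)) has_derivative
      (\<lambda>v. \<Sum>i\<in>UNIV. fd f u (E i) \<bullet> D2 u v (E i) + D2 u v (E i) \<bullet> fd f u (E i))) (at u)"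
  proof (rule has_derivative_det_at_identity[where H' = "\<lambda>i j v. fd f u (E i) \<bullet> D2 u v (E j) + D2 u v (E i) \<bullet> fd f u (E j)"])
    show "?H u = mat 1" by (rule gram_frame[OF E])
    show "((\<lambda>y. ?H y $ i $ j) has_derivative (\<lambda>v. fd f u (E i) \<bullet> D2 u v (E j) + D2 u v (E i) \<bullet> fd f u (E j))) (at u)" for i j
      by (simp add: gram_def) (intro has_derivative_inner deriv2 u)
  qed
  \<comment> \<open>The Gram determinant in the frame is 1 at \<open>u\<close>, where the square
    root has slope 1/2.\<close>
  moreover have "(sqrt has_derivative (*) (1 / 2)) (at (det (?H u)))"
    using DERIV_real_sqrt[of 1] gram_frame[OF E] by (simp add: has_field_derivative_def)
  ultimately have "((\<lambda>y. sqrt (det (?H y))) has_derivative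
      (\<lambda>v. 1 / 2 * (\<Sum>i\<in>UNIV. fd f u (E i) \<bullet> D2 u v (E i) + D2 u v (E i) \<bullet> fd f u (E i)))) (at u)"
    by (rule has_derivative_compose)
  moreover have "1 / 2 * (\<Sum>i\<in>UNIV. fd f u (E i) \<bullet> D2 u v (E i) + D2 u v (E i) \<bullet> fd f u (E i))
      = (\<Sum>i\<in>UNIV. D2 u v (E i) \<bullet> fd f u (E i))" for v
    by (simp add: inner_commute[of "fd f u _"] flip: sum_distrib_left)
  ultimately have "((\<lambda>y. sqrt (det (?H y))) has_derivative
      (\<lambda>v. \<Sum>i\<in>UNIV. D2 u v (E i) \<bullet> fd f u (E i))) (at u)"
    by simp
  moreover have "sqrt (det (?H y)) = ?e * dens y" if "y \<in> U" for y
    unfolding volume_density_gram by (rule sqrt_det_gram_compose[OF lin[OF that]])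
  ultimately have 1: "((\<lambda>y. ?e * dens y) has_derivative (\<lambda>v. \<Sum>i\<in>UNIV. D2 u v (E i) \<bullet> fd f u (E i))) (at u)"
    by (rule has_derivative_transform_within_open[OF _ open_U u])
  have "((\<lambda>y. ?e * dens y) has_derivative (\<lambda>v. ?e * fd dens u v)) (at u)"
    by (intro has_derivative_mult_right Ck_Suc_has_derivative[OF C1_dens open_U u])
  from has_derivative_unique[OF 1 this] have "(\<Sum>i\<in>UNIV. D2 u v (E i) \<bullet> fd f u (E i)) = ?e * fd dens u v"
    by metis
  then have "dens u * (\<Sum>i\<in>UNIV. D2 u v (E i) \<bullet> fd f u (E i)) = (?e * dens u) * fd dens u v" by simp
  then show ?thesis using e by simp
qed

lemma T_has_derivative: "u \<in> U \<Longrightarrow> (T has_derivative fd T u) (at u)"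
  using Ck_Suc_has_derivative[OF C1_T open_U] .

text \<open>Obtained by differentiating the identity \<open>tang_inner\<close> along
  \<open>v\<close> with \<open>z\<close> held constant.\<close>

lemma fd_T_inner:
  assumes u: "u \<in> U"
  shows "fd f u (fd T u v) \<bullet> fd f u z
    = fd f u v \<bullet> fd f u z + (f u - tang u) \<bullet> D2 u v z - D2 u v (T u) \<bullet> fd f u z"
proof -
  have "(tang has_derivative (\<lambda>v. D2 u v (T u) + fd f u (fd T u v))) (at u)"
    unfolding tang_def
    by (rule has_derivative_fd_apply[OF open_U u _ has_derivative_ident T_has_derivative[OF u]]) simp
  then have "((\<lambda>y. tang y \<bullet> fd f y z) has_derivative
      (\<lambda>v. tang u \<bullet> D2 u v z + (D2 u v (T u) + fd f u (fd T u v)) \<bullet> fd f u z)) (at u)"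
    by (intro has_derivative_inner deriv2 u)
  moreover have "((\<lambda>y. f y \<bullet> fd f y z) has_derivative (\<lambda>v. f u \<bullet> D2 u v z + fd f u v \<bullet> fd f u z)) (at u)"
    by (intro has_derivative_inner deriv2 deriv u)
  then have "((\<lambda>y. tang y \<bullet> fd f y z) has_derivative (\<lambda>v. f u \<bullet> D2 u v z + fd f u v \<bullet> fd f u z)) (at u)"
    by (rule has_derivative_transform_within_open[OF _ open_U u]) (simp add: tang_inner)
  ultimately have "tang u \<bullet> D2 u v z + (D2 u v (T u) + fd f u (fd T u v)) \<bullet> fd f u z
    = f u \<bullet> D2 u v z + fd f u v \<bullet> fd f u z"
    by (rule has_derivative_unique[THEN fun_cong])
  then show ?thesis by (simp add: inner_diff_left inner_add_left)
qed

text \<open>The left side is the coordinate divergence of \<open>dens\<close> times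
  \<open>T\<close>. Summing \<open>fd_T_inner\<close> over a frame gives the dimension, the normal
  trace of the second derivative, and a term that cancels the derivative of the density by symmetry
  of \<open>D2\<close>.\<close>

lemma divergence_T:
  assumes u: "u \<in> U" and E: "orthonormal_frame (fd f u) E"
  shows "fd dens u (T u) + dens u * (\<Sum>j\<in>UNIV. fd T u (axis j 1) $ j)
    = dens u * (CARD('n) + (\<Sum>i\<in>UNIV. (f u - tang u) \<bullet> D2 u (E i) (E i)))"
proof -
  have "(\<Sum>j\<in>UNIV. fd T u (axis j 1) $ j) = (\<Sum>i\<in>UNIV. fd f u (fd T u (E i)) \<bullet> fd f u (E i))"
    by (rule trace_frame[OF lin[OF u] E]) (rule has_derivative_linear[OF T_has_derivative[OF u]])
  also have "\<dots> = (\<Sum>i\<in>UNIV. 1 + (f u - tang u) \<bullet> D2 u (E i) (E i) - D2 u (T u) (E i) \<bullet> fd f u (E i))"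
    using E by (intro sum.cong refl) (simp add: fd_T_inner[OF u] orthonormal_frame_def D2_sym[OF u, of _ "T u"])
  also have "\<dots> = CARD('n) + (\<Sum>i\<in>UNIV. (f u - tang u) \<bullet> D2 u (E i) (E i))
      - (\<Sum>i\<in>UNIV. D2 u (T u) (E i) \<bullet> fd f u (E i))"
    by (simp only: sum.distrib sum_subtractf) simp
  finally have *: "(\<Sum>j\<in>UNIV. fd T u (axis j 1) $ j) = \<dots>" .
  show ?thesis
    unfolding fd_dens[OF u E] * distrib_left right_diff_distrib by simp
qed

text \<open>The integrand is the Euclidean divergence of \<open>\<eta>\<close> times
  \<open>dens\<close> times \<open>T\<close>, and each component of this field has compact support.
  The function \<open>N\<close> stands for the normal trace, which the shrinker equation will
  supply.\<close>

lemma integral_divergence_T: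
  fixes \<eta> N :: "real^'n \<Rightarrow> real"
  assumes \<eta>: "C1 U \<eta>" and K: "compact K" "K \<subseteq> U" and supp: "\<And>u. u \<in> U - K \<Longrightarrow> \<eta> u = 0"
    and N: "\<And>u. u \<in> U \<Longrightarrow> \<exists>E. orthonormal_frame (fd f u) E \<and>
      (\<Sum>i\<in>UNIV. (f u - tang u) \<bullet> D2 u (E i) (E i)) = N u"
  shows "(\<integral>u. indicator U u *\<^sub>R (dens u * (fd \<eta> u (T u) + \<eta> u * (real CARD('n) + N u))) \<partial>lborel) = 0"
proof -
  \<comment> \<open>Extended by zero outside \<open>U\<close>, this is C1 on the whole space because
    \<open>U\<close> and the complement of \<open>K\<close> are open and cover it.\<close>
  define F where "F j u = (if u \<in> U then \<eta> u * (dens u * T u $ j) else 0)" for j u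
  have C: "C1 U (\<lambda>u. \<eta> u * (dens u * T u $ j))" for j
    by (intro C1_mult open_U \<eta> C1_dens C1_T_component)
  have CF: "C1 UNIV (F j)" for j
  proof -
    have "C1 U (F j)" by (rule C1_cong[OF open_U _ C[of j]]) (simp add: F_def)
    moreover have "C1 (-K) (F j)"
      using K(1) supp by (intro C1_cong[OF _ _ C1_const[of _ 0]]) (auto simp: F_def intro: compact_imp_closed)
    ultimately have "C1 (U \<union> -K) (F j)" using K(1) by (intro C1_Un open_U) (auto intro: compact_imp_closed)
    moreover have "U \<union> -K = UNIV" using K(2) by blast
    ultimately show ?thesis by simp
  qed
  have FK: "F j u = 0" if "u \<notin> K" for j u using that supp by (auto simp: F_def)
  have int: "integrable lborel (\<lambda>u. fd (F j) u (axis j 1))" for j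
  proof -
    have "fd (F j) u v = 0" if "u \<notin> K" for u v
    proof -
      have "fd (F j) u = fd (\<lambda>_. 0) u"
        by (rule fd_cong[of "-K"]) (use that FK K in \<open>auto intro: compact_imp_closed\<close>)
      then show ?thesis by simp
    qed
    then have "(\<lambda>u. fd (F j) u (axis j 1)) = (\<lambda>u. indicator K u *\<^sub>R fd (F j) u (axis j 1))"
      by (auto simp: indicator_def fun_eq_iff)
    moreover have "integrable lborel (\<lambda>u. indicator K u *\<^sub>R fd (F j) u (axis j 1))"
      by (rule borel_integrable_compact[OF K(1) continuous_on_subset[OF C1_fd_continuous[OF CF]]]) auto
    ultimately show ?thesis by simp
  qed
  have pw: "(\<Sum>j\<in>UNIV. fd (F j) u (axis j 1))
     = indicator U u *\<^sub>R (dens u * (fd \<eta> u (T u) + \<eta> u * (CARD('n) + N u)))" for u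
  proof (cases "u \<in> U")
    case False
    then have "u \<in> - K" using K by auto
    then have "fd (F j) u = fd (\<lambda>_. 0) u" for j
      by (intro fd_cong[of "-K"]) (use FK K in \<open>auto intro: compact_imp_closed\<close>)
    then show ?thesis using False by simp
  next
    case u: True
    obtain E where E: "orthonormal_frame (fd f u) E" "(\<Sum>i\<in>UNIV. (f u - tang u) \<bullet> D2 u (E i) (E i)) = N u"
      using N[OF u] by blast
    have T: "((\<lambda>y. T y $ j) has_derivative (\<lambda>v. fd T u v $ j)) (at u)" for j
      by (rule bounded_linear.has_derivative[OF bounded_linear_vec_nth T_has_derivative[OF u]])
    have der: "((\<lambda>y. \<eta> y * (dens y * T y $ j)) has_derivative
       (\<lambda>v. \<eta> u * (dens u * fd T u v $ j + fd dens u v * T u $ j) + fd \<eta> u v * (dens u * T u $ j))) (at u)" for j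
      by (intro has_derivative_mult T Ck_Suc_has_derivative[OF C1_dens open_U u] Ck_Suc_has_derivative[OF \<eta> open_U u])
    have "(F j has_derivative
       (\<lambda>v. \<eta> u * (dens u * fd T u v $ j + fd dens u v * T u $ j) + fd \<eta> u v * (dens u * T u $ j))) (at u)" for j
      by (rule has_derivative_transform_within_open[OF der open_U u]) (simp add: F_def)
    then have "fd (F j) u = (\<lambda>v. \<eta> u * (dens u * fd T u v $ j + fd dens u v * T u $ j) + fd \<eta> u v * (dens u * T u $ j))" for j
      by (rule frechet_derivative_at[symmetric])
    then have "(\<Sum>j\<in>UNIV. fd (F j) u (axis j 1)) =
       \<eta> u * (dens u * (\<Sum>j\<in>UNIV. fd T u (axis j 1) $ j) + (\<Sum>j\<in>UNIV. T u $ j *\<^sub>R fd dens u (axis j 1)))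
       + dens u * (\<Sum>j\<in>UNIV. T u $ j *\<^sub>R fd \<eta> u (axis j 1))"
      by (simp add: sum.distrib sum_distrib_left distrib_left mult_ac)
    also have "(\<Sum>j\<in>UNIV. T u $ j *\<^sub>R fd dens u (axis j 1)) = fd dens u (T u)"
      by (rule linear_axis_expansion[symmetric, OF fd_linear[OF C1_dens open_U u]])
    also have "(\<Sum>j\<in>UNIV. T u $ j *\<^sub>R fd \<eta> u (axis j 1)) = fd \<eta> u (T u)"
      by (rule linear_axis_expansion[symmetric, OF fd_linear[OF \<eta> open_U u]])
    also have "dens u * (\<Sum>j\<in>UNIV. fd T u (axis j 1) $ j) + fd dens u (T u) = dens u * (CARD('n) + N u)"
      using divergence_T[OF u E(1)] E(2) by (simp add: add.commute)
    finally show ?thesis using u by (simp add: algebra_simps)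
  qed
  have "(\<integral>u. (\<Sum>j\<in>UNIV. fd (F j) u (axis j 1)) \<partial>lborel) = (\<Sum>j\<in>UNIV. \<integral>u. fd (F j) u (axis j 1) \<partial>lborel)"
    by (rule Bochner_Integration.integral_sum) (rule int)
  also have "\<dots> = 0" using integral_fd_compact_support[OF CF K(1) FK] by simp
  finally show ?thesis by (simp add: pw)
qed

end

subsection \<open>The divergence theorem on a self-shrinker\<close>

text \<open>For z in the complement, v - z is the orthogonal sum of t and v - t - z, so its norm is
  at least that of t.\<close>

lemma closest_point_orthogonal_comp:
  fixes v t :: "'a::euclidean_space"
  assumes t: "t \<in> S" and orth: "\<And>z. z \<in> S \<Longrightarrow> (v - t) \<bullet> z = 0"
  shows "closest_point (orthogonal_comp S) v = v - t"
proof (rule closest_point_unique[symmetric])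
  show "convex (orthogonal_comp S)" "closed (orthogonal_comp S)"
    by (simp_all add: subspace_orthogonal_comp subspace_imp_convex closed_subspace)
  show "v - t \<in> orthogonal_comp S"
    using orth by (auto simp: orthogonal_comp_def orthogonal_def inner_commute)
  show "\<forall>z\<in>orthogonal_comp S. dist v (v - t) \<le> dist v z"
  proof
    fix z assume "z \<in> orthogonal_comp S"
    then have "t \<bullet> (v - t - z) = 0"
      using t orth by (auto simp: orthogonal_comp_def orthogonal_def inner_diff_right inner_diff_left inner_commute)
    then have "(norm (t + (v - t - z)))\<^sup>2 = (norm t)\<^sup>2 + (norm (v - t - z))\<^sup>2"
      by (intro norm_add_Pythagorean) (simp add: orthogonal_def)
    then have "(norm t)\<^sup>2 \<le> (norm (v - z))\<^sup>2" by simp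
    then show "dist v (v - t) \<le> dist v z" by (simp add: dist_norm abs_le_square_iff[symmetric])
  qed
qed

context immersed
begin

lemma patch: "c \<in> \<A> \<Longrightarrow> immersion_patch (X c) (img c)"
  by unfold_locales (auto intro: open_img smooth_X inj_fd_X simp del: comp_apply)

abbreviation "T c \<equiv> immersion_patch.T (X c)"
abbreviation "tang c \<equiv> immersion_patch.tang (X c)"

lemma tang_orth:
  assumes "c \<in> \<A>" "u \<in> img c"
  shows "(X c u - tang c u) \<bullet> fd (X c) u z = 0"
  using immersion_patch.tang_inner[OF patch[OF assms(1)] assms(2)] by (simp add: inner_diff_left)

lemma transit_transit: "c \<in> \<A> \<Longrightarrow> d \<in> \<A> \<Longrightarrow> u \<in> overlap c d \<Longrightarrow> transit d c (transit c d u) = u"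
  by (auto simp: chart_inv_chart)

lemma transit_in: "c \<in> \<A> \<Longrightarrow> d \<in> \<A> \<Longrightarrow> u \<in> overlap c d \<Longrightarrow> transit c d u \<in> overlap d c"
  by (auto simp: chart_inv_chart)

text \<open>The transformed vector has the same ambient image as \<open>T c u\<close>, hence
  satisfies the equations that determine the tangential field in chart \<open>d\<close>.\<close>

lemma T_transit:
  assumes c: "c \<in> \<A>" and d: "d \<in> \<A>" and u: "u \<in> overlap c d"
  shows "fd (transit c d) u (T c u) = T d (transit c d u)"
proof (rule immersion_patch.tang_unique[OF patch[OF d]])
  have uc: "u \<in> img c" using u by auto
  show "transit c d u \<in> img d" using transit_in[OF assms] by auto
  fix z
  \<comment> \<open>The inverse transition turns an arbitrary direction in chart \<open>d\<close>
    into one in chart \<open>c\<close>.\<close>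
  let ?z = "fd (transit d c) (transit c d u) z"
  have z: "fd (X d) (transit c d u) z = fd (X c) u ?z"
    using fd_X_trans[OF d c transit_in[OF assms]] transit_transit[OF assms] by simp
  have "fd (X d) (transit c d u) (fd (transit c d) u (T c u)) = tang c u"
    unfolding immersion_patch.tang_def[OF patch[OF c]] fd_X_trans[OF assms] ..
  then show "fd (X d) (transit c d u) (fd (transit c d) u (T c u)) \<bullet> fd (X d) (transit c d u) z
      = X d (transit c d u) \<bullet> fd (X d) (transit c d u) z"
    unfolding z X_trans[OF assms, symmetric] using immersion_patch.tang_inner[OF patch[OF c] uc] by simp
qed

lemma tang_transit:
  assumes c: "c \<in> \<A>" and d: "d \<in> \<A>" and u: "u \<in> overlap c d"
  shows "tang d (transit c d u) = tang c u"
  unfolding immersion_patch.tang_def[OF patch[OF c]] immersion_patch.tang_def[OF patch[OF d]]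
    T_transit[OF assms, symmetric] fd_X_trans[OF assms] ..

lemma chart_at: "chart_at \<A> q \<in> \<A>" "q \<in> cdom (chart_at \<A> q)"
proof -
  obtain c where "c \<in> \<A> \<and> q \<in> cdom c" using chart_cover by metis
  from someI[of "\<lambda>c. c \<in> \<A> \<and> q \<in> fst c", OF this]
  show "chart_at \<A> q \<in> \<A>" "q \<in> cdom (chart_at \<A> q)" by (simp_all add: chart_at_def)
qed

lemma tang_chart:
  assumes "c \<in> \<A>" "d \<in> \<A>" "q \<in> cdom c" "q \<in> cdom d"
  shows "tang d (snd d q) = tang c (snd c q)"
  using tang_transit[OF assms(1,2), of "snd c q"] assms by (simp add: chart_inv_chart)

lemma normal_part_eq:
  assumes c: "c \<in> \<A>" "q \<in> cdom c"
  shows "normal_part \<A> x q (x q) = x q - tang c (snd c q)"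
proof -
  let ?d = "chart_at \<A> q"
  have u: "snd ?d q \<in> img ?d" using chart_at by blast
  have "normal_part \<A> x q (x q) = x q - tang ?d (snd ?d q)"
    unfolding normal_part_def tangent_space_def Let_def
  proof (rule closest_point_orthogonal_comp)
    show "tang ?d (snd ?d q) \<in> range (fd (X ?d) (snd ?d q))"
      unfolding immersion_patch.tang_def[OF patch[OF chart_at(1)]] by blast
    show "(x q - tang ?d (snd ?d q)) \<bullet> z = 0" if "z \<in> range (fd (X ?d) (snd ?d q))" for z
      using that tang_orth[OF chart_at(1) u] chart_inv_chart[OF chart_at] by auto
  qed
  then show ?thesis using tang_chart[OF c(1) chart_at(1) c(2) chart_at(2)] by simp
qed

lemma frame_transit:
  assumes c: "c \<in> \<A>" and d: "d \<in> \<A>" and u: "u \<in> overlap c d"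
    and E: "orthonormal_frame (fd (X c) u) E"
  shows "orthonormal_frame (fd (X d) (transit c d u)) (\<lambda>i. fd (transit c d) u (E i))"
  using E unfolding orthonormal_frame_def fd_X_trans[OF c d u] .

text \<open>Second derivatives are not tensorial: the chain rule also produces the second derivative
  of the transition map. That extra term is tangential and vanishes against the normal vector
  \<open>\<nu>\<close>.\<close>

lemma second_derivative_transit:
  assumes c: "c \<in> \<A>" and d: "d \<in> \<A>" and u: "u \<in> overlap c d"
    and \<nu>: "\<And>z. \<nu> \<bullet> fd (X d) (transit c d u) z = 0"
  shows "\<nu> \<bullet> fd (\<lambda>y. fd (X c) y w) u v
    = \<nu> \<bullet> fd (\<lambda>y. fd (X d) y (fd (transit c d) u w)) (transit c d u) (fd (transit c d) u v)"
proof -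
  interpret d: immersion_patch "X d" "img d" by (rule patch[OF d])
  let ?\<tau> = "transit c d"
  have \<tau>: "(?\<tau> has_derivative fd ?\<tau> u) (at u)"
    by (rule Ck_Suc_has_derivative[OF smooth_C1[OF smooth_trans[OF c d]] open_overlap[OF c d] u])
  have \<tau>w: "((\<lambda>y. fd ?\<tau> y w) has_derivative fd (\<lambda>y. fd ?\<tau> y w) u) (at u)"
    by (rule Ck_Suc_has_derivative[OF smooth_C1[OF smooth_fd[OF smooth_trans[OF c d]]] open_overlap[OF c d] u])
  have sub: "?\<tau> ` overlap c d \<subseteq> img d" using transit_in[OF c d] by blast
  have "((\<lambda>y. fd (X d) (?\<tau> y) (fd ?\<tau> y w)) has_derivative
    (\<lambda>v. fd (\<lambda>y. fd (X d) y (fd ?\<tau> u w)) (?\<tau> u) (fd ?\<tau> u v) + fd (X d) (?\<tau> u) (fd (\<lambda>y. fd ?\<tau> y w) u v))) (at u)"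
    by (rule d.has_derivative_fd_apply[OF open_overlap[OF c d] u sub \<tau> \<tau>w])
  then have "((\<lambda>y. fd (X c) y w) has_derivative
    (\<lambda>v. fd (\<lambda>y. fd (X d) y (fd ?\<tau> u w)) (?\<tau> u) (fd ?\<tau> u v) + fd (X d) (?\<tau> u) (fd (\<lambda>y. fd ?\<tau> y w) u v))) (at u)"
    by (rule has_derivative_transform_within_open[OF _ open_overlap[OF c d] u])
       (rule fd_X_trans[OF c d, THEN fun_cong, symmetric])
  from frechet_derivative_at[OF this, symmetric] show ?thesis
    by (simp only: inner_add_right \<nu> add_0_right)
qed

lemma tangent_onb_frame:
  assumes "tangent_onb (f :: real^'n \<Rightarrow> 'a) u B"
  obtains E where "orthonormal_frame (fd f u) E" "bij_betw E UNIV B"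
proof -
  have "card B = CARD('n)" using assms by (simp add: tangent_onb_def)
  moreover from this have "finite B" by (metis card_ge_0_finite zero_less_card_finite)
  ultimately obtain E :: "'n \<Rightarrow> real^'n" where E: "bij_betw E UNIV B"
    using finite_same_card_bij[of "UNIV :: 'n set" B] by auto
  then have "orthonormal_frame (fd f u) E"
    using assms by (auto simp: orthonormal_frame_def tangent_onb_def induced_metric_def bij_betw_def inj_eq)
  then show ?thesis using that E by blast
qed

lemma frame_tangent_onb:
  assumes "orthonormal_frame (fd f u) E"
  shows "tangent_onb (f :: real^'n \<Rightarrow> 'a) u (range E)"
proof -
  have inj: "inj E"
  proof (rule injI)
    fix i j assume "E i = E j"
    then have "fd f u (E i) \<bullet> fd f u (E j) = 1" using assms by (metis orthonormal_frame_def)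
    then show "i = j" using assms by (metis orthonormal_frame_def zero_neq_one)
  qed
  then have "card (range E) = CARD('n)" by (simp add: card_image)
  then show ?thesis
    using assms inj by (auto simp: tangent_onb_def orthonormal_frame_def induced_metric_def inj_eq)
qed

section \<open>C1 functions on the manifold and their derivative along x^T\<close>

definition C1m :: "('m \<Rightarrow> real) \<Rightarrow> bool" where
  "C1m h \<longleftrightarrow> (\<forall>c\<in>\<A>. C1 (img c) (h \<circ> chart_inv c))"

text \<open>The derivative of \<open>h\<close> along x^T. The chart picked by
  \<open>chart_at\<close> is only a device: \<open>Tderiv_chart\<close> gives the same value in
  every chart when \<open>h\<close> is C1.\<close>

definition Tderiv :: "('m \<Rightarrow> real) \<Rightarrow> 'm \<Rightarrow> real" where
  "Tderiv h q = (let c = chart_at \<A> q in fd (h \<circ> chart_inv c) (snd c q) (T c (snd c q)))"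

lemma C1m_deriv: "C1m h \<Longrightarrow> c \<in> \<A> \<Longrightarrow> u \<in> img c \<Longrightarrow> (h \<circ> chart_inv c has_derivative fd (h \<circ> chart_inv c) u) (at u)"
  unfolding C1m_def using Ck_Suc_has_derivative open_img by blast

lemma Tderiv_chart:
  assumes h: "C1m h" and d: "d \<in> \<A>" "q \<in> cdom d"
  shows "Tderiv h q = fd (h \<circ> chart_inv d) (snd d q) (T d (snd d q))"
proof -
  let ?c = "chart_at \<A> q" let ?u = "snd ?c q"
  note c = chart_at[of q]
  have u: "?u \<in> overlap ?c d" using c d by auto
  have \<tau>u: "transit ?c d ?u = snd d q" using chart_inv_chart[OF c] by simp
  have du: "snd d q \<in> img d" using d by auto
  have "fd (h \<circ> chart_inv ?c) ?u = fd (\<lambda>y. (h \<circ> chart_inv d) (transit ?c d y)) ?u"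
    by (rule fd_cong[OF open_overlap[OF c(1) d(1)] u]) (auto simp: chart_inv_chart c d)
  moreover have "fd (\<lambda>y. (h \<circ> chart_inv d) (transit ?c d y)) ?u v
      = fd (h \<circ> chart_inv d) (snd d q) (fd (transit ?c d) ?u v)" for v
  proof -
    have 1: "(transit ?c d has_derivative fd (transit ?c d) ?u) (at ?u)"
      by (rule Ck_Suc_has_derivative[OF smooth_C1[OF smooth_trans[OF c(1) d(1)]] open_overlap[OF c(1) d(1)] u])
    have 2: "(h \<circ> chart_inv d has_derivative fd (h \<circ> chart_inv d) (snd d q)) (at (transit ?c d ?u))"
      unfolding \<tau>u by (rule C1m_deriv[OF h d(1) du])
    show ?thesis by (rule fd_compose[OF 1 2])
  qed
  ultimately show ?thesis
    using T_transit[OF c(1) d(1) u] \<tau>u by (simp add: Tderiv_def Let_def)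
qed

lemma continuous_on_atlas:
  assumes "\<And>c. c \<in> \<A> \<Longrightarrow> continuous_on (cdom c) h"
  shows "continuous_on UNIV h"
proof -
  have "continuous_on (\<Union>c\<in>\<A>. cdom c) h"
    using assms open_dom by (intro continuous_on_open_UN) auto
  then show ?thesis using atlas by (simp add: smooth_atlas_def)
qed

lemma C1m_continuous:
  assumes "C1m h"
  shows "continuous_on UNIV h"
proof (rule continuous_on_atlas)
  fix c assume c: "c \<in> \<A>"
  have "continuous_on (img c) (h \<circ> chart_inv c)" using assms c C1_continuous unfolding C1m_def by blast
  then have "continuous_on (cdom c) ((h \<circ> chart_inv c) \<circ> snd c)"
    by (rule continuous_on_compose[OF chart_continuous[OF c]])
  then show "continuous_on (cdom c) h" by (rule continuous_on_eq) (simp add: chart_inv_chart c)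
qed

lemma continuous_on_T: "c \<in> \<A> \<Longrightarrow> continuous_on (img c) (T c)"
  using C1_continuous immersion_patch.C1_T patch by blast

lemma continuous_on_fd_T:
  fixes g :: "real^'n \<Rightarrow> 'b::real_normed_vector"
  assumes c: "c \<in> \<A>" and g: "C1 (img c) g"
  shows "continuous_on (img c) (\<lambda>u. fd g u (T c u))"
proof -
  have "fd g u (T c u) = (\<Sum>k\<in>UNIV. T c u $ k *\<^sub>R fd g u (axis k 1))" if "u \<in> img c" for u
    by (rule linear_axis_expansion[OF fd_linear[OF g open_img[OF c] that]])
  moreover have "continuous_on (img c) (\<lambda>u. \<Sum>k\<in>UNIV. T c u $ k *\<^sub>R fd g u (axis k 1))"
    by (intro continuous_intros continuous_on_T c C1_fd_continuous g)
  ultimately show ?thesis by (simp cong: continuous_on_cong)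
qed

lemma Tderiv_continuous:
  assumes h: "C1m h"
  shows "continuous_on UNIV (Tderiv h)"
proof (rule continuous_on_atlas)
  fix c assume c: "c \<in> \<A>"
  have "continuous_on (cdom c) ((\<lambda>u. fd (h \<circ> chart_inv c) u (T c u)) \<circ> snd c)"
    using h c by (intro continuous_on_compose chart_continuous continuous_on_fd_T) (auto simp: C1m_def)
  then show "continuous_on (cdom c) (Tderiv h)"
    by (rule continuous_on_eq) (simp add: Tderiv_chart[OF h c])
qed

lemma Tderiv_zero:
  assumes h: "C1m h" and K: "closed K" "\<And>q. q \<notin> K \<Longrightarrow> h q = 0" and q: "q \<notin> K"
  shows "Tderiv h q = 0"
proof -
  let ?c = "chart_at \<A> q"
  note c = chart_at[of q]
  have "fd (h \<circ> chart_inv ?c) (snd ?c q) = fd (\<lambda>_. 0) (snd ?c q)"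
  proof (rule fd_cong[of "snd ?c ` (cdom ?c - K)"])
    show "open (snd ?c ` (cdom ?c - K))"
      using c K open_dom[OF c(1)] by (intro open_chart_image) auto
  qed (use c q K in \<open>auto simp: chart_inv_chart\<close>)
  then show ?thesis by (simp add: Tderiv_def Let_def)
qed

lemma C1m_const: "C1m (\<lambda>_. a)"
  by (auto simp: C1m_def o_def intro: C1_const open_img)

lemma C1m_add: "C1m g \<Longrightarrow> C1m h \<Longrightarrow> C1m (\<lambda>q. g q + h q)"
  unfolding C1m_def o_def using C1_add[OF open_img] by blast

lemma C1m_mult: "C1m g \<Longrightarrow> C1m h \<Longrightarrow> C1m (\<lambda>q. g q * h q)"
  unfolding C1m_def o_def using C1_mult[OF open_img] by blast

lemma Tderiv_add:
  assumes g: "C1m g" and h: "C1m h"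
  shows "Tderiv (\<lambda>q. g q + h q) q = Tderiv g q + Tderiv h q"
proof -
  let ?c = "chart_at \<A> q"
  have u: "snd ?c q \<in> img ?c" using chart_at by blast
  have "(((\<lambda>q. g q + h q) \<circ> chart_inv ?c) has_derivative
     (\<lambda>v. fd (g \<circ> chart_inv ?c) (snd ?c q) v + fd (h \<circ> chart_inv ?c) (snd ?c q) v)) (at (snd ?c q))"
    using has_derivative_add[OF C1m_deriv[OF g chart_at(1) u] C1m_deriv[OF h chart_at(1) u]] by (simp add: o_def)
  from frechet_derivative_at[OF this, symmetric] show ?thesis by (simp add: Tderiv_def Let_def)
qed

lemma integrable_vol_compact:
  fixes h :: "'m \<Rightarrow> real"
  assumes h: "continuous_on UNIV h" and K: "compact K" and supp: "\<And>q. q \<notin> K \<Longrightarrow> h q = 0"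
  shows "integrable vol h"
proof -
  have "bounded (h ` K)"
    using K continuous_on_subset[OF h] by (blast intro: compact_imp_bounded compact_continuous_image)
  then obtain B where B: "\<And>q. q \<in> K \<Longrightarrow> \<bar>h q\<bar> \<le> B" by (auto simp: bounded_iff)
  have "h \<in> borel_measurable borel" using h by (rule borel_measurable_continuous_onI)
  then have m: "h \<in> borel_measurable vol" by (simp cong: measurable_cong_sets)
  show ?thesis
  proof (rule integrableI_bounded_set[where A=K and B=B])
    show "K \<in> sets vol" using K by (simp add: compact_imp_closed)
    show "emeasure vol K < \<infinity>" by (rule emeasure_vol_compact[OF K])
  qed (use m B supp in auto)
qed

text \<open>A cutoff of the squared coordinate distance from \<open>q\<close>, equal to 1 up to half
  the radius of a closed coordinate ball and 0 beyond the full radius.\<close>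

lemma bump_exists:
  "\<exists>b W c K. C1m b \<and> open W \<and> q \<in> W \<and> (\<forall>p\<in>W. b p = 1) \<and>
    c \<in> \<A> \<and> compact K \<and> K \<subseteq> cdom c \<and> (\<forall>p. p \<notin> K \<longrightarrow> b p = 0)"
proof -
  obtain c where c: "c \<in> \<A>" "q \<in> cdom c" using chart_cover .
  let ?u = "snd c q"
  obtain e where e: "e > 0" "cball ?u e \<subseteq> img c"
    using open_img[OF c(1)] c(2) open_contains_cball by blast
  have "(e / 2)\<^sup>2 < e\<^sup>2" using e(1) by (simp add: power_divide)
  then obtain \<psi> \<psi>' where \<psi>: "\<And>t. (\<psi> has_real_derivative \<psi>' t) (at t)" "continuous_on UNIV \<psi>'"
    "\<And>t. t \<le> (e / 2)\<^sup>2 \<Longrightarrow> \<psi> t = 1" "\<And>t. e\<^sup>2 \<le> t \<Longrightarrow> \<psi> t = 0"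
    by (rule cutoff_exists) blast
  have C\<psi>: "C1 UNIV \<psi>" using \<psi>(1,2) by (intro C1_real) auto
  define b where "b p = (if p \<in> cdom c then \<psi> ((snd c p - ?u) \<bullet> (snd c p - ?u)) else 0)" for p
  define K where "K = chart_inv c ` cball ?u e"
  define W where "W = chart_inv c ` ball ?u (e / 2)"
  have K: "compact K"
    unfolding K_def by (intro compact_continuous_image continuous_on_subset[OF chart_inv_continuous[OF c(1)] e(2)]) simp
  have Kc: "K \<subseteq> cdom c" using e(2) chart_inv_in[OF c(1)] by (auto simp: K_def)
  have inK: "p \<in> K" if "p \<in> cdom c" "snd c p \<in> cball ?u e" for p
    using that chart_inv_chart[OF c(1) that(1)] unfolding K_def by (metis imageI)
  have zero: "b p = 0" if "p \<notin> K" for p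
  proof (cases "p \<in> cdom c")
    case True
    then have "e < norm (snd c p - ?u)" using inK[OF True] that by (force simp: dist_norm norm_minus_commute)
    then have "e\<^sup>2 \<le> (norm (snd c p - ?u))\<^sup>2" using e(1) by (intro power_mono) auto
    then show ?thesis using True \<psi>(4) by (simp add: b_def power2_norm_eq_inner)
  qed (simp add: b_def)
  have half: "ball ?u (e / 2) \<subseteq> img c" using e by (intro order_trans[OF _ e(2)]) auto
  have "openin (top_of_set (cdom c)) W"
    unfolding W_def
    by (rule homeomorphism_imp_open_map[OF homeomorphism_symD[OF chart_homeomorphism[OF c(1)]]])
       (use half in \<open>auto simp: openin_open\<close>)
  then have W: "open W" using open_dom[OF c(1)] openin_open_trans by blast
  have one: "b p = 1" if p: "p \<in> W" for p
  proof -
    obtain u where u: "p = chart_inv c u" "u \<in> ball ?u (e / 2)" using p unfolding W_def by blast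
    then have "u \<in> img c" using half by blast
    then have "snd c p = u" "p \<in> cdom c" using u(1) chart_chart_inv[OF c(1)] chart_inv_in[OF c(1)] by auto
    moreover have "(norm (u - ?u))\<^sup>2 \<le> (e / 2)\<^sup>2"
      using u(2) by (intro power_mono) (auto simp: dist_norm norm_minus_commute)
    ultimately show ?thesis using \<psi>(3) by (simp add: b_def power2_norm_eq_inner)
  qed
  have "?u \<in> ball ?u (e / 2)" using e(1) by simp
  then have qW: "q \<in> W" using chart_inv_chart[OF c] unfolding W_def by (metis imageI)
  have "C1m b"
    unfolding C1m_def
  proof
    \<comment> \<open>In another chart the bump is a composition with the transition map on the
      overlap and zero off \<open>K\<close>; these two open sets cover the image of the chart since
      \<open>K\<close> lies in the domain of \<open>c\<close>.\<close>
    fix d assume d: "d \<in> \<A>"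
    let ?\<tau> = "transit d c"
    have C\<tau>: "C1 (overlap d c) (\<lambda>v. ?\<tau> v - ?u)"
      using C1_add[OF open_overlap[OF d c(1)] smooth_C1[OF smooth_trans[OF d c(1)]] C1_const[OF open_overlap[OF d c(1)], of "- ?u"]]
      by simp
    have "C1 (overlap d c) (\<lambda>v. \<psi> ((?\<tau> v - ?u) \<bullet> (?\<tau> v - ?u)))"
      by (rule C1_compose[OF open_overlap[OF d c(1)] open_UNIV C1_inner[OF open_overlap[OF d c(1)] C\<tau> C\<tau>] C\<psi>]) simp
    then have 1: "C1 (overlap d c) (b \<circ> chart_inv d)"
      by (rule C1_cong[OF open_overlap[OF d c(1)], rotated]) (auto simp: b_def chart_inv_chart[OF d])
    have o: "open (snd d ` (cdom d - K))"
      using K open_dom[OF d] by (intro open_chart_image d) (auto intro: compact_imp_closed)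
    have 2: "C1 (snd d ` (cdom d - K)) (b \<circ> chart_inv d)"
      by (rule C1_cong[OF o _ C1_const[OF o, of 0]]) (auto simp: zero chart_inv_chart[OF d])
    have "img d = overlap d c \<union> snd d ` (cdom d - K)" using Kc by blast
    then show "C1 (img d) (b \<circ> chart_inv d)"
      using C1_Un[OF open_overlap[OF d c(1)] o 1 2] by simp
  qed
  then show ?thesis using W qW one c(1) K Kc zero by blast
qed

end

section \<open>Consequences of the shrinker equation\<close>

locale shrinker =
  fixes \<A> :: "('m::{t2_space, second_countable_topology}, 'n::finite) chart set"
    and x :: "'m \<Rightarrow> 'a::euclidean_space"
  assumes ss: "self_shrinker \<A> x"
begin

sublocale immersed \<A> x
  using ss by unfold_locales (auto simp: self_shrinker_def)

abbreviation "H \<equiv> mean_curvature \<A> x"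

definition w :: "'m \<Rightarrow> real" where "w q = (norm (H q))\<^sup>2"

lemma H_eq: "c \<in> \<A> \<Longrightarrow> q \<in> cdom c \<Longrightarrow> H q = - (1/2) *\<^sub>R (x q - tang c (snd c q))"
  using ss normal_part_eq by (simp add: self_shrinker_def)

lemma w_eq:
  assumes c: "c \<in> \<A>" "q \<in> cdom c"
  shows "4 * w q = (norm (x q - tang c (snd c q)))\<^sup>2"
  by (simp add: w_def H_eq[OF c] power_divide)

lemma tang_square:
  assumes c: "c \<in> \<A>" "q \<in> cdom c"
  shows "x q \<bullet> tang c (snd c q) = (norm (x q))\<^sup>2 - 4 * w q"
    and "(norm (tang c (snd c q)))\<^sup>2 = (norm (x q))\<^sup>2 - 4 * w q"
proof -
  have u: "snd c q \<in> img c" using c by auto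
  have "(x q - tang c (snd c q)) \<bullet> tang c (snd c q) = 0"
    using tang_orth[OF c(1) u, of "T c (snd c q)"] chart_inv_chart[OF c]
      immersion_patch.tang_def[OF patch[OF c(1)], of "snd c q"] by simp
  then show "x q \<bullet> tang c (snd c q) = (norm (x q))\<^sup>2 - 4 * w q"
    "(norm (tang c (snd c q)))\<^sup>2 = (norm (x q))\<^sup>2 - 4 * w q"
    unfolding w_eq[OF c] power2_norm_eq_inner by (simp_all add: inner_diff_left inner_diff_right inner_commute)
qed

lemma w_bounds: "0 \<le> w q" "4 * w q \<le> (norm (x q))\<^sup>2"
proof -
  show "0 \<le> w q" by (simp add: w_def)
  have "0 \<le> (norm (tang (chart_at \<A> q) (snd (chart_at \<A> q) q)))\<^sup>2" by simp
  then show "4 * w q \<le> (norm (x q))\<^sup>2" using tang_square(2)[OF chart_at(1,2)] by simp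
qed

lemma continuous_x: "continuous_on UNIV x"
proof (rule continuous_on_atlas)
  fix c assume c: "c \<in> \<A>"
  have "continuous_on (cdom c) (X c \<circ> snd c)"
    by (intro continuous_on_compose chart_continuous c C1_continuous smooth_C1 smooth_X)
  then show "continuous_on (cdom c) x" by (rule continuous_on_eq) (simp add: chart_inv_chart c)
qed

lemma continuous_w: "continuous_on UNIV w"
proof (rule continuous_on_atlas)
  fix c assume c: "c \<in> \<A>"
  have "continuous_on (img c) (tang c)"
    unfolding immersion_patch.tang_def[OF patch[OF c], abs_def]
    by (intro continuous_on_fd_T c smooth_C1 smooth_X)
  then have "continuous_on (cdom c) (tang c \<circ> snd c)"
    by (rule continuous_on_compose[OF chart_continuous[OF c]])
  then have "continuous_on (cdom c) (\<lambda>q. (norm (x q - tang c (snd c q)))\<^sup>2 / 4)"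
    by (intro continuous_intros continuous_on_subset[OF continuous_x]) (auto simp: o_def)
  then show "continuous_on (cdom c) w"
    by (rule continuous_on_eq) (use w_eq[OF c] in force)
qed

text \<open>The Christoffel symbols in the definition of the mean curvature only contribute a tangential
  vector, which is orthogonal to \<open>x\<^sup>N\<close>; so their existence is not needed here.\<close>

lemma normal_trace:
  assumes c: "c \<in> \<A>" and u: "u \<in> img c"
  shows "\<exists>E. orthonormal_frame (fd (X c) u) E \<and>
    (\<Sum>i\<in>UNIV. (X c u - tang c u) \<bullet> fd (\<lambda>y. fd (X c) y (E i)) u (E i)) = - 2 * w (chart_inv c u)"
proof -
  define q where "q = chart_inv c u"
  have q: "q \<in> cdom c" "snd c q = u" using chart_inv_in[OF c u] chart_chart_inv[OF c u] by (auto simp: q_def)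
  \<comment> \<open>\<open>mean_curvature\<close> is computed in the chart chosen by
    \<open>chart_at\<close>, so the frame is taken there and transported to
    \<open>c\<close>.\<close>
  define d where "d = chart_at \<A> q"
  have d: "d \<in> \<A>" "q \<in> cdom d" using chart_at by (auto simp: d_def)
  define v where "v = snd d q"
  have v: "v \<in> overlap d c" "v \<in> img d" "transit d c v = u"
    using q d by (auto simp: v_def chart_inv_chart)
  define \<nu> where "\<nu> = X c u - tang c u"
  have \<nu>c: "\<nu> \<bullet> fd (X c) u z = 0" for z unfolding \<nu>_def by (rule tang_orth[OF c u])
  have \<nu>d: "\<nu> \<bullet> fd (X d) v z = 0" for z
    unfolding fd_X_trans[OF d(1) c v(1)] v(3) by (rule \<nu>c)
  have Hq: "H q = - (1/2) *\<^sub>R \<nu>" using H_eq[OF c q(1)] by (simp add: \<nu>_def q_def[symmetric] q(2))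
  define B where "B = (SOME B. tangent_onb (X d) v B)"
  have "\<exists>B. tangent_onb (X d) v B"
    using orthonormal_frame_exists[OF linear_fd_X[OF d(1) v(2)] inj_fd_X[OF d(1) v(2)]] frame_tangent_onb by metis
  then have "tangent_onb (X d) v B" unfolding B_def by (rule someI_ex)
  then obtain E where E: "orthonormal_frame (fd (X d) v) E" "bij_betw E UNIV B" by (rule tangent_onb_frame)
  have "H q = (\<Sum>e\<in>B. second_fundamental_form (X d) (\<lambda>_. e) (\<lambda>_. e) v)"
    by (simp only: mean_curvature_def Let_def d_def[symmetric] v_def[symmetric] B_def)
  also have "\<dots> = (\<Sum>i\<in>UNIV. second_fundamental_form (X d) (\<lambda>_. E i) (\<lambda>_. E i) v)"
    by (rule sum.reindex_bij_betw[OF E(2), symmetric])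
  finally have "\<nu> \<bullet> H q = (\<Sum>i\<in>UNIV. \<nu> \<bullet> fd (\<lambda>y. fd (X d) y (E i)) v (E i))"
    by (simp add: inner_sum_right second_fundamental_form_def inner_diff_right \<nu>d del: comp_apply)
  also have "\<dots> = (\<Sum>i\<in>UNIV. \<nu> \<bullet> fd (\<lambda>y. fd (X c) y (fd (transit d c) v (E i))) u (fd (transit d c) v (E i)))"
    using second_derivative_transit[OF d(1) c v(1), of \<nu>] \<nu>c unfolding v(3) by simp
  finally have "(\<Sum>i\<in>UNIV. \<nu> \<bullet> fd (\<lambda>y. fd (X c) y (fd (transit d c) v (E i))) u (fd (transit d c) v (E i)))
      = - 2 * w q"
    by (simp add: Hq w_def power_divide power2_norm_eq_inner)
  moreover have "orthonormal_frame (fd (X c) u) (\<lambda>i. fd (transit d c) v (E i))"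
    using frame_transit[OF d(1) c v(1) E(1)] unfolding v(3) .
  ultimately show ?thesis unfolding \<nu>_def q_def by blast
qed

abbreviation "div_term h q \<equiv> Tderiv h q + h q * (real CARD('n) - 2 * w q)"

lemma div_term_integrable:
  assumes h: "C1m h" and K: "compact K" and supp: "\<And>q. q \<notin> K \<Longrightarrow> h q = 0"
  shows "integrable vol (div_term h)"
proof (rule integrable_vol_compact[OF _ K])
  show "continuous_on UNIV (div_term h)"
    by (intro continuous_intros Tderiv_continuous h C1m_continuous continuous_w)
  show "div_term h q = 0" if "q \<notin> K" for q
    using Tderiv_zero[OF h compact_imp_closed[OF K] supp that] supp[OF that] by simp
qed

lemma integral_div_term_chart:
  assumes h: "C1m h" and c: "c \<in> \<A>" and K: "compact K" "K \<subseteq> cdom c" and supp: "\<And>q. q \<notin> K \<Longrightarrow> h q = 0"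
  shows "(\<integral>q. div_term h q \<partial>vol) = 0"
proof -
  have "(\<integral>q. div_term h q \<partial>vol) = (\<integral>u. indicator (img c) u *\<^sub>R (dens c u * div_term h (chart_inv c u)) \<partial>lborel)"
  proof (rule integral_vol_chart[OF c])
    show "div_term h \<in> borel_measurable borel"
      by (intro borel_measurable_continuous_onI continuous_intros Tderiv_continuous h C1m_continuous continuous_w)
    show "div_term h q = 0" if "q \<notin> cdom c" for q
    proof -
      have "q \<notin> K" using that K by blast
      then show ?thesis using Tderiv_zero[OF h compact_imp_closed[OF K(1)] supp] supp by simp
    qed
  qed
  also have "\<dots> = (\<integral>u. indicator (img c) u *\<^sub>R (dens c u * (fd (h \<circ> chart_inv c) u (T c u)
      + (h \<circ> chart_inv c) u * (real CARD('n) + - 2 * w (chart_inv c u)))) \<partial>lborel)"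
  proof (intro Bochner_Integration.integral_cong refl)
    fix u
    show "indicator (img c) u *\<^sub>R (dens c u * div_term h (chart_inv c u)) =
      indicator (img c) u *\<^sub>R (dens c u * (fd (h \<circ> chart_inv c) u (T c u)
      + (h \<circ> chart_inv c) u * (real CARD('n) + - 2 * w (chart_inv c u))))"
    proof (cases "u \<in> img c")
      case True
      then show ?thesis
        using Tderiv_chart[OF h c chart_inv_in[OF c True]] chart_chart_inv[OF c True] by simp
    qed simp
  qed
  also have "\<dots> = 0"
  proof (rule immersion_patch.integral_divergence_T[OF patch[OF c], where K = "snd c ` K" and \<eta> = "h \<circ> chart_inv c"
        and N = "\<lambda>u. - 2 * w (chart_inv c u)"])
    show "C1 (img c) (h \<circ> chart_inv c)" using h c by (simp add: C1m_def)
    show "compact (snd c ` K)"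
      using K by (intro compact_continuous_image continuous_on_subset[OF chart_continuous[OF c]])
    show "snd c ` K \<subseteq> img c" using K by blast
    show "(h \<circ> chart_inv c) u = 0" if "u \<in> img c - snd c ` K" for u
      using that by (auto simp: chart_inv_chart[OF c] intro!: supp)
  qed (rule normal_trace[OF c])
  finally show ?thesis .
qed

text \<open>Induction over a finite cover by sets on which some bump function b equals 1, in place
  of a partition of unity. In h = h b + h (1 - b) the first summand lives in one chart, and the
  second vanishes on the set just treated, so its support is covered by the remaining ones.\<close>

lemma integral_div_term:
  assumes h: "C1m h" and K: "compact K" and supp: "\<And>q. q \<notin> K \<Longrightarrow> h q = 0"
  shows "(\<integral>q. div_term h q \<partial>vol) = 0"
proof -
  define good where "good W \<longleftrightarrow> open W \<and> (\<exists>b c L. C1m b \<and> (\<forall>p\<in>W. b p = 1) \<and> c \<in> \<A> \<and> compact L \<and>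
    L \<subseteq> cdom c \<and> (\<forall>p. p \<notin> L \<longrightarrow> b p = 0))" for W
  have "\<exists>W. good W \<and> q \<in> W" for q
    using bump_exists[of q] unfolding good_def by blast
  then obtain W where W: "\<And>q. good (W q)" "\<And>q. q \<in> W q" by metis
  have o: "\<And>q. q \<in> K \<Longrightarrow> open (W q)" using W(1) unfolding good_def by blast
  have "K \<subseteq> (\<Union>q\<in>K. W q)" using W(2) by blast
  from compactE_image[OF K o this] obtain I where I: "finite I" "K \<subseteq> (\<Union>q\<in>I. W q)" by metis
  from I(1) h K supp I(2) show ?thesis
  proof (induction I arbitrary: h K rule: finite_induct)
    case empty
    then have "h = (\<lambda>_. 0)" by auto
    moreover have "Tderiv (\<lambda>_. 0) q = 0" for q
      using Tderiv_zero[of "\<lambda>_. 0" "{}"] C1m_const by simp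
    ultimately show ?case by simp
  next
    case (insert i I)
    obtain b c L where b: "C1m b" "\<And>p. p \<in> W i \<Longrightarrow> b p = 1" "c \<in> \<A>" "compact L" "L \<subseteq> cdom c"
      "\<And>p. p \<notin> L \<Longrightarrow> b p = 0"
      using W(1)[of i] unfolding good_def by blast
    \<comment> \<open>The factor 1 - b is spelled as a sum with a constant multiple, the form to
      which the closure rules for \<open>C1m\<close> apply.\<close>
    let ?h1 = "\<lambda>q. h q * b q" and ?h2 = "\<lambda>q. h q * (1 + (-1) * b q)"
    have C: "C1m ?h1" "C1m ?h2"
      by (intro C1m_mult C1m_add C1m_const insert.prems b(1))+
    have "open (W i)" using W(1) by (simp add: good_def)
    then have K2: "compact (K - W i)" using insert.prems(2) by (simp add: compact_diff)
    have s1: "?h1 q = 0" if "q \<notin> L" for q using b(6)[OF that] by simp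
    have s2: "?h2 q = 0" if "q \<notin> K - W i" for q using that insert.prems(3) b(2) by auto
    have z2: "(\<integral>q. div_term ?h2 q \<partial>vol) = 0"
      by (rule insert.IH[OF C(2) K2 s2]) (use insert.prems(4) in auto)
    have z1: "(\<integral>q. div_term ?h1 q \<partial>vol) = 0"
      by (rule integral_div_term_chart[OF C(1) b(3,4,5) s1])
    have sum: "(\<lambda>q. ?h1 q + ?h2 q) = h" by (simp add: fun_eq_iff algebra_simps)
    have "Tderiv h q = Tderiv ?h1 q + Tderiv ?h2 q" for q
      using Tderiv_add[OF C] unfolding sum .
    then have "div_term h q = div_term ?h1 q + div_term ?h2 q" for q
      by (simp add: algebra_simps)
    then have "(\<integral>q. div_term h q \<partial>vol) = (\<integral>q. div_term ?h1 q + div_term ?h2 q \<partial>vol)" by simp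
    also have "\<dots> = 0"
      using z1 z2 div_term_integrable[OF C(1) b(4) s1] div_term_integrable[OF C(2) K2 s2]
      by (subst Bochner_Integration.integral_add) auto
    finally show ?case .
  qed
qed

lemma radial_C1m:
  assumes \<phi>: "\<And>t. (\<phi> has_real_derivative \<phi>' t) (at t)" "continuous_on UNIV \<phi>'"
  shows "C1m (\<lambda>q. \<phi> ((norm (x q))\<^sup>2))"
    and "Tderiv (\<lambda>q. \<phi> ((norm (x q))\<^sup>2)) q = 2 * \<phi>' ((norm (x q))\<^sup>2) * ((norm (x q))\<^sup>2 - 4 * w q)"
proof -
  let ?h = "\<lambda>q. \<phi> ((norm (x q))\<^sup>2)"
  have C: "C1 UNIV \<phi>" using \<phi> by (intro C1_real) auto
  show "C1m ?h"
    unfolding C1m_def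
  proof
    fix c assume c: "c \<in> \<A>"
    note X = smooth_C1[OF smooth_X[OF c]]
    have "C1 (img c) (\<lambda>u. \<phi> (X c u \<bullet> X c u))"
      by (rule C1_compose[OF open_img[OF c] open_UNIV C1_inner[OF open_img[OF c] X X] C]) simp
    then show "C1 (img c) (?h \<circ> chart_inv c)" by (simp add: power2_norm_eq_inner o_def)
  qed
  let ?c = "chart_at \<A> q" let ?u = "snd ?c q"
  note c = chart_at[of q]
  have u: "?u \<in> img ?c" using c by blast
  have Xu: "X ?c ?u = x q" using chart_inv_chart[OF c] by simp
  have d: "(X ?c has_derivative fd (X ?c) ?u) (at ?u)"
    by (rule immersion_patch.deriv[OF patch[OF c(1)] u])
  have "((\<lambda>u. X ?c u \<bullet> X ?c u) has_derivative (\<lambda>v. X ?c ?u \<bullet> fd (X ?c) ?u v + fd (X ?c) ?u v \<bullet> X ?c ?u)) (at ?u)"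
    by (intro has_derivative_inner d)
  moreover have "(\<phi> has_derivative (*) (\<phi>' (X ?c ?u \<bullet> X ?c ?u))) (at (X ?c ?u \<bullet> X ?c ?u))"
    using \<phi>(1) by (simp add: has_field_derivative_def)
  ultimately have "((\<lambda>u. \<phi> (X ?c u \<bullet> X ?c u)) has_derivative
     (\<lambda>v. \<phi>' (X ?c ?u \<bullet> X ?c ?u) * (X ?c ?u \<bullet> fd (X ?c) ?u v + fd (X ?c) ?u v \<bullet> X ?c ?u))) (at ?u)"
    by (rule has_derivative_compose)
  from frechet_derivative_at[OF this, symmetric]
  have "Tderiv ?h q = \<phi>' (x q \<bullet> x q) * (x q \<bullet> fd (X ?c) ?u (T ?c ?u) + fd (X ?c) ?u (T ?c ?u) \<bullet> x q)"
    using chart_inv_chart[OF c] by (simp add: Tderiv_def Let_def o_def power2_norm_eq_inner)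
  also have "fd (X ?c) ?u (T ?c ?u) = tang ?c ?u"
    by (simp only: immersion_patch.tang_def[OF patch[OF c(1)]])
  finally show "Tderiv ?h q = 2 * \<phi>' ((norm (x q))\<^sup>2) * ((norm (x q))\<^sup>2 - 4 * w q)"
    using tang_square(1)[OF c] by (simp add: inner_commute power2_norm_eq_inner)
qed

end

subsection \<open>Volume growth\<close>

text \<open>The analytic core on an arbitrary measure space: geometry enters only through
  \<open>div\<close>, the divergence theorem for radial functions, and through the pointwise bounds
  on \<open>w\<close>.\<close>

lemma growth_of_weighted_integral:
  fixes s w :: "'a \<Rightarrow> real" and n \<beta> R :: real
  assumes meas [measurable]: "s \<in> borel_measurable M" "w \<in> borel_measurable M"
    and \<beta>: "0 \<le> \<beta>" "\<And>q. \<beta> \<le> w q" and w: "\<And>q. 4 * w q \<le> s q"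
    and fin: "\<And>R. emeasure M {q \<in> space M. s q \<le> R} < \<infinity>"
    and \<psi>: "\<And>t. (\<psi> has_real_derivative \<psi>' t) (at t)" "continuous_on UNIV \<psi>'" "\<And>t. \<psi>' t \<le> 0"
      "\<And>t. 0 \<le> \<psi> t" "\<And>t. \<psi> t \<le> 1" "\<And>t. R \<le> t \<Longrightarrow> \<psi> t = 0"
    and div: "\<And>\<phi> \<phi>' R. (\<And>t. (\<phi> has_real_derivative \<phi>' t) (at t)) \<Longrightarrow> continuous_on UNIV \<phi>' \<Longrightarrow>
      (\<And>t. R \<le> t \<Longrightarrow> \<phi> t = 0) \<Longrightarrow>
      integrable M (\<lambda>q. 2 * \<phi>' (s q) * (s q - 4 * w q) + \<phi> (s q) * (n - 2 * w q)) \<and>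
      (\<integral>q. 2 * \<phi>' (s q) * (s q - 4 * w q) + \<phi> (s q) * (n - 2 * w q) \<partial>M) = 0"
    and t: "1 \<le> t"
  shows "(\<integral>q. \<psi> (s q) * exp (- s q / (4 * t)) \<partial>M)
    \<le> exp \<beta> * t powr (n / 2 - \<beta>) * (\<integral>q. \<psi> (s q) * exp (- s q / 4) \<partial>M)"
proof -
  define a where "a = n / 2 - \<beta>"
  define J where "J t = (\<integral>q. \<psi> (s q) * exp (- s q / (4 * t)) \<partial>M)" for t
  define J' where "J' t = (\<integral>q. \<psi> (s q) * (exp (- s q / (4 * t)) * (s q / (4 * t\<^sup>2))) \<partial>M)" for t
  have s0: "0 \<le> s q" for q using \<beta>(1) \<beta>(2)[of q] w[of q] by linarith
  have [measurable]: "\<psi> \<in> borel_measurable borel"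
    using \<psi>(1) by (intro borel_measurable_continuous_onI) (meson DERIV_isCont continuous_at_imp_continuous_on)
  \<comment> \<open>Every integrand below is dominated by a constant on the sublevel set of
    \<open>R\<close>, which carries the support of the cutoff and has finite measure.\<close>
  have \<psi>_le: "\<psi> (s q) * c \<le> indicator {q \<in> space M. s q \<le> R} q *\<^sub>R C" 
    "0 \<le> \<psi> (s q) * c" if "q \<in> space M" "0 \<le> c" "s q \<le> R \<Longrightarrow> c \<le> C" for q c C
  proof -
    show "\<psi> (s q) * c \<le> indicator {q \<in> space M. s q \<le> R} q *\<^sub>R C"
    proof (cases "s q \<le> R")
      case True
      then show ?thesis using that mult_left_le_one_le[of c "\<psi> (s q)"] \<psi>(4,5) by (auto intro: order_trans)
    qed (simp add: \<psi>(6))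
    show "0 \<le> \<psi> (s q) * c" using that \<psi>(4) by simp
  qed
  have int_ind: "integrable M (\<lambda>q. indicator {q \<in> space M. s q \<le> R} q *\<^sub>R (C::real))" for C
    using fin[of R] by (intro integrable_scaleR_left integrable_real_indicator) auto
  have int: "integrable M (\<lambda>q. \<psi> (s q) * h q)"
    if h: "h \<in> borel_measurable M" "\<And>q. 0 \<le> h q" "\<And>q. s q \<le> R \<Longrightarrow> h q \<le> C" for h C
    using \<psi>_le[OF _ h(2,3)] h(1)
    by (intro Bochner_Integration.integrable_bound[OF int_ind[of C]] AE_I2) (auto intro: order_trans[OF _ abs_ge_self])
  have exp_le: "exp (- s q / (4 * t)) \<le> 1" if "0 < t" for q t
    using s0[of q] that by simp
  have int1: "integrable M (\<lambda>q. \<psi> (s q) * exp (- s q / (4 * t)))" if "0 < t" for t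
    by (rule int[of _ 1]) (use exp_le that in auto)
  have int2: "integrable M (\<lambda>q. \<psi> (s q) * (exp (- s q / (4 * t)) * (s q / (4 * t\<^sup>2))))" if "0 < t" for t
  proof (rule int[of _ "R / (4 * t\<^sup>2)"])
    show "exp (- s q / (4 * t)) * (s q / (4 * t\<^sup>2)) \<le> R / (4 * t\<^sup>2)" if "s q \<le> R" for q
      using mult_mono[OF exp_le[OF \<open>0 < t\<close>, of q] divide_right_mono[OF that, of "4 * t\<^sup>2"]] s0 by simp
  qed (use s0 in auto)
  \<comment> \<open>Radius t / 2 keeps the parameter r above t / 2, so that s / (4 r^2) is at most R
    / t^2 where s <= R.\<close>
  have derivJ: "(J has_real_derivative J' t) (at t)" if t: "0 < t" for t
    unfolding J_def[abs_def] J'_def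
  proof (rule integral_has_real_derivative[where \<epsilon>="t / 2" and g="\<lambda>q. indicator {q \<in> space M. s q \<le> R} q *\<^sub>R (R / t\<^sup>2)"
        and F'="\<lambda>t q. \<psi> (s q) * (exp (- s q / (4 * t)) * (s q / (4 * t\<^sup>2)))"])
    fix r q assume r: "\<bar>r - t\<bar> < t / 2" and q: "q \<in> space M"
    have r0: "t / 2 < r" using r by (auto simp: abs_if split: if_splits)
    then have r1: "0 < r" using t by linarith
    show "((\<lambda>t. \<psi> (s q) * exp (- s q / (4 * t))) has_real_derivative
       \<psi> (s q) * (exp (- s q / (4 * r)) * (s q / (4 * r\<^sup>2)))) (at r)"
      using r1 by (auto intro!: derivative_eq_intros simp: power2_eq_square field_simps)
    have "t\<^sup>2 \<le> 4 * r\<^sup>2"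
      using power_mono[of t "2 * r" 2] r0 t by (simp add: power_mult_distrib)
    then have "s q / (4 * r\<^sup>2) \<le> R / t\<^sup>2" if "s q \<le> R"
      using that s0[of q] t by (intro frac_le) auto
    then have "exp (- s q / (4 * r)) * (s q / (4 * r\<^sup>2)) \<le> R / t\<^sup>2" if "s q \<le> R"
      using mult_mono[OF exp_le[OF r1, of q], of "s q / (4 * r\<^sup>2)" "R / t\<^sup>2"] s0[of q] that by simp
    from \<psi>_le[OF q _ this] s0[of q]
    show "\<bar>\<psi> (s q) * (exp (- s q / (4 * r)) * (s q / (4 * r\<^sup>2)))\<bar> \<le> indicator {q \<in> space M. s q \<le> R} q *\<^sub>R (R / t\<^sup>2)"
      by simp
  next
    fix r assume "\<bar>r - t\<bar> < t / 2"
    then have "0 < r" using t by (auto simp: abs_if split: if_splits)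
    then show "integrable M (\<lambda>q. \<psi> (s q) * exp (- s q / (4 * r)))" by (rule int1)
  qed (use t int_ind in auto)
  have key: "J' t \<le> (a / t + \<beta> / t\<^sup>2) * J t" if t: "1 \<le> t" for t
  proof -
    have t0: "0 < t" using t by linarith
    define \<phi> where "\<phi> \<sigma> = \<psi> \<sigma> * exp (- \<sigma> / (4 * t))" for \<sigma>
    define \<phi>' where "\<phi>' \<sigma> = (\<psi>' \<sigma> - \<psi> \<sigma> / (4 * t)) * exp (- \<sigma> / (4 * t))" for \<sigma>
    let ?F = "\<lambda>q. 2 * \<phi>' (s q) * (s q - 4 * w q) + \<phi> (s q) * (n - 2 * w q)"
    \<comment> \<open>\<open>?F\<close> after dropping the \<open>\<psi>'\<close> term and replacing
      \<open>w\<close> by \<open>\<beta>\<close>; its two parts integrate to multiples of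
      \<open>J t\<close> and \<open>J' t\<close>.\<close>
    let ?G = "\<lambda>q. (2 * a + 2 * \<beta> / t) * (\<psi> (s q) * exp (- s q / (4 * t)))
      - 2 * t * (\<psi> (s q) * (exp (- s q / (4 * t)) * (s q / (4 * t\<^sup>2))))"
    have \<psi>c: "continuous_on UNIV \<psi>"
      using \<psi>(1) by (meson DERIV_isCont continuous_at_imp_continuous_on)
    have "integrable M ?F \<and> integral\<^sup>L M ?F = 0"
    proof (rule div[of \<phi> \<phi>' R])
      show "(\<phi> has_real_derivative \<phi>' \<sigma>) (at \<sigma>)" for \<sigma>
        unfolding \<phi>_def[abs_def] \<phi>'_def using t0
        by (auto intro!: derivative_eq_intros \<psi>(1) simp: field_simps)
      show "continuous_on UNIV \<phi>'"
        unfolding \<phi>'_def using t0 by (intro continuous_intros \<psi>(2) \<psi>c) auto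
    qed (simp add: \<phi>_def \<psi>(6))
    then have F: "integrable M ?F" "integral\<^sup>L M ?F = 0" by blast+
    have FG: "?F q \<le> ?G q" for q
    proof -
      let ?e = "exp (- s q / (4 * t))"
      \<comment> \<open>The direct term -2 w and the term 2 w / t from the Gaussian weight add up to
        -2 w (1 - 1/t), whose factor is nonnegative since t >= 1.\<close>
      have "w q * (1 - 1 / t) \<ge> \<beta> * (1 - 1 / t)" using \<beta>(2) t by (intro mult_right_mono) auto
      then have "n - 2 * w q - (s q - 4 * w q) / (2 * t) \<le> 2 * a + 2 * \<beta> / t - s q / (2 * t)"
      proof -
        have "(s q - 4 * w q) / (2 * t) = s q / (2 * t) - 2 * (w q / t)" using t0 by (simp add: field_simps)
        moreover have "w q * (1 - 1 / t) = w q - w q / t" "\<beta> * (1 - 1 / t) = \<beta> - \<beta> / t"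
          by (simp_all add: right_diff_distrib)
        moreover have "2 * \<beta> / t = 2 * (\<beta> / t)" by simp
        moreover have "2 * a = n - 2 * \<beta>" by (simp add: a_def)
        ultimately show ?thesis
          using \<open>w q * (1 - 1 / t) \<ge> \<beta> * (1 - 1 / t)\<close> by linarith
      qed
      then have 1: "\<psi> (s q) * ?e * (n - 2 * w q - (s q - 4 * w q) / (2 * t))
          \<le> \<psi> (s q) * ?e * (2 * a + 2 * \<beta> / t - s q / (2 * t))"
        using \<psi>(4) by (intro mult_left_mono) auto
      have 2: "\<psi>' (s q) * (?e * (s q - 4 * w q)) \<le> 0"
        using \<psi>(3) w[of q] by (intro mult_nonpos_nonneg mult_nonneg_nonneg) auto
      have "?F q = 2 * (\<psi>' (s q) * (?e * (s q - 4 * w q))) + \<psi> (s q) * ?e * (n - 2 * w q - (s q - 4 * w q) / (2 * t))"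
        using t0 by (simp add: \<phi>_def \<phi>'_def field_simps)
      moreover have "?G q = \<psi> (s q) * ?e * (2 * a + 2 * \<beta> / t - s q / (2 * t))"
        using t0 by (simp add: field_simps power2_eq_square)
      ultimately show ?thesis using 1 2 by linarith
    qed
    have "0 \<le> integral\<^sup>L M ?G"
    proof -
      have "integrable M ?G"
        by (intro Bochner_Integration.integrable_diff integrable_mult_right int1 int2 t0)
      from integral_mono[OF F(1) this FG] show ?thesis unfolding F(2) .
    qed
    also have "integral\<^sup>L M ?G = (2 * a + 2 * \<beta> / t) * J t - 2 * t * J' t"
      unfolding J_def J'_def
      by (simp only: Bochner_Integration.integral_diff[OF integrable_mult_right[OF int1[OF t0]]
            integrable_mult_right[OF int2[OF t0]]] integral_mult_right_zero)
    finally show ?thesis using t0 by (simp add: field_simps power2_eq_square)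
  qed
  \<comment> \<open>Integrating factor for the inequality \<open>key\<close>: a primitive of a / t +
    \<beta> / t^2 is a ln t - \<beta> / t.\<close>
  define g where "g t = J t * (t powr (- a) * exp (\<beta> / t))" for t
  have "g t \<le> g 1"
  proof (rule DERIV_nonpos_imp_nonincreasing[OF t])
    fix r :: real assume r: "1 \<le> r" "r \<le> t"
    then have r0: "0 < r" by linarith
    have e1: "((\<lambda>t. t powr (- a)) has_real_derivative - a * r powr (- a) / r) (at r)"
      using has_real_derivative_powr[OF r0, of "- a"] r0 by (simp add: powr_diff)
    have e2: "((\<lambda>t. exp (\<beta> / t)) has_real_derivative exp (\<beta> / r) * (- \<beta> / r\<^sup>2)) (at r)"
      using r0 by (auto intro!: derivative_eq_intros simp: power2_eq_square)
    have "(g has_real_derivative (J r * (r powr (- a) * (exp (\<beta> / r) * (- \<beta> / r\<^sup>2)) + - a * r powr (- a) / r * exp (\<beta> / r))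
       + J' r * (r powr (- a) * exp (\<beta> / r)))) (at r)"
      unfolding g_def[abs_def]
      using DERIV_mult[OF derivJ[OF r0] DERIV_mult[OF e1 e2]] by (simp add: algebra_simps)
    moreover have "J r * (r powr (- a) * (exp (\<beta> / r) * (- \<beta> / r\<^sup>2)) + - a * r powr (- a) / r * exp (\<beta> / r))
       + J' r * (r powr (- a) * exp (\<beta> / r))
      = (r powr (- a) * exp (\<beta> / r)) * (J' r - (a / r + \<beta> / r\<^sup>2) * J r)"
      by (simp add: algebra_simps)
    moreover have "\<dots> \<le> 0"
      using key[OF r(1)] by (intro mult_nonneg_nonpos) auto
    ultimately show "\<exists>y. (g has_real_derivative y) (at r) \<and> y \<le> 0" by metis
  qed
  then have "J t * (t powr (- a) * exp (\<beta> / t)) \<le> J 1 * exp \<beta>" by (simp add: g_def)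
  then have "J t * (t powr (- a) * exp (\<beta> / t)) * t powr a \<le> J 1 * exp \<beta> * t powr a"
    by (rule mult_right_mono) simp
  moreover have "t powr (- a) * t powr a = 1" using t by (simp add: powr_minus)
  ultimately have "J t * exp (\<beta> / t) \<le> J 1 * exp \<beta> * t powr a"
    by (metis (no_types, lifting) mult.assoc mult.commute mult.left_neutral)
  moreover have "J t * 1 \<le> J t * exp (\<beta> / t)"
    using \<beta>(1) t \<psi>(4) by (intro mult_left_mono) (auto simp: J_def intro!: Bochner_Integration.integral_nonneg)
  ultimately show ?thesis by (simp add: J_def a_def mult_ac)
qed

text \<open>The cutoff depends on r, so the constant is built from \<open>K\<close>,
  \<open>S0\<close> and \<open>m\<close>, all fixed before r.\<close>

lemma volume_growth:
  fixes s w :: "'a \<Rightarrow> real" and n \<beta> :: real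
  assumes meas [measurable]: "s \<in> borel_measurable M" "w \<in> borel_measurable M"
    and \<beta>: "0 \<le> \<beta>" "\<And>q. \<beta> \<le> w q" and w: "\<And>q. 4 * w q \<le> s q"
    and fin: "\<And>R. emeasure M {q \<in> space M. s q \<le> R} < \<infinity>"
    and div: "\<And>\<phi> \<phi>' R. (\<And>t. (\<phi> has_real_derivative \<phi>' t) (at t)) \<Longrightarrow> continuous_on UNIV \<phi>' \<Longrightarrow>
      (\<And>t. R \<le> t \<Longrightarrow> \<phi> t = 0) \<Longrightarrow>
      integrable M (\<lambda>q. 2 * \<phi>' (s q) * (s q - 4 * w q) + \<phi> (s q) * (n - 2 * w q)) \<and>
      (\<integral>q. 2 * \<phi>' (s q) * (s q - 4 * w q) + \<phi> (s q) * (n - 2 * w q) \<partial>M) = 0"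
  shows "\<exists>C>0. \<forall>r\<ge>1. emeasure M {q \<in> space M. s q < r\<^sup>2} \<le> ennreal (C * r powr (n - 2 * \<beta>))"
proof -
  \<comment> \<open>The growth factor of J from t = 1 to t = 2.\<close>
  define K where "K = exp \<beta> * 2 powr (n / 2 - \<beta>)"
  have K: "0 < K" by (simp add: K_def)
  \<comment> \<open>Beyond this threshold exp(-s/8) is at most 1 / (2 K), so the weight exp(-s/4) of
    \<open>J 1\<close> is at most 1 / (2 K) times the weight exp(-s/8) of
    \<open>J 2\<close>.\<close>
  define S0 where "S0 = 8 * ln (2 * K)"
  define m where "m = measure M {q \<in> space M. s q \<le> S0}"
  have s0: "0 \<le> s q" for q using \<beta>(1) \<beta>(2)[of q] w[of q] by linarith
  have int_ind: "integrable M (indicator {q \<in> space M. s q \<le> R} :: 'a \<Rightarrow> real)" for R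
    using fin[of R] by (intro integrable_real_indicator) auto
  have bound: "measure M {q \<in> space M. s q < r\<^sup>2} \<le> exp (1/4) * exp \<beta> * (2 * m) * r powr (n - 2 * \<beta>)" if r: "1 \<le> r" for r
  proof -
    obtain \<psi> \<psi>' where \<psi>: "\<And>t. (\<psi> has_real_derivative \<psi>' t) (at t)" "continuous_on UNIV \<psi>'" "\<And>t. \<psi>' t \<le> 0"
      "\<And>t. 0 \<le> \<psi> t" "\<And>t. \<psi> t \<le> 1" "\<And>t. t \<le> r\<^sup>2 \<Longrightarrow> \<psi> t = 1" "\<And>t. r\<^sup>2 + 1 \<le> t \<Longrightarrow> \<psi> t = 0"
      using cutoff_exists[of "r\<^sup>2" "r\<^sup>2 + 1"] by auto
    have [measurable]: "\<psi> \<in> borel_measurable borel"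
      using \<psi>(1) by (intro borel_measurable_continuous_onI) (meson DERIV_isCont continuous_at_imp_continuous_on)
    define J where "J t = (\<integral>q. \<psi> (s q) * exp (- s q / (4 * t)) \<partial>M)" for t
    have J: "J t \<le> exp \<beta> * t powr (n / 2 - \<beta>) * J 1" if "1 \<le> t" for t
    proof -
      have "(\<integral>q. \<psi> (s q) * exp (- s q / (4 * t)) \<partial>M)
        \<le> exp \<beta> * t powr (n / 2 - \<beta>) * (\<integral>q. \<psi> (s q) * exp (- s q / 4) \<partial>M)"
      proof (rule growth_of_weighted_integral[where R="r\<^sup>2 + 1", OF meas \<beta> w fin \<psi>(1-5) _ _ that])
        show "\<psi> t = 0" if "r\<^sup>2 + 1 \<le> t" for t by (rule \<psi>(7)[OF that])
      qed (rule div)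
      then show ?thesis by (simp add: J_def)
    qed
    have int: "integrable M (\<lambda>q. \<psi> (s q) * exp (- s q / (4 * t)))" if "0 < t" for t
    proof (rule Bochner_Integration.integrable_bound[OF int_ind[of "r\<^sup>2 + 1"]])
      show "AE q in M. norm (\<psi> (s q) * exp (- s q / (4 * t))) \<le> norm (indicator {q \<in> space M. s q \<le> r\<^sup>2 + 1} q :: real)"
      proof (intro AE_I2)
        fix q assume "q \<in> space M"
        moreover have "\<psi> (s q) * exp (- s q / (4 * t)) \<le> 1"
          using \<psi>(4,5)[of "s q"] s0[of q] that by (intro mult_le_one) auto
        ultimately show "norm (\<psi> (s q) * exp (- s q / (4 * t))) \<le> norm (indicator {q \<in> space M. s q \<le> r\<^sup>2 + 1} q :: real)"
          using \<psi>(4)[of "s q"] \<psi>(7)[of "s q"] by (auto simp: indicator_def abs_mult)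
      qed
    qed measurable
    have "J 1 \<le> (\<integral>q. indicator {q \<in> space M. s q \<le> S0} q + \<psi> (s q) * exp (- s q / (4 * 2)) / (2 * K) \<partial>M)"
      unfolding J_def
    proof (rule integral_mono)
      fix q assume q: "q \<in> space M"
      show "\<psi> (s q) * exp (- s q / (4 * 1)) \<le> indicator {q \<in> space M. s q \<le> S0} q + \<psi> (s q) * exp (- s q / (4 * 2)) / (2 * K)"
      proof (cases "s q \<le> S0")
        case True
        have "\<psi> (s q) * exp (- s q / (4 * 1)) \<le> 1"
          using \<psi>(4,5)[of "s q"] s0[of q] by (intro mult_le_one) auto
        moreover have "0 \<le> \<psi> (s q) * exp (- s q / (4 * 2)) / (2 * K)" using \<psi>(4) K by simp
        ultimately show ?thesis using True q by simp
      next
        case False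
        then have "- s q / 8 \<le> - ln (2 * K)" by (simp add: S0_def)
        then have "exp (- s q / 8) \<le> exp (- ln (2 * K))" by (simp only: exp_le_cancel_iff)
        also have "\<dots> = 1 / (2 * K)" using K by (simp add: exp_minus inverse_eq_divide)
        finally have e: "exp (- s q / 8) \<le> 1 / (2 * K)" .
        have "exp (- s q / (4 * 1)) = exp (- s q / 8) * exp (- s q / 8)" by (simp add: exp_add[symmetric])
        also have "\<dots> \<le> exp (- s q / 8) * (1 / (2 * K))" using e by (intro mult_left_mono) auto
        finally have "\<psi> (s q) * exp (- s q / (4 * 1)) \<le> \<psi> (s q) * (exp (- s q / 8) * (1 / (2 * K)))"
          using \<psi>(4) by (intro mult_left_mono)
        then show ?thesis using False by simp
      qed
    qed (use int[of 1] int[of 2] int_ind in auto)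
    also have "\<dots> = m + J 2 / (2 * K)"
      using int[of 2] int_ind[of S0] by (simp add: J_def m_def)
    \<comment> \<open>The factor 1 / (2 K) was chosen so that the growth from 1 to 2 returns only
      half of \<open>J 1\<close>, which is then absorbed on the left.\<close>
    also have "J 2 \<le> K * J 1" using J[of 2] by (simp add: K_def)
    then have "m + J 2 / (2 * K) \<le> m + J 1 / 2" using K by (simp add: field_simps)
    finally have J1: "J 1 \<le> 2 * m" by linarith
    have r2: "1 \<le> r\<^sup>2" using r by simp
    \<comment> \<open>Where s < r^2 the cutoff is 1 and the weight for t = r^2 is at least
      exp(-1/4).\<close>
    have "exp (- 1/4) * measure M {q \<in> space M. s q < r\<^sup>2} = (\<integral>q. exp (- 1/4) * indicat_real {q \<in> space M. s q < r\<^sup>2} q \<partial>M)"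
      by (simp add: Int_def conj_commute)
    also have "\<dots> \<le> J (r\<^sup>2)"
      unfolding J_def
    proof (rule integral_mono)
      have "emeasure M {q \<in> space M. s q < r\<^sup>2} < \<infinity>"
        using fin[of "r\<^sup>2"] by (rule le_less_trans[rotated]) (auto intro!: emeasure_mono)
      then have "integrable M (indicator {q \<in> space M. s q < r\<^sup>2} :: 'a \<Rightarrow> real)"
        by (intro integrable_real_indicator) auto
      then show "integrable M (\<lambda>q. exp (- 1/4) * indicat_real {q \<in> space M. s q < r\<^sup>2} q)"
        by (rule integrable_mult_right)
      show "integrable M (\<lambda>q. \<psi> (s q) * exp (- s q / (4 * r\<^sup>2)))" using r2 by (intro int) linarith
      fix q
      show "exp (- 1/4) * indicat_real {q \<in> space M. s q < r\<^sup>2} q \<le> \<psi> (s q) * exp (- s q / (4 * r\<^sup>2))"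
      proof (cases "s q < r\<^sup>2")
        case True
        then have "s q / (4 * r\<^sup>2) \<le> 1 / 4"
          using less_le_trans[OF zero_less_one r2] by (subst pos_divide_le_eq) auto
        then show ?thesis using True \<psi>(6)[of "s q"] by (simp add: indicator_def)
      qed (use \<psi>(4) in simp)
    qed
    also have "\<dots> \<le> exp \<beta> * (r\<^sup>2) powr (n / 2 - \<beta>) * J 1" by (rule J[OF r2])
    also have "\<dots> \<le> exp \<beta> * (r\<^sup>2) powr (n / 2 - \<beta>) * (2 * m)" using J1 by (intro mult_left_mono) auto
    also have "(r\<^sup>2) powr (n / 2 - \<beta>) = r powr (n - 2 * \<beta>)"
    proof -
      have "r\<^sup>2 = r powr 2" using r by (simp add: powr_numeral)
      then have "(r\<^sup>2) powr (n / 2 - \<beta>) = r powr (2 * (n / 2 - \<beta>))" by (simp only: powr_powr)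
      then show ?thesis by (simp add: right_diff_distrib)
    qed
    finally have "exp (1/4) * (exp (- 1/4) * measure M {q \<in> space M. s q < r\<^sup>2})
        \<le> exp (1/4) * (exp \<beta> * r powr (n - 2 * \<beta>) * (2 * m))"
      by (intro mult_left_mono) auto
    moreover have "exp (1/4) * (exp (- 1/4) * y) = y" for y :: real
      by (simp add: mult.assoc[symmetric] exp_add[symmetric])
    ultimately have "measure M {q \<in> space M. s q < r\<^sup>2} \<le> exp (1/4) * (exp \<beta> * r powr (n - 2 * \<beta>) * (2 * m))"
      by (simp only:)
    then show ?thesis by (simp only: mult_ac)
  qed
  \<comment> \<open>The summand 1 keeps the constant positive when \<open>m\<close> is 0.\<close>
  have "emeasure M {q \<in> space M. s q < r\<^sup>2} \<le> ennreal ((exp (1/4) * exp \<beta> * (2 * m) + 1) * r powr (n - 2 * \<beta>))" if r: "1 \<le> r" for r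
  proof -
    have "emeasure M {q \<in> space M. s q < r\<^sup>2} < \<infinity>"
      using fin[of "r\<^sup>2"] by (rule le_less_trans[rotated]) (auto intro!: emeasure_mono)
    then have "emeasure M {q \<in> space M. s q < r\<^sup>2} = ennreal (measure M {q \<in> space M. s q < r\<^sup>2})"
      by (intro emeasure_eq_ennreal_measure) auto
    also have "\<dots> \<le> ennreal ((exp (1/4) * exp \<beta> * (2 * m) + 1) * r powr (n - 2 * \<beta>))"
      using bound[OF r] by (intro ennreal_leI) (simp add: distrib_right add_increasing2)
    finally show ?thesis .
  qed
  moreover have "0 < exp (1/4) * exp \<beta> * (2 * m) + 1"
    by (intro add_nonneg_pos) (auto simp: m_def)
  ultimately show ?thesis by blast
qed

theorem theorem3p1:
  fixes \<A> :: "('m::{t2_space, second_countable_topology}, 'n::finite) chart set"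
    and x :: "'m \<Rightarrow> real^('n + 'p::finite)"
    and \<beta> :: real
  assumes "self_shrinker \<A> x"
    and "complete_immersed \<A> x"
    and "\<not> compact (UNIV :: 'm set)"
    and "proper_map euclidean euclidean x"
    and "0 \<le> \<beta>"
    and "\<beta> \<le> (INF q. (norm (mean_curvature \<A> x q))\<^sup>2)"
  shows "\<exists>C>0. \<forall>r\<ge>1.
    emeasure (riemannian_volume \<A> x) {q. norm (x q) < r}
      \<le> ennreal (C * r powr (real CARD('n) - 2 * \<beta>))"
proof -
  interpret shrinker \<A> x by unfold_locales fact
  let ?s = "\<lambda>q. (norm (x q))\<^sup>2"
  \<comment> \<open>Properness makes these sublevel sets compact, which provides both finite volume
    and compact support of radial test functions.\<close>
  have compact: "compact {q. ?s q \<le> R}" for R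
  proof -
    have "compactin euclidean {q \<in> topspace euclidean. x q \<in> cball 0 (sqrt R)}"
      using assms(4) by (intro compactin_proper_map_preimage[of _ euclidean]) (auto simp: compactin_euclidean_iff)
    \<comment> \<open>This includes negative \<open>R\<close>: there \<open>sqrt R\<close> is
      negative and both sides are false.\<close>
    moreover have "x q \<in> cball 0 (sqrt R) \<longleftrightarrow> ?s q \<le> R" for q
      using real_le_rsqrt[of "norm (x q)" R] real_sqrt_le_iff[of "?s q" R] by auto
    ultimately show ?thesis by (simp add: compactin_euclidean_iff)
  qed
  have w: "\<beta> \<le> w q" for q
  proof -
    \<comment> \<open>On the reals \<open>INF\<close> is known to be a lower bound only when the
      range is bounded below.\<close>
    have "bdd_below (range (\<lambda>q. (norm (H q))\<^sup>2))" by (intro bdd_belowI2[of _ 0]) simp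
    then show ?thesis using assms(6) cINF_lower[of "\<lambda>q. (norm (H q))\<^sup>2" UNIV q] by (simp add: w_def)
  qed
  have s: "continuous_on UNIV ?s" by (intro continuous_intros continuous_x)
  have "\<exists>C>0. \<forall>r\<ge>1. emeasure vol {q \<in> space vol. ?s q < r\<^sup>2} \<le> ennreal (C * r powr (real CARD('n) - 2 * \<beta>))"
  proof (rule volume_growth[where w=w])
    show "?s \<in> borel_measurable vol" "w \<in> borel_measurable vol"
      using borel_measurable_continuous_onI[OF s] borel_measurable_continuous_onI[OF continuous_w]
      by (simp_all cong: measurable_cong_sets)
    show "emeasure vol {q \<in> space vol. ?s q \<le> R} < \<infinity>" for R
      using emeasure_vol_compact[OF compact] by simp
    show "integrable vol (\<lambda>q. 2 * \<phi>' (?s q) * (?s q - 4 * w q) + \<phi> (?s q) * (real CARD('n) - 2 * w q)) \<and>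
      (\<integral>q. 2 * \<phi>' (?s q) * (?s q - 4 * w q) + \<phi> (?s q) * (real CARD('n) - 2 * w q) \<partial>vol) = 0"
      if \<phi>: "\<And>t. (\<phi> has_real_derivative \<phi>' t) (at t)" "continuous_on UNIV \<phi>'" and R: "\<And>t. R \<le> t \<Longrightarrow> \<phi> t = 0"
      for \<phi> \<phi>' R
    proof -
      have supp: "\<phi> (?s q) = 0" if "q \<notin> {q. ?s q \<le> R}" for q using that R by simp
      show ?thesis
        using integral_div_term[OF radial_C1m(1)[OF \<phi>] compact supp] div_term_integrable[OF radial_C1m(1)[OF \<phi>] compact supp]
        unfolding radial_C1m(2)[OF \<phi>] by blast
    qed
  qed (use assms(5) w w_bounds in auto)
  then obtain C where C: "C > 0"
    "\<And>r. 1 \<le> r \<Longrightarrow> emeasure vol {q \<in> space vol. ?s q < r\<^sup>2} \<le> ennreal (C * r powr (real CARD('n) - 2 * \<beta>))"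
    by blast
  have "emeasure vol {q. norm (x q) < r} \<le> ennreal (C * r powr (real CARD('n) - 2 * \<beta>))" if r: "1 \<le> r" for r
  proof -
    have "norm y < r \<longleftrightarrow> (norm y)\<^sup>2 < r\<^sup>2" for y :: "real^('n + 'p)"
      using r power_strict_mono[of "norm y" r 2] power2_less_imp_less[of "norm y" r] by auto
    then have "{q. norm (x q) < r} = {q \<in> space vol. ?s q < r\<^sup>2}" by simp
    then show ?thesis using C(2)[OF r] by (simp only:)
  qed
  then show ?thesis using C(1) by blast
qed

end
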